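(* Assume that $k^\star\le\bar k_n\lesssim\log n/\log\log n$. Then with the prior distribution $\Pi$ satisfying conditions (P1), (P2) and (P3) described in the context, we have $$\sup_{\nu^\star\in\mathcal M_{k^\star}}\mathsf P^{(n)}_{\nu^\star*\Phi}\Big[\Pi\big(\mathsf W_1(\nu,\nu^\star)\ge M\bar\epsilon_{n,k^\star}\,\big|\,X_{1:n}\big)\Big]=o(1)$$ for some universal constant $M>0$, where $$\bar\epsilon_{n,k^\star}:=(k^\star)^{3/2}\Big(\frac{\log^2 n}{n}\Big)^{\frac1{4k^\star-2}}.$$
   Context: Notation. $\mathbb N=\{1,2,\dots\}$, $[k]:=\{1,\dots,k\}$, $\Delta_k:=\{w\in[0,1]^k:\sum_{j=1}^k w_j=1\}$. For positive sequences, $a_n\lesssim b_n$ means that there is a constant $C>0$ with $a_n\le Cb_n$ for any $n\in\mathbb N$; $o(1)$ is as $n\to\infty$. Fix $L>0$. $\mathcal M_k$ is the set of distributions $\sum_{j=1}^k w_j\delta_{\theta_j}$ with $(w_1,\dots,w_k)\in\Delta_k$ and $\theta_1,\dots,\theta_k\in[-L,L]$ ($\delta_\theta$ is the Dirac measure at $\theta$), and $\mathcal M:=\bigcup_{k\in\mathbb N}\mathcal M_k$. $\Phi$ is the standard normal distribution and, for $\nu=\sum_j w_j\delta_{\theta_j}$, $\nu*\Phi=\sum_j w_j\mathrm N(\theta_j,1)$. $\mathsf P_G^{(n)}$ denotes probability or expectation when $X_1,\dots,X_n$ are i.i.d. from $G$, $p_G^{(n)}$ is the joint Lebesgue density, and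 $X_{1:n}=(X_1,\dots,X_n)$. For $\nu=\sum_{j=1}^kw_j\delta_{\theta_j}$ and $\nu'=\sum_{h=1}^{k'}w'_h\delta_{\theta'_h}$, $\mathsf W_1(\nu,\nu')$ is the infimum of $\sum_{j,h}p_{jh}|\theta_j-\theta'_h|$ over all $(p_{jh})\in[0,1]^{k\times k'}$ with $\sum_hp_{jh}=w_j$ and $\sum_jp_{jh}=w'_h$. Setting. The data are i.i.d. from $\nu^\star*\Phi$ with $\nu^\star\in\mathcal M_{k^\star}$; both the true mixing distribution $\nu^\star$ and the true number of components $k^\star\in\mathbb N$ may vary with $n$, and $\bar k_n$ is a known upper bound on $k^\star$. The prior $\Pi$ first samples $k\in\mathbb N$ from $\Pi(k)$ and then samples the atoms $\theta\in[-L,L]^k$ from $\Pi(\theta|k)$ and the weights $w\in\Delta_k$ from $\Pi(w|k)$, which induces a distribution on $\mathcal M$ through $\nu=\sum_{j=1}^kw_j\delta_{\theta_j}$. The posterior is $\Pi(\mathrm d\nu|X_{1:n}):=p^{(n)}_{\nu*\Phi}(X_{1:n})\Pi(\mathrm d\nu)\big/\int p^{(n)}_{\nu*\Phi}(X_{1:n})\Pi(\mathrm d\nu)$. Conditions on the prior. (P1) The prior on $k$ is sample size dependent. There are a constant $c_1>0$ and a sufficiently large constant $A>0$ such that for any $n\in\mathbb N$ and any $k^\circ\in\mathbb N$, $\Pi(k=k^\circ+1)/\Pi(k=k^\circ)\le c_1e^{-A\bar k_n\log n}$. Additionally, there are constants $c_2>0$ and $c_3>0$ such that for any $n\in\mathbb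 N$ and any $k^\dagger\in[\bar k_n]$, $\Pi(k=k^\dagger)\ge c_2e^{-(c_3\bar k_n\log n)k^\dagger}$. (P2) For any $k\in\mathbb N$ and any $(w_1^0,\dots,w_k^0)\in\Delta_k$, there are positive constants $c_4$ and $c_5$ such that for any $\eta\in(0,1/k)$, $\Pi\big(\sum_{j=1}^k|w_j-w_j^0|\le\eta\,\big|\,k\big)\ge c_4\eta^{c_5k}$. (P3) For any $k\in\mathbb N$ and any $\theta^0\in[-L,L]^k$, there are positive constants $c_6$ and $c_7$ such that for any $\eta>0$, $\Pi\big(\max_{1\le j\le k}|\theta_j-\theta_j^0|\le\eta\,\big|\,k\big)\ge c_6\eta^{c_7k}$.
   Formalization: In (P3) the bound is required only for η in (0,1/k), since no prior satisfies it for all η>0; in (P2) and (P3) the constants c4,…,c7 are uniform in k and in the centre w⁰ or θ⁰, since the claim fails if they may depend on k. *)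

theory Defs
  imports "HOL-Probability.Probability"
begin

section \<open>Finite mixing distributions\<close>

definition weight_simplex :: "nat \<Rightarrow> (nat \<Rightarrow> real) set" where
  "weight_simplex k = {w \<in> {1..k} \<rightarrow>\<^sub>E {0..1}. (\<Sum>j\<in>{1..k}. w j) = 1}"

definition atom_box :: "real \<Rightarrow> nat \<Rightarrow> (nat \<Rightarrow> real) set" where
  "atom_box L k = {1..k} \<rightarrow>\<^sub>E {-L..L}"

text \<open>The measure $\sum_{j=1}^k w_j \delta_{\theta_j}$: the image of the weights on the index
  set under $j \mapsto \theta_j$ (see \<open>emeasure_mixing\<close> below).\<close>

definition mixing :: "nat \<Rightarrow> (nat \<Rightarrow> real) \<Rightarrow> (nat \<Rightarrow> real) \<Rightarrow> real measure" where
  "mixing k w \<theta> = distr (point_measure {1..k} (\<lambda>j. ennreal (w j))) borel \<theta>"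

definition mixing_dists_k :: "real \<Rightarrow> nat \<Rightarrow> real measure set" where
  "mixing_dists_k L k = {mixing k w \<theta> | w \<theta>. w \<in> weight_simplex k \<and> \<theta> \<in> atom_box L k}"

definition mixing_dists :: "real \<Rightarrow> real measure set" where
  "mixing_dists L = (\<Union>k\<in>{1..}. mixing_dists_k L k)"

text \<open>The set of mixing distributions carries the trace of the usual (evaluation)
  sigma-algebra on probability measures, which is the Borel sigma-algebra of weak convergence.\<close>

definition mixing_space :: "real \<Rightarrow> real measure measure" where
  "mixing_space L = restrict_space (prob_algebra borel) (mixing_dists L)"


section \<open>The Wasserstein distance\<close>

definition couplings ::
    "nat \<Rightarrow> (nat \<Rightarrow> real) \<Rightarrow> nat \<Rightarrow> (nat \<Rightarrow> real) \<Rightarrow> (nat \<Rightarrow> nat \<Rightarrow> real) set" where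
  "couplings k w k' w' =
    {p. (\<forall>j\<in>{1..k}. \<forall>h\<in>{1..k'}. p j h \<in> {0..1}) \<and>
        (\<forall>j\<in>{1..k}. (\<Sum>h\<in>{1..k'}. p j h) = w j) \<and>
        (\<forall>h\<in>{1..k'}. (\<Sum>j\<in>{1..k}. p j h) = w' h)}"

text \<open>A mixing distribution does not determine its representation by weights and atoms
  (permutations, repeated atoms, zero weights), so the infimum is taken over the couplings of all
  representations; by \<open>wasserstein1_mixing\<close> below, each single pair of representations already
  attains the same infimum.\<close>

definition wasserstein1 :: "real measure \<Rightarrow> real measure \<Rightarrow> real" where
  "wasserstein1 \<nu> \<nu>' = Inf {(\<Sum>j\<in>{1..k}. \<Sum>h\<in>{1..k'}. p j h * \<bar>\<theta> j - \<theta>' h\<bar>) | k w \<theta> k' w' \<theta>' p.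
     w \<in> weight_simplex k \<and> w' \<in> weight_simplex k' \<and> \<nu> = mixing k w \<theta> \<and> \<nu>' = mixing k' w' \<theta>' \<and>
     p \<in> couplings k w k' w'}"


section \<open>Gaussian mixtures, prior and posterior\<close>

definition gauss_mix :: "real measure \<Rightarrow> real measure" where
  "gauss_mix \<nu> = (\<nu> \<star> density lborel (\<lambda>x. ennreal (std_normal_density x)))"

text \<open>The version $x \mapsto \int \varphi(x - \theta)\, \nu(d\theta)$ of the Lebesgue density of
  \<open>gauss_mix \<nu>\<close> (see \<open>gauss_mix_eq_density\<close> below). A posterior needs one fixed version
  for every \<open>\<nu>\<close>, so a Radon-Nikodym derivative chosen separately for each \<open>\<nu>\<close> would not do.\<close>

definition mix_density :: "real measure \<Rightarrow> real \<Rightarrow> ennreal" where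
  "mix_density \<nu> x = (\<integral>\<^sup>+ \<theta>. ennreal (normal_density \<theta> 1 x) \<partial>\<nu>)"

definition likelihood :: "nat \<Rightarrow> real measure \<Rightarrow> (nat \<Rightarrow> real) \<Rightarrow> ennreal" where
  "likelihood n \<nu> x = (\<Prod>i\<in>{1..n}. mix_density \<nu> (x i))"

definition sample_dist :: "nat \<Rightarrow> real measure \<Rightarrow> (nat \<Rightarrow> real) measure" where
  "sample_dist n G = (\<Pi>\<^sub>M i\<in>{1..n}. G)"

text \<open>The prior on the mixing distribution, from the prior \<open>\<kappa>\<close> on the number of components and the
  conditional priors of the atoms and of the weights, which are independent given \<open>k\<close>.\<close>

definition mixing_prior ::
    "real \<Rightarrow> nat measure \<Rightarrow> (nat \<Rightarrow> (nat \<Rightarrow> real) measure) \<Rightarrow> (nat \<Rightarrow> (nat \<Rightarrow> real) measure)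
      \<Rightarrow> real measure measure" where
  "mixing_prior L \<kappa> \<Pi>\<theta> \<Pi>w =
    \<kappa> \<bind> (\<lambda>k. distr (\<Pi>\<theta> k \<Otimes>\<^sub>M \<Pi>w k) (mixing_space L) (\<lambda>(\<theta>, w). mixing k w \<theta>))"

definition posterior :: "nat \<Rightarrow> real measure measure \<Rightarrow> (nat \<Rightarrow> real) \<Rightarrow> real measure measure" where
  "posterior n P x =
    density P (\<lambda>\<nu>. likelihood n \<nu> x / (\<integral>\<^sup>+ \<nu>'. likelihood n \<nu>' x \<partial>P))"


section \<open>Conditions on the prior\<close>

definition prior_components ::
    "real \<Rightarrow> (nat \<Rightarrow> nat measure) \<Rightarrow> (nat \<Rightarrow> (nat \<Rightarrow> real) measure) \<Rightarrow> (nat \<Rightarrow> (nat \<Rightarrow> real) measure)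
      \<Rightarrow> bool" where
  "prior_components L \<Pi>k \<Pi>\<theta> \<Pi>w \<longleftrightarrow>
    (\<forall>n\<ge>1. \<Pi>k n \<in> space (prob_algebra (count_space {1..}))) \<and>
    (\<forall>k\<ge>1. \<Pi>\<theta> k \<in> space (prob_algebra (restrict_space (\<Pi>\<^sub>M j\<in>{1..k}. borel) (atom_box L k)))) \<and>
    (\<forall>k\<ge>1. \<Pi>w k \<in> space (prob_algebra (restrict_space (\<Pi>\<^sub>M j\<in>{1..k}. borel) (weight_simplex k))))"

text \<open>The bound on the ratio \<open>\<Pi>(k = k\<^sub>0 + 1) / \<Pi>(k = k\<^sub>0)\<close> is multiplied out: with
  \<open>x / 0 = 0\<close> it would say nothing where the denominator vanishes.\<close>

definition prior_P1 ::
    "real \<Rightarrow> real \<Rightarrow> real \<Rightarrow> real \<Rightarrow> (nat \<Rightarrow> nat) \<Rightarrow> (nat \<Rightarrow> nat measure) \<Rightarrow> bool" where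
  "prior_P1 A c1 c2 c3 kbar \<Pi>k \<longleftrightarrow>
    (\<forall>n\<ge>1. \<forall>k\<^sub>0\<ge>1. measure (\<Pi>k n) {k\<^sub>0 + 1}
        \<le> c1 * exp (- A * real (kbar n) * ln (real n)) * measure (\<Pi>k n) {k\<^sub>0}) \<and>
    (\<forall>n\<ge>1. \<forall>k\<in>{1..kbar n}. measure (\<Pi>k n) {k}
        \<ge> c2 * exp (- (c3 * real (kbar n) * ln (real n)) * real k))"

definition prior_P2 :: "real \<Rightarrow> real \<Rightarrow> (nat \<Rightarrow> (nat \<Rightarrow> real) measure) \<Rightarrow> bool" where
  "prior_P2 c4 c5 \<Pi>w \<longleftrightarrow>
    (\<forall>k\<ge>1. \<forall>w\<^sub>0\<in>weight_simplex k. \<forall>\<eta>\<in>{0<..<1 / real k}.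
      measure (\<Pi>w k) {w \<in> space (\<Pi>w k). (\<Sum>j\<in>{1..k}. \<bar>w j - w\<^sub>0 j\<bar>) \<le> \<eta>}
        \<ge> c4 * \<eta> powr (c5 * real k))"

text \<open>The range of \<open>\<eta>\<close> is the one of \<open>prior_P2\<close>: no probability measure satisfies the bound for
  all \<open>\<eta> > 0\<close>, because its right-hand side is unbounded in \<open>\<eta>\<close>.\<close>

definition prior_P3 :: "real \<Rightarrow> real \<Rightarrow> real \<Rightarrow> (nat \<Rightarrow> (nat \<Rightarrow> real) measure) \<Rightarrow> bool" where
  "prior_P3 L c6 c7 \<Pi>\<theta> \<longleftrightarrow>
    (\<forall>k\<ge>1. \<forall>\<theta>\<^sub>0\<in>atom_box L k. \<forall>\<eta>\<in>{0<..<1 / real k}.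
      measure (\<Pi>\<theta> k) {\<theta> \<in> space (\<Pi>\<theta> k). (MAX j\<in>{1..k}. \<bar>\<theta> j - \<theta>\<^sub>0 j\<bar>) \<le> \<eta>}
        \<ge> c6 * \<eta> powr (c7 * real k))"

definition contraction_rate :: "nat \<Rightarrow> nat \<Rightarrow> real" where
  "contraction_rate n k =
    real k powr (3 / 2) * ((ln (real n))\<^sup>2 / real n) powr (1 / (4 * real k - 2))"


section \<open>Consistency of the definitions\<close>

lemma emeasure_mixing:
  assumes "w \<in> weight_simplex k" "B \<in> sets borel"
  shows "emeasure (mixing k w \<theta>) B = (\<Sum>j\<in>{1..k}. ennreal (w j) * indicator B (\<theta> j))"
proof -
  have "emeasure (mixing k w \<theta>) B = (\<Sum>j\<in>\<theta> -` B \<inter> {1..k}. ennreal (w j))"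
    using assms unfolding mixing_def
    by (subst emeasure_distr) (auto simp: space_point_measure emeasure_point_measure_finite)
  also have "\<dots> = (\<Sum>j\<in>{1..k}. ennreal (w j) * indicator B (\<theta> j))"
    by (rule sum.mono_neutral_cong_left) (auto simp: indicator_def)
  finally show ?thesis .
qed

lemma sets_mixing [simp]: "sets (mixing k w \<theta>) = sets borel"
  by (simp add: mixing_def)

lemma prob_space_mixing:
  assumes "w \<in> weight_simplex k"
  shows "prob_space (mixing k w \<theta>)"
proof
  have "(\<Sum>j\<in>{1..k}. ennreal (w j)) = 1"
    using assms by (subst sum_ennreal) (auto simp: weight_simplex_def)
  then show "emeasure (mixing k w \<theta>) (space (mixing k w \<theta>)) = 1"
    using emeasure_mixing[OF assms, of UNIV \<theta>] by (simp add: mixing_def)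
qed

lemma gauss_mix_eq_density:
  assumes "\<nu> \<in> mixing_dists L"
  shows "gauss_mix \<nu> = density lborel (mix_density \<nu>)"
proof -
  let ?N = "density lborel (\<lambda>x. ennreal (std_normal_density x))"
  from assms have sets: "sets \<nu> = sets borel" and "prob_space \<nu>"
    by (auto simp: mixing_dists_def mixing_dists_k_def intro: prob_space_mixing)
  interpret \<nu>: prob_space \<nu> by fact
  interpret N: prob_space ?N
    by (rule prob_space_normal_density) simp
  interpret P: pair_sigma_finite \<nu> lborel ..
  note sets[measurable_cong]
  show ?thesis
  proof (rule measure_eqI)
    fix B assume "B \<in> sets (gauss_mix \<nu>)"
    then have B[measurable]: "B \<in> sets borel" by (simp add: gauss_mix_def)
    have "emeasure (gauss_mix \<nu>) B = (\<integral>\<^sup>+\<theta>. \<integral>\<^sup>+y. indicator B (\<theta> + y) \<partial>?N \<partial>\<nu>)"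
      unfolding gauss_mix_def
      by (rule convolution_emeasure') (auto simp: sets \<nu>.finite_measure_axioms N.finite_measure_axioms)
    also have "\<dots> = (\<integral>\<^sup>+\<theta>. \<integral>\<^sup>+x. ennreal (normal_density \<theta> 1 x) * indicator B x \<partial>lborel \<partial>\<nu>)"
    proof (rule nn_integral_cong)
      fix \<theta> :: real
      have "(\<integral>\<^sup>+y. indicator B (\<theta> + y) \<partial>?N)
          = (\<integral>\<^sup>+y. ennreal (std_normal_density y) * indicator B (\<theta> + y) \<partial>lborel)"
        by (subst nn_integral_density) auto
      also have "\<dots> = (\<integral>\<^sup>+x. ennreal (normal_density \<theta> 1 x) * indicator B x \<partial>lborel)"
        using nn_integral_real_affine[of "\<lambda>x. ennreal (normal_density \<theta> 1 x) * indicator B x" 1 \<theta>]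
        by (simp add: normal_density_def)
      finally show "(\<integral>\<^sup>+y. indicator B (\<theta> + y) \<partial>?N)
          = (\<integral>\<^sup>+x. ennreal (normal_density \<theta> 1 x) * indicator B x \<partial>lborel)" .
    qed
    also have "\<dots> = (\<integral>\<^sup>+x. \<integral>\<^sup>+\<theta>. ennreal (normal_density \<theta> 1 x) * indicator B x \<partial>\<nu> \<partial>lborel)"
      unfolding normal_density_def by (rule P.Fubini'[symmetric]) measurable
    also have "\<dots> = (\<integral>\<^sup>+x. mix_density \<nu> x * indicator B x \<partial>lborel)"
      unfolding mix_density_def normal_density_def by (intro nn_integral_cong nn_integral_multc) measurable
    also have "\<dots> = emeasure (density lborel (mix_density \<nu>)) B"
      unfolding mix_density_def normal_density_def by (subst emeasure_density) auto
    finally show "emeasure (gauss_mix \<nu>) B = emeasure (density lborel (mix_density \<nu>)) B" .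
  qed (simp add: gauss_mix_def)
qed

lemma measurable_mixing:
  assumes k: "k \<ge> 1"
  shows "(\<lambda>(\<theta>, w). mixing k w \<theta>)
    \<in> restrict_space (\<Pi>\<^sub>M j\<in>{1..k}. borel) (atom_box L k) \<Otimes>\<^sub>M
      restrict_space (\<Pi>\<^sub>M j\<in>{1..k}. borel) (weight_simplex k) \<rightarrow>\<^sub>M mixing_space L"
    (is "?f \<in> ?T \<Otimes>\<^sub>M ?W \<rightarrow>\<^sub>M _")
proof -
  have sp: "\<theta> \<in> atom_box L k" "w \<in> weight_simplex k" if "(\<theta>, w) \<in> space (?T \<Otimes>\<^sub>M ?W)" for \<theta> w
    using that by (auto simp: space_pair_measure space_restrict_space)
  have [measurable]: "(\<lambda>z. fst z j) \<in> borel_measurable (?T \<Otimes>\<^sub>M ?W)"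
      "(\<lambda>z. snd z j) \<in> borel_measurable (?T \<Otimes>\<^sub>M ?W)" if "j \<in> {1..k}" for j
  proof -
    have "(\<lambda>x. x j) \<in> borel_measurable ?T" "(\<lambda>x. x j) \<in> borel_measurable ?W"
      using that by (auto intro!: measurable_restrict_space1 measurable_component_singleton)
    then show "(\<lambda>z. fst z j) \<in> borel_measurable (?T \<Otimes>\<^sub>M ?W)"
      "(\<lambda>z. snd z j) \<in> borel_measurable (?T \<Otimes>\<^sub>M ?W)"
      using measurable_compose[OF measurable_fst] measurable_compose[OF measurable_snd] by blast+
  qed
  have "?f \<in> ?T \<Otimes>\<^sub>M ?W \<rightarrow>\<^sub>M prob_algebra borel"
  proof (rule measurable_prob_algebraI)
    show "prob_space (?f z)" if "z \<in> space (?T \<Otimes>\<^sub>M ?W)" for z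
      using that sp(2)[of "fst z" "snd z"] prob_space_mixing[of "snd z" k "fst z"]
      by (simp add: split_beta)
    show "?f \<in> ?T \<Otimes>\<^sub>M ?W \<rightarrow>\<^sub>M subprob_algebra borel"
    proof (rule measurable_subprob_algebra)
      show "subprob_space (?f z)" if "z \<in> space (?T \<Otimes>\<^sub>M ?W)" for z
        using that sp(2)[of "fst z" "snd z"] prob_space_mixing[of "snd z" k "fst z"]
        by (simp add: split_beta prob_space_imp_subprob_space)
      fix B :: "real set" assume B[measurable]: "B \<in> sets borel"
      have "(\<lambda>z. \<Sum>j\<in>{1..k}. ennreal (snd z j) * indicator B (fst z j))
          \<in> borel_measurable (?T \<Otimes>\<^sub>M ?W)"
        by measurable
      then show "(\<lambda>z. emeasure (?f z) B) \<in> borel_measurable (?T \<Otimes>\<^sub>M ?W)"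
        by (rule measurable_cong[THEN iffD1, rotated]) (auto simp: emeasure_mixing[OF sp(2) B])
    qed auto
  qed
  moreover have "mixing k w \<theta> \<in> mixing_dists L" if "\<theta> \<in> atom_box L k" "w \<in> weight_simplex k" for \<theta> w
    using k that unfolding mixing_dists_def mixing_dists_k_def by blast
  then have "?f \<in> space (?T \<Otimes>\<^sub>M ?W) \<rightarrow> mixing_dists L"
    using sp by (intro funcsetI) (metis (no_types, lifting) case_prod_beta prod.collapse)
  ultimately show ?thesis
    unfolding mixing_space_def by (intro measurable_restrict_space2)
qed

lemma mixing_prior_in_prob_algebra:
  assumes "prior_components L \<Pi>k \<Pi>\<theta> \<Pi>w" "n \<ge> 1"
  shows "mixing_prior L (\<Pi>k n) \<Pi>\<theta> \<Pi>w \<in> space (prob_algebra (mixing_space L))"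
proof -
  let ?g = "\<lambda>k. distr (\<Pi>\<theta> k \<Otimes>\<^sub>M \<Pi>w k) (mixing_space L) (\<lambda>(\<theta>, w). mixing k w \<theta>)"
  have g: "?g k \<in> space (prob_algebra (mixing_space L))" if k: "k \<ge> 1" for k
  proof -
    from assms k have T: "prob_space (\<Pi>\<theta> k)" "prob_space (\<Pi>w k)"
      and S[measurable_cong]:
          "sets (\<Pi>\<theta> k) = sets (restrict_space (\<Pi>\<^sub>M j\<in>{1..k}. borel) (atom_box L k))"
          "sets (\<Pi>w k) = sets (restrict_space (\<Pi>\<^sub>M j\<in>{1..k}. borel) (weight_simplex k))"
      by (auto simp: prior_components_def space_prob_algebra)
    interpret T: prob_space "\<Pi>\<theta> k" by fact
    interpret W: prob_space "\<Pi>w k" by fact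
    interpret P: pair_prob_space "\<Pi>\<theta> k" "\<Pi>w k" ..
    have "(\<lambda>(\<theta>, w). mixing k w \<theta>) \<in> \<Pi>\<theta> k \<Otimes>\<^sub>M \<Pi>w k \<rightarrow>\<^sub>M mixing_space L"
      using measurable_mixing[OF k, of L] by (simp cong: measurable_cong_sets add: S)
    then show ?thesis
      by (auto simp: space_prob_algebra intro!: P.prob_space_distr)
  qed
  then have "?g \<in> count_space {1..} \<rightarrow>\<^sub>M prob_algebra (mixing_space L)"
    by (auto simp: measurable_count_space_eq1)
  moreover have "\<Pi>k n \<in> space (prob_algebra (count_space {1..}))"
    using assms by (auto simp: prior_components_def)
  moreover have "(\<lambda>_. \<Pi>k n) \<in> count_space (UNIV :: unit set) \<rightarrow>\<^sub>M prob_algebra (count_space {1..})"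
    using calculation by simp
  ultimately have "(\<lambda>_::unit. \<Pi>k n \<bind> ?g) \<in> count_space UNIV \<rightarrow>\<^sub>M prob_algebra (mixing_space L)"
    by (intro measurable_bind_prob_space[where N = "count_space {1..}"])
  then show ?thesis
    unfolding mixing_prior_def by (simp add: measurable_count_space_eq1 Pi_iff)
qed

lemma weight_at_point:
  assumes "w \<in> weight_simplex k"
  shows "measure (mixing k w \<theta>) {t} = (\<Sum>j | j \<in> {1..k} \<and> \<theta> j = t. w j)"
proof -
  have "emeasure (mixing k w \<theta>) {t} = (\<Sum>j | j \<in> {1..k} \<and> \<theta> j = t. ennreal (w j))"
    using assms
    by (subst emeasure_mixing) (auto simp: indicator_def intro!: sum.mono_neutral_cong_right)
  also have "\<dots> = ennreal (\<Sum>j | j \<in> {1..k} \<and> \<theta> j = t. w j)"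
    using assms by (subst sum_ennreal) (auto simp: weight_simplex_def)
  finally show ?thesis
    using assms by (auto simp: measure_def weight_simplex_def intro!: enn2real_ennreal sum_nonneg)
qed

lemma coupling_transfer:
  assumes w: "w \<in> weight_simplex k" "v \<in> weight_simplex l" and eq: "mixing k w \<theta> = mixing l v \<tau>"
    and p: "p \<in> couplings k w k' w'"
  shows "\<exists>q\<in>couplings l v k' w'. (\<Sum>i\<in>{1..l}. \<Sum>h\<in>{1..k'}. q i h * \<bar>\<tau> i - \<theta>' h\<bar>)
    = (\<Sum>j\<in>{1..k}. \<Sum>h\<in>{1..k'}. p j h * \<bar>\<theta> j - \<theta>' h\<bar>)"
proof -
  define m where "m t = measure (mixing k w \<theta>) {t}" for t
  have m: "m t = (\<Sum>j | j \<in> {1..k} \<and> \<theta> j = t. w j)" "m t = (\<Sum>i | i \<in> {1..l} \<and> \<tau> i = t. v i)" for t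
    using weight_at_point[OF w(1), of \<theta>] weight_at_point[OF w(2), of \<tau>] eq by (simp_all add: m_def)
  have w0: "0 \<le> w j" if "j \<in> {1..k}" for j using w that by (auto simp: weight_simplex_def)
  have v0: "0 \<le> v i" "v i \<le> 1" if "i \<in> {1..l}" for i using w that by (auto simp: weight_simplex_def)
  have p0: "0 \<le> p j h" if "j \<in> {1..k}" "h \<in> {1..k'}" for j h
    using p that by (auto simp: couplings_def)
  have prow: "(\<Sum>h\<in>{1..k'}. p j h) = w j" if "j \<in> {1..k}" for j
    using p that by (auto simp: couplings_def)
  have pcol: "(\<Sum>j\<in>{1..k}. p j h) = w' h" if "h \<in> {1..k'}" for h
    using p that by (auto simp: couplings_def)
  have pz: "p j h = 0" if j: "j \<in> {1..k}" and h: "h \<in> {1..k'}" and z: "m (\<theta> j) = 0" for j h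
  proof -
    have "w j = 0"
      using z j w0 unfolding m(1)
      by (subst (asm) sum_nonneg_eq_0_iff) auto
    then have "\<forall>h\<in>{1..k'}. p j h = 0"
      using prow[OF j] p0[OF j] by (subst sum_nonneg_eq_0_iff[symmetric]) auto
    then show ?thesis using h by blast
  qed
  have vz: "v i = 0" if i: "i \<in> {1..l}" and z: "m (\<tau> i) = 0" for i
    using z i v0 unfolding m(2) by (subst (asm) sum_nonneg_eq_0_iff) auto
  define q where "q i h = (\<Sum>j | j \<in> {1..k} \<and> \<theta> j = \<tau> i. p j h) * (v i / m (\<tau> i))" for i h
  have swap: "(\<Sum>i\<in>{1..l}. q i h * f (\<tau> i)) = (\<Sum>j\<in>{1..k}. p j h * f (\<theta> j))"
    if h: "h \<in> {1..k'}" for h and f :: "real \<Rightarrow> real"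
  proof -
    have "(\<Sum>i\<in>{1..l}. q i h * f (\<tau> i))
        = (\<Sum>i\<in>{1..l}. \<Sum>j | j \<in> {1..k} \<and> \<theta> j = \<tau> i. p j h * f (\<theta> j) * (v i / m (\<theta> j)))"
      unfolding q_def sum_distrib_right by (intro sum.cong) (auto simp: mult_ac)
    also have "\<dots> = (\<Sum>j\<in>{1..k}. \<Sum>i | i \<in> {1..l} \<and> \<theta> j = \<tau> i. p j h * f (\<theta> j) * (v i / m (\<theta> j)))"
      by (rule sum.swap_restrict) auto
    also have "\<dots> = (\<Sum>j\<in>{1..k}. p j h * f (\<theta> j))"
    proof (rule sum.cong[OF refl])
      fix j assume j: "j \<in> {1..k}"
      have "(\<Sum>i | i \<in> {1..l} \<and> \<theta> j = \<tau> i. p j h * f (\<theta> j) * (v i / m (\<theta> j)))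
          = p j h * f (\<theta> j) * ((\<Sum>i | i \<in> {1..l} \<and> \<tau> i = \<theta> j. v i) / m (\<theta> j))"
        unfolding sum_distrib_left sum_divide_distrib by (intro sum.cong) auto
      also have "\<dots> = p j h * f (\<theta> j)"
        unfolding m(2)[symmetric] using pz[OF j h] by (cases "m (\<theta> j) = 0") auto
      finally show "(\<Sum>i | i \<in> {1..l} \<and> \<theta> j = \<tau> i. p j h * f (\<theta> j) * (v i / m (\<theta> j)))
          = p j h * f (\<theta> j)" .
    qed
    finally show ?thesis .
  qed
  have m0: "0 \<le> m t" for t by (simp add: m_def)
  have q0: "0 \<le> q i h" if "i \<in> {1..l}" "h \<in> {1..k'}" for i h
    unfolding q_def using that m0 by (intro mult_nonneg_nonneg sum_nonneg divide_nonneg_nonneg p0 v0) auto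
  have qrow: "(\<Sum>h\<in>{1..k'}. q i h) = v i" if i: "i \<in> {1..l}" for i
  proof -
    have "(\<Sum>h\<in>{1..k'}. q i h)
        = (\<Sum>j | j \<in> {1..k} \<and> \<theta> j = \<tau> i. \<Sum>h\<in>{1..k'}. p j h) * (v i / m (\<tau> i))"
      unfolding q_def sum_distrib_right[symmetric] by (subst sum.swap) (rule refl)
    also have "\<dots> = m (\<tau> i) * (v i / m (\<tau> i))"
      unfolding m(1) using prow by (intro arg_cong2[where f = "(*)"] sum.cong refl) auto
    also have "\<dots> = v i" using vz[OF i] by auto
    finally show ?thesis .
  qed
  have qcol: "(\<Sum>i\<in>{1..l}. q i h) = w' h" if "h \<in> {1..k'}" for h
    using swap[OF that, of "\<lambda>_. 1"] pcol[OF that] by simp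
  have q1: "q i h \<le> 1" if i: "i \<in> {1..l}" and h: "h \<in> {1..k'}" for i h
  proof -
    have "q i h \<le> (\<Sum>h\<in>{1..k'}. q i h)"
      using h q0[OF i] by (intro member_le_sum) auto
    then show ?thesis using qrow[OF i] v0(2)[OF i] by simp
  qed
  have "q \<in> couplings l v k' w'"
    using q0 q1 qrow qcol by (auto simp: couplings_def)
  moreover have "(\<Sum>i\<in>{1..l}. \<Sum>h\<in>{1..k'}. q i h * \<bar>\<tau> i - \<theta>' h\<bar>)
      = (\<Sum>j\<in>{1..k}. \<Sum>h\<in>{1..k'}. p j h * \<bar>\<theta> j - \<theta>' h\<bar>)"
    unfolding sum.swap[of _ "{1..k'}" "{1..l}"] sum.swap[of _ "{1..k'}" "{1..k}"]
    by (rule sum.cong[OF refl], rule swap)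
  ultimately show ?thesis by blast
qed

lemma couplings_flip: "p \<in> couplings k w k' w' \<longleftrightarrow> (\<lambda>h j. p j h) \<in> couplings k' w' k w"
  by (auto simp: couplings_def)

lemma wasserstein1_mixing:
  assumes w: "w \<in> weight_simplex k" and w': "w' \<in> weight_simplex k'"
  shows "wasserstein1 (mixing k w \<theta>) (mixing k' w' \<theta>') =
    (INF p\<in>couplings k w k' w'. \<Sum>j\<in>{1..k}. \<Sum>h\<in>{1..k'}. p j h * \<bar>\<theta> j - \<theta>' h\<bar>)"
proof -
  have transfer: "\<exists>r\<in>couplings k w k' w'. (\<Sum>j\<in>{1..k}. \<Sum>h\<in>{1..k'}. r j h * \<bar>\<theta> j - \<theta>' h\<bar>)
      = (\<Sum>i\<in>{1..l}. \<Sum>g\<in>{1..l'}. p i g * \<bar>\<tau> i - \<tau>' g\<bar>)"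
    if v: "v \<in> weight_simplex l" and v': "v' \<in> weight_simplex l'"
      and eq: "mixing k w \<theta> = mixing l v \<tau>" and eq': "mixing k' w' \<theta>' = mixing l' v' \<tau>'"
      and p: "p \<in> couplings l v l' v'" for l v \<tau> l' v' \<tau>' p
  proof -
    obtain q where q: "q \<in> couplings k w l' v'"
      "(\<Sum>j\<in>{1..k}. \<Sum>g\<in>{1..l'}. q j g * \<bar>\<theta> j - \<tau>' g\<bar>)
        = (\<Sum>i\<in>{1..l}. \<Sum>g\<in>{1..l'}. p i g * \<bar>\<tau> i - \<tau>' g\<bar>)"
      using coupling_transfer[OF v w eq[symmetric] p] by blast
    obtain r where r: "r \<in> couplings k' w' k w"
      "(\<Sum>h\<in>{1..k'}. \<Sum>j\<in>{1..k}. r h j * \<bar>\<theta>' h - \<theta> j\<bar>)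
        = (\<Sum>g\<in>{1..l'}. \<Sum>j\<in>{1..k}. q j g * \<bar>\<tau>' g - \<theta> j\<bar>)"
      using coupling_transfer[OF v' w' eq'[symmetric], of "\<lambda>g j. q j g" k w \<theta>] q(1) couplings_flip
      by blast
    have "(\<lambda>j h. r h j) \<in> couplings k w k' w'" using r(1) couplings_flip by blast
    moreover have "(\<Sum>j\<in>{1..k}. \<Sum>h\<in>{1..k'}. r h j * \<bar>\<theta> j - \<theta>' h\<bar>)
        = (\<Sum>j\<in>{1..k}. \<Sum>g\<in>{1..l'}. q j g * \<bar>\<theta> j - \<tau>' g\<bar>)"
      using r(2) unfolding sum.swap[of _ "{1..k'}" "{1..k}"] sum.swap[of _ "{1..l'}" "{1..k}"]
      by (simp only: abs_minus_commute)
    ultimately show ?thesis using q(2) by (intro bexI[of _ "\<lambda>j h. r h j"]) auto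
  qed
  have "{(\<Sum>i\<in>{1..l}. \<Sum>g\<in>{1..l'}. p i g * \<bar>\<tau> i - \<tau>' g\<bar>) | l v \<tau> l' v' \<tau>' p.
      v \<in> weight_simplex l \<and> v' \<in> weight_simplex l' \<and> mixing k w \<theta> = mixing l v \<tau> \<and>
      mixing k' w' \<theta>' = mixing l' v' \<tau>' \<and> p \<in> couplings l v l' v'}
    \<subseteq> (\<lambda>p. \<Sum>j\<in>{1..k}. \<Sum>h\<in>{1..k'}. p j h * \<bar>\<theta> j - \<theta>' h\<bar>) ` couplings k w k' w'"
    (is "?A \<subseteq> ?B")
  proof
    fix z assume "z \<in> ?A"
    then obtain l v \<tau> l' v' \<tau>' p where z:
      "z = (\<Sum>i\<in>{1..l}. \<Sum>g\<in>{1..l'}. p i g * \<bar>\<tau> i - \<tau>' g\<bar>)"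
      and A: "v \<in> weight_simplex l" "v' \<in> weight_simplex l'" "mixing k w \<theta> = mixing l v \<tau>"
      "mixing k' w' \<theta>' = mixing l' v' \<tau>'" "p \<in> couplings l v l' v'"
      by blast
    obtain r where "r \<in> couplings k w k' w'"
      "(\<Sum>j\<in>{1..k}. \<Sum>h\<in>{1..k'}. r j h * \<bar>\<theta> j - \<theta>' h\<bar>)
        = (\<Sum>i\<in>{1..l}. \<Sum>g\<in>{1..l'}. p i g * \<bar>\<tau> i - \<tau>' g\<bar>)"
      using transfer[OF A] by blast
    then show "z \<in> ?B" unfolding z by (intro image_eqI[of _ _ r]) simp_all
  qed
  moreover have "?B \<subseteq> ?A"
  proof
    fix z assume "z \<in> ?B"
    then obtain p where "p \<in> couplings k w k' w'"
      "z = (\<Sum>j\<in>{1..k}. \<Sum>h\<in>{1..k'}. p j h * \<bar>\<theta> j - \<theta>' h\<bar>)" by blast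
    with w w' show "z \<in> ?A"
      unfolding mem_Collect_eq
      by (intro exI[of _ k] exI[of _ w] exI[of _ \<theta>] exI[of _ k'] exI[of _ w'] exI[of _ \<theta>'] exI[of _ p])
        simp
  qed
  ultimately have "?A = ?B" by (rule subset_antisym)
  then show ?thesis
    unfolding wasserstein1_def by (rule arg_cong)
qed

end

theory Submission
  imports Defs
begin

text \<open>A posterior contraction argument with explicit tests. Under the alternative
  \<open>W\<^sub>1(\<nu>, \<nu>\<^sub>0) \<ge> M \<epsilon>\<close> with \<open>\<nu>\<close> having at most \<open>k\<close> atoms, Wu and Yang's moment comparison
  makes one of the first \<open>2k - 1\<close> moments differ by at least \<open>\<delta> = (c M \<epsilon> / k)\<^bsup>2k-1\<^esup>\<close>. The moment
  \<open>\<integral> \<theta>\<^sup>r d\<nu>\<close> is the mean of the Hermite polynomial \<open>H\<^sub>r(X)\<close>, whose second moment is at most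
  \<open>(C k)\<^bsup>2k-1\<^esup>\<close>, and replacing the sample mean by a Catoni-type product
  \<open>\<Prod>\<^sub>i (1 + y\<^sub>i + y\<^sub>i\<^sup>2/2)\<close> with \<open>y\<^sub>i = s (H\<^sub>r(X\<^sub>i) - m\<^sub>r)\<close> gives tests with error
  \<open>exp (- k log\<^sup>2 n)\<close>, although \<open>H\<^sub>r(X)\<close> has no exponential moments. No entropy bound is needed.
  The evidence is bounded below by the prior mass of a \<open>n\<^sup>-\<^sup>6\<close>-neighbourhood of the true parameters:
  on \<open>max \<bar>X\<^sub>i\<bar> \<le> L + 2 \<surd>(log n)\<close> the density ratio there is at least \<open>1 - 1/(2n)\<close>. The resulting loss
  \<open>exp (O(k\<^sup>\<star> k\<^sub>n log n))\<close>, for the bound \<open>k\<^sub>n\<close> on \<open>k\<^sup>\<star>\<close>, is of smaller order than the exponent of the tests because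
  \<open>k\<^sub>n log n = o(log\<^sup>2 n)\<close>, and models with more than \<open>k\<^sup>\<star>\<close> components are removed by the prior ratio in (P1).\<close>

section \<open>Separating polynomials and the quantile coupling\<close>

text \<open>The factor \<open>k^(3/2)\<close> in the rate has two sources. Two mixtures with at most
  \<open>k\<close> atoms each leave at most \<open>2k - 1\<close> gaps between atoms, so a distance
  \<epsilon> guarantees only a contribution of order \<open>\<epsilon> / k\<close> from some gap;
  and the second moments of the Hermite polynomials up to degree \<open>2k - 1\<close> grow like
  \<open>(C k)^(2k-1)\<close>, whose root of order \<open>2 (2k - 1)\<close> is of order
  \<open>sqrt k\<close>. Entropy does not enter because the rejection region is built from the
  moments of the truth alone: testing \<open>2k - 1\<close> moments in two directions meets all
  alternatives with at most \<open>k\<close> components at once. Second moments suffice because the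
  mean of \<open>1 + y + y^2/2\<close> involves nothing else, and because this polynomial at
  \<open>-y\<close> dominates its reciprocal at \<open>y\<close>, so one formula controls both
  errors. The evidence bound carries the prior mass of the true number of components as a factor.
  For larger models this factor cancels against the prior ratio. For the others it does not cancel,
  and there the bound on \<open>kbar\<close> is used.\<close>

text \<open>Lagrange interpolation would divide by distances between nodes of the same group, which
  can be arbitrarily small. The recursion here always drops one node from each side of the gap, so
  every denominator is at least \<open>g\<close>.\<close>

lemma separating_polynomial:
  fixes S T :: "real set"
  assumes "finite S" "finite T" "S \<subseteq> {-L..L}" "T \<subseteq> {-L..L}"
    and "0 < g" "g \<le> 2 * (1 + L)" "\<And>s t. s \<in> S \<Longrightarrow> t \<in> T \<Longrightarrow> s + g \<le> t"
    and "card S + card T \<le> Suc d"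
  shows "\<exists>c. (\<forall>s\<in>S. (\<Sum>i\<le>d. c i * s ^ i) = 1) \<and> (\<forall>t\<in>T. (\<Sum>i\<le>d. c i * t ^ i) = 0) \<and>
    (\<Sum>i\<le>d. \<bar>c i\<bar>) \<le> (2 * (1 + L) / g) ^ d"
  using assms
proof (induction d arbitrary: S T)
  case (0 S T)
  \<comment> \<open>For \<open>d = 0\<close> there is at most one node, and a constant polynomial
    does.\<close>
  then have "S = {} \<or> T = {}"
    by (metis One_nat_def add_leE card_0_eq card_gt_0_iff less_one linorder_not_le
        nat_add_left_cancel_le not_one_le_zero add_le_same_cancel1 le_antisym Suc_leI)
  then show ?case
    by (intro exI[of _ "\<lambda>i. if S = {} then 0 else 1"]) auto
next
  case (Suc d S T)
  define K where "K = 2 * (1 + L) / g"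
  have K: "1 \<le> K" using Suc.prems unfolding K_def by (simp add: field_simps)
  consider "S = {}" | "T = {}" | s t where "s \<in> S" "t \<in> T" by blast
  then show ?case
  proof cases
    case 1
    moreover have "0 \<le> K ^ Suc d" using K by simp
    ultimately show ?thesis unfolding K_def[symmetric] by (intro exI[of _ "\<lambda>_. 0"]) simp
  next
    \<comment> \<open>The constant 1 has coefficient sum 1; the bound holds because
      \<open>g \<le> 2 * (1 + L)\<close> makes \<open>K \<ge> 1\<close>.\<close>
    case 2
    have "1 \<le> K ^ Suc d" using K by (rule one_le_power)
    moreover have "(\<Sum>i\<le>Suc d. (if i = 0 then 1 else 0) * s ^ i) = 1" "(\<Sum>i\<le>Suc d. \<bar>if i = 0 then 1 else 0\<bar>) = (1::real)"
      for s :: real unfolding sum.atMost_Suc_shift by simp_all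
    ultimately show ?thesis using 2 unfolding K_def[symmetric]
      by (intro exI[of _ "\<lambda>i. if i = 0 then 1 else 0"]) simp
  next
    case (3 s t)
    have ts: "g \<le> t - s" using Suc.prems(7)[OF 3] by simp
    have "card (S - {s}) + card T \<le> Suc d" "card S + card (T - {t}) \<le> Suc d"
      using Suc.prems(1,2,8) 3 card_Suc_Diff1[of S s] card_Suc_Diff1[of T t] by linarith+
    then obtain c e where c: "\<forall>x\<in>S - {s}. (\<Sum>i\<le>d. c i * x ^ i) = 1" "\<forall>x\<in>T. (\<Sum>i\<le>d. c i * x ^ i) = 0"
        "(\<Sum>i\<le>d. \<bar>c i\<bar>) \<le> K ^ d"
      and e: "\<forall>x\<in>S. (\<Sum>i\<le>d. e i * x ^ i) = 1" "\<forall>x\<in>T - {t}. (\<Sum>i\<le>d. e i * x ^ i) = 0"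
        "(\<Sum>i\<le>d. \<bar>e i\<bar>) \<le> K ^ d"
      using Suc.IH[of "S - {s}" T] Suc.IH[of S "T - {t}"] Suc.prems unfolding K_def[symmetric]
      by (smt (verit, best) Diff_iff finite_Diff subset_iff)
    \<comment> \<open>Neville's recursion on coefficients: \<open>f\<close> represents
      \<open>((x - s) c(x) - (x - t) e(x)) / (t - s)\<close>. At a node shared by \<open>c\<close>
      and \<open>e\<close> the common value survives; at \<open>s\<close> only \<open>e\<close>
      counts, at \<open>t\<close> only \<open>c\<close>. The case distinction on \<open>i\<close> is
      the shift caused by multiplication with \<open>x\<close>.\<close>
    define f where "f i = ((case i of 0 \<Rightarrow> 0 | Suc j \<Rightarrow> c j - e j) -
        (if i \<le> d then s * c i - t * e i else 0)) / (t - s)" for i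
    have f: "(\<Sum>i\<le>Suc d. f i * x ^ i)
        = ((x - s) * (\<Sum>i\<le>d. c i * x ^ i) - (x - t) * (\<Sum>i\<le>d. e i * x ^ i)) / (t - s)" for x
    proof -
      have "(\<Sum>i\<le>Suc d. f i * x ^ i) = ((\<Sum>i\<le>Suc d. (case i of 0 \<Rightarrow> 0 | Suc j \<Rightarrow> c j - e j) * x ^ i) -
          (\<Sum>i\<le>Suc d. (if i \<le> d then s * c i - t * e i else 0) * x ^ i)) / (t - s)"
        unfolding f_def sum_divide_distrib sum_subtractf[symmetric]
        by (intro sum.cong) (auto simp: algebra_simps diff_divide_distrib)
      also have "(\<Sum>i\<le>Suc d. (case i of 0 \<Rightarrow> 0 | Suc j \<Rightarrow> c j - e j) * x ^ i)
          = x * (\<Sum>i\<le>d. c i * x ^ i) - x * (\<Sum>i\<le>d. e i * x ^ i)"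
        unfolding sum.atMost_Suc_shift
        by (simp add: sum_distrib_left sum_subtractf[symmetric] algebra_simps)
      also have "(\<Sum>i\<le>Suc d. (if i \<le> d then s * c i - t * e i else 0) * x ^ i)
          = s * (\<Sum>i\<le>d. c i * x ^ i) - t * (\<Sum>i\<le>d. e i * x ^ i)"
        by (simp add: sum_distrib_left sum_subtractf[symmetric] algebra_simps)
      finally show ?thesis by (simp add: algebra_simps)
    qed
    \<comment> \<open>Multiplication by \<open>x - s\<close> or \<open>x - t\<close> enlarges the
      coefficient sum by at most \<open>1 + L\<close>; two such terms divided by at least
      \<open>g\<close> give one more factor \<open>K\<close>.\<close>
    have "(\<Sum>i\<le>Suc d. \<bar>f i\<bar>) \<le> (\<Sum>i\<le>Suc d. ((case i of 0 \<Rightarrow> 0 | Suc j \<Rightarrow> \<bar>c j\<bar> + \<bar>e j\<bar>) +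
        (if i \<le> d then L * (\<bar>c i\<bar> + \<bar>e i\<bar>) else 0)) / g)"
    proof (rule sum_mono)
      fix i
      have sL: "\<bar>s\<bar> \<le> L" "\<bar>t\<bar> \<le> L" using 3 Suc.prems(3,4) by (force simp: abs_le_iff)+
      have "\<bar>s * c i - t * e i\<bar> \<le> \<bar>s\<bar> * \<bar>c i\<bar> + \<bar>t\<bar> * \<bar>e i\<bar>"
        by (metis abs_mult abs_triangle_ineq4)
      also have "\<dots> \<le> L * (\<bar>c i\<bar> + \<bar>e i\<bar>)"
        unfolding distrib_left by (intro add_mono mult_right_mono sL) auto
      finally have 1: "\<bar>s * c i - t * e i\<bar> \<le> L * (\<bar>c i\<bar> + \<bar>e i\<bar>)" .
      have "\<bar>f i\<bar> = \<bar>(case i of 0 \<Rightarrow> 0 | Suc j \<Rightarrow> c j - e j) -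
        (if i \<le> d then s * c i - t * e i else 0)\<bar> / (t - s)"
        using ts Suc.prems unfolding f_def by (simp add: abs_divide)
      also have "\<dots> \<le> ((case i of 0 \<Rightarrow> 0 | Suc j \<Rightarrow> \<bar>c j\<bar> + \<bar>e j\<bar>) +
        (if i \<le> d then L * (\<bar>c i\<bar> + \<bar>e i\<bar>) else 0)) / g"
        using ts Suc.prems 1 by (intro frac_le) (auto split: nat.splits)
      finally show "\<bar>f i\<bar> \<le> ((case i of 0 \<Rightarrow> 0 | Suc j \<Rightarrow> \<bar>c j\<bar> + \<bar>e j\<bar>) +
        (if i \<le> d then L * (\<bar>c i\<bar> + \<bar>e i\<bar>) else 0)) / g" .
    qed
    also have "\<dots> = ((\<Sum>i\<le>Suc d. case i of 0 \<Rightarrow> 0 | Suc j \<Rightarrow> \<bar>c j\<bar> + \<bar>e j\<bar>) +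
        (\<Sum>i\<le>Suc d. if i \<le> d then L * (\<bar>c i\<bar> + \<bar>e i\<bar>) else 0)) / g"
      by (simp only: sum_divide_distrib[symmetric] sum.distrib)
    also have "(\<Sum>i\<le>Suc d. case i of 0 \<Rightarrow> 0 | Suc j \<Rightarrow> \<bar>c j\<bar> + \<bar>e j\<bar>) = (\<Sum>i\<le>d. \<bar>c i\<bar>) + (\<Sum>i\<le>d. \<bar>e i\<bar>)"
      unfolding sum.atMost_Suc_shift by (simp add: sum.distrib)
    also have "(\<Sum>i\<le>Suc d. if i \<le> d then L * (\<bar>c i\<bar> + \<bar>e i\<bar>) else 0)
        = L * ((\<Sum>i\<le>d. \<bar>c i\<bar>) + (\<Sum>i\<le>d. \<bar>e i\<bar>))"
      by (simp add: sum.distrib sum_distrib_left distrib_left)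
    also have "((\<Sum>i\<le>d. \<bar>c i\<bar>) + (\<Sum>i\<le>d. \<bar>e i\<bar>) + L * ((\<Sum>i\<le>d. \<bar>c i\<bar>) + (\<Sum>i\<le>d. \<bar>e i\<bar>))) / g
        = (1 + L) / g * ((\<Sum>i\<le>d. \<bar>c i\<bar>) + (\<Sum>i\<le>d. \<bar>e i\<bar>))"
      by (simp add: algebra_simps add_divide_distrib)
    also have "\<dots> \<le> (1 + L) / g * (K ^ d + K ^ d)"
      using Suc.prems c(3) e(3) by (intro mult_left_mono add_mono) auto
    also have "\<dots> = K ^ Suc d" unfolding K_def by simp
    finally have "(\<Sum>i\<le>Suc d. \<bar>f i\<bar>) \<le> K ^ Suc d" .
    moreover have "(\<Sum>i\<le>Suc d. f i * x ^ i) = 1" if "x \<in> S" for x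
      using that c e ts Suc.prems unfolding f by (cases "x = s") (auto simp: algebra_simps)
    moreover have "(\<Sum>i\<le>Suc d. f i * x ^ i) = 0" if "x \<in> T" for x
      using that c e ts Suc.prems unfolding f by (cases "x = t") (auto simp: algebra_simps)
    ultimately show ?thesis unfolding K_def by blast
  qed
qed

section \<open>Transport on the line and distribution functions\<close>

text \<open>The intervals from \<open>f (h - 1)\<close> to \<open>f h\<close> tile the one from
  \<open>f l\<close> to \<open>f u\<close>, so the lengths of their intersections with a fixed
  interval add up. The marginals of the quantile coupling and its mass across a cut are both
  instances.\<close>

lemma sum_overlap:
  fixes f :: "nat \<Rightarrow> real"
  assumes "l \<le> u" "\<And>i j. l \<le> i \<Longrightarrow> i \<le> j \<Longrightarrow> j \<le> u \<Longrightarrow> f i \<le> f j"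
  shows "(\<Sum>h\<in>{Suc l..u}. max 0 (min y (f h) - max x (f (h - 1)))) = max 0 (min y (f u) - max x (f l))"
  using assms
proof (induction u rule: dec_induct)
  case base
  then show ?case by simp
next
  case (step u)
  have "f l \<le> f u" "f u \<le> f (Suc u)" using step.prems step.hyps by auto
  moreover have "(\<Sum>h\<in>{Suc l..u}. max 0 (min y (f h) - max x (f (h - 1)))) = max 0 (min y (f u) - max x (f l))"
    using step.prems by (intro step.IH) auto
  ultimately show ?case using step.hyps
    by (simp add: max_def min_def)
qed

text \<open>Splitting a distance into the gaps that separate its endpoints lets a transport cost be
  summed cut by cut. At most one of the two indicators is 1, according to the direction of the
  move.\<close>

lemma abs_diff_eq_sum_gaps:
  fixes t :: "nat \<Rightarrow> real"
  assumes "\<And>i j. 1 \<le> i \<Longrightarrow> i \<le> j \<Longrightarrow> j \<le> m \<Longrightarrow> t i \<le> t j" "i \<in> {1..m}" "h \<in> {1..m}"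
  shows "\<bar>t i - t h\<bar> = (\<Sum>r\<in>{1..<m}. (t (Suc r) - t r) *
    (of_bool (i \<le> r \<and> r < h) + of_bool (h \<le> r \<and> r < i)))"
proof -
  have tel: "t h - t i = (\<Sum>r\<in>{1..<m}. (t (Suc r) - t r) * of_bool (i \<le> r \<and> r < h))"
    if "1 \<le> i" "i \<le> h" "h \<le> m" for i h
  proof -
    have "t h - t i = (\<Sum>r\<in>{i..<h}. t (Suc r) - t r)"
      using that by (simp add: sum_Suc_diff')
    also have "\<dots> = (\<Sum>r\<in>{1..<m}. (t (Suc r) - t r) * of_bool (i \<le> r \<and> r < h))"
      using that by (intro sum.mono_neutral_cong_left) auto
    finally show ?thesis .
  qed
  show ?thesis
  proof (cases "i \<le> h")
    case True
    then have "\<bar>t i - t h\<bar> = t h - t i" using assms(1)[of i h] assms(2,3) by auto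
    also have "\<dots> = (\<Sum>r\<in>{1..<m}. (t (Suc r) - t r) * of_bool (i \<le> r \<and> r < h))"
      using tel True assms by auto
    also have "\<dots> = (\<Sum>r\<in>{1..<m}. (t (Suc r) - t r) *
       (of_bool (i \<le> r \<and> r < h) + of_bool (h \<le> r \<and> r < i)))"
      using True by (intro sum.cong) auto
    finally show ?thesis .
  next
    case False
    then have "\<bar>t i - t h\<bar> = t i - t h" using assms(1)[of h i] assms(2,3) by auto
    also have "\<dots> = (\<Sum>r\<in>{1..<m}. (t (Suc r) - t r) * of_bool (h \<le> r \<and> r < i))"
      using tel[of h i] False assms by auto
    also have "\<dots> = (\<Sum>r\<in>{1..<m}. (t (Suc r) - t r) *
       (of_bool (i \<le> r \<and> r < h) + of_bool (h \<le> r \<and> r < i)))"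
      using False by (intro sum.cong) auto
    finally show ?thesis .
  qed
qed

text \<open>The quantile coupling: \<open>p i h\<close> is the length of the overlap of the
  \<open>i\<close>-th cumulative-weight interval of \<open>a\<close> with the \<open>h\<close>-th one of \<open>b\<close>.\<close>

lemma wasserstein1_le_cdf_distance:
  assumes a: "a \<in> weight_simplex m" and b: "b \<in> weight_simplex m"
    and t: "\<And>i j. 1 \<le> i \<Longrightarrow> i \<le> j \<Longrightarrow> j \<le> m \<Longrightarrow> t i \<le> t j"
  shows "wasserstein1 (mixing m a t) (mixing m b t)
    \<le> (\<Sum>r\<in>{1..<m}. \<bar>\<Sum>i\<in>{1..r}. a i - b i\<bar> * (t (Suc r) - t r))"
proof -
  define A where "A r = (\<Sum>i\<in>{1..r}. a i)" for r
  define B where "B r = (\<Sum>i\<in>{1..r}. b i)" for r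
  define p where "p i h = max 0 (min (A i) (B h) - max (A (i - 1)) (B (h - 1)))" for i h
  have p': "p i h = max 0 (min (B h) (A i) - max (B (h - 1)) (A (i - 1)))" for i h
    unfolding p_def by (simp add: min.commute max.commute)
  have A0: "A 0 = 0" "B 0 = 0" and A1: "A m = 1" "B m = 1"
    using a b by (auto simp: A_def B_def weight_simplex_def)
  have nn: "0 \<le> a i" "0 \<le> b i" "a i \<le> 1" "b i \<le> 1" if "i \<in> {1..m}" for i
    using a b that by (auto simp: weight_simplex_def)
  have mono: "A i \<le> A j" "B i \<le> B j" if "i \<le> j" "j \<le> m" for i j
    unfolding A_def B_def using that nn by (auto intro!: sum_mono2)
  have AS: "A i - A (i - 1) = a i" "B i - B (i - 1) = b i" if "1 \<le> i" for i
    using that by (cases i; simp add: A_def B_def)+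
  have row: "(\<Sum>h\<in>{Suc l..u}. p i h) = max 0 (min (A i) (B u) - max (A (i - 1)) (B l))" 
    if "l \<le> u" "u \<le> m" for i l u
    unfolding p_def by (rule sum_overlap) (use that mono in auto)
  have col: "(\<Sum>i\<in>{Suc l..u}. p i h) = max 0 (min (B h) (A u) - max (B (h - 1)) (A l))" 
    if "l \<le> u" "u \<le> m" for h l u
    unfolding p' by (rule sum_overlap) (use that mono in auto)
  have row1: "(\<Sum>h\<in>{1..m}. p i h) = a i" if "i \<in> {1..m}" for i
    using row[of 0 m i] that mono[of 0 "i - 1"] mono[of i m] mono[of "i - 1" i] AS[of i] A0 A1 by auto
  have col1: "(\<Sum>i\<in>{1..m}. p i h) = b h" if "h \<in> {1..m}" for h
    using col[of 0 m h] that mono[of 0 "h - 1"] mono[of h m] mono[of "h - 1" h] AS[of h] A0 A1 by auto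
  have p0: "0 \<le> p i h" for i h by (simp add: p_def)
  have p1: "p i h \<le> 1" if "i \<in> {1..m}" "h \<in> {1..m}" for i h
  proof -
    have "p i h \<le> (\<Sum>h\<in>{1..m}. p i h)" using that p0 by (intro member_le_sum) auto
    then show ?thesis using row1 nn that by fastforce
  qed
  have pc: "p \<in> couplings m a m b"
    using p0 p1 row1 col1 by (auto simp: couplings_def)
  \<comment> \<open>The mass moved upwards across the cut \<open>r\<close> is exactly the excess of
    \<open>A r\<close> over \<open>B r\<close>; with the downward mass \<open>sepB\<close> this adds
    up to the absolute cdf difference.\<close>
  have sepA: "(\<Sum>i\<in>{1..m}. \<Sum>h\<in>{1..m}. p i h * of_bool (i \<le> r \<and> r < h)) = max 0 (A r - B r)"
    if r: "r \<in> {1..<m}" for r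
  proof -
    have "(\<Sum>i\<in>{1..m}. \<Sum>h\<in>{1..m}. p i h * of_bool (i \<le> r \<and> r < h)) =
        (\<Sum>i\<in>{Suc 0..r}. \<Sum>h\<in>{Suc r..m}. p i h)"
    proof (rule sum.mono_neutral_cong_right)
      show "\<forall>i\<in>{1..m} - {Suc 0..r}. (\<Sum>h\<in>{1..m}. p i h * of_bool (i \<le> r \<and> r < h)) = 0"
        by auto
      show "(\<Sum>h\<in>{1..m}. p i h * of_bool (i \<le> r \<and> r < h)) = (\<Sum>h\<in>{Suc r..m}. p i h)"
        if "i \<in> {Suc 0..r}" for i
        using that r by (intro sum.mono_neutral_cong_right) auto
    qed (use r in auto)
    also have "\<dots> = (\<Sum>i\<in>{Suc 0..r}. max 0 (min 1 (A i) - max (B r) (A (i - 1))))"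
      using r row[of r m] A1 by (intro sum.cong) (auto simp: min.commute max.commute)
    also have "\<dots> = max 0 (min 1 (A r) - max (B r) (A 0))"
      using r mono by (intro sum_overlap) auto
    also have "\<dots> = max 0 (A r - B r)"
      using mono[of r m] mono[of 0 r] r A0 A1 by (simp add: min_def max_def)
    finally show ?thesis .
  qed
  have sepB: "(\<Sum>i\<in>{1..m}. \<Sum>h\<in>{1..m}. p i h * of_bool (h \<le> r \<and> r < i)) = max 0 (B r - A r)"
    if r: "r \<in> {1..<m}" for r
  proof -
    have "(\<Sum>i\<in>{1..m}. \<Sum>h\<in>{1..m}. p i h * of_bool (h \<le> r \<and> r < i)) =
        (\<Sum>h\<in>{1..m}. \<Sum>i\<in>{1..m}. p i h * of_bool (h \<le> r \<and> r < i))" by (rule sum.swap)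
    also have "\<dots> = (\<Sum>h\<in>{Suc 0..r}. \<Sum>i\<in>{Suc r..m}. p i h)"
    proof (rule sum.mono_neutral_cong_right)
      show "\<forall>h\<in>{1..m} - {Suc 0..r}. (\<Sum>i\<in>{1..m}. p i h * of_bool (h \<le> r \<and> r < i)) = 0"
        by auto
      show "(\<Sum>i\<in>{1..m}. p i h * of_bool (h \<le> r \<and> r < i)) = (\<Sum>i\<in>{Suc r..m}. p i h)"
        if "h \<in> {Suc 0..r}" for h
        using that r by (intro sum.mono_neutral_cong_right) auto
    qed (use r in auto)
    also have "\<dots> = (\<Sum>h\<in>{Suc 0..r}. max 0 (min 1 (B h) - max (A r) (B (h - 1))))"
      using r col[of r m] A1 by (intro sum.cong) (auto simp: min.commute max.commute)
    also have "\<dots> = max 0 (min 1 (B r) - max (A r) (B 0))"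
      using r mono by (intro sum_overlap) auto
    also have "\<dots> = max 0 (B r - A r)"
      using mono[of r m] mono[of 0 r] r A0 A1 by (simp add: min_def max_def)
    finally show ?thesis .
  qed
  have gaps: "\<bar>t i - t h\<bar> = (\<Sum>r\<in>{1..<m}. (t (Suc r) - t r) *
      (of_bool (i \<le> r \<and> r < h) + of_bool (h \<le> r \<and> r < i)))"
    if "i \<in> {1..m}" "h \<in> {1..m}" for i h
    by (rule abs_diff_eq_sum_gaps) (use t that in auto)
  have "(\<Sum>i\<in>{1..m}. \<Sum>h\<in>{1..m}. p i h * \<bar>t i - t h\<bar>) = (\<Sum>i\<in>{1..m}. \<Sum>h\<in>{1..m}. \<Sum>r\<in>{1..<m}.
     (t (Suc r) - t r) * (p i h * of_bool (i \<le> r \<and> r < h) + p i h * of_bool (h \<le> r \<and> r < i)))"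
    by (intro sum.cong refl)
       (simp only: gaps sum_distrib_left distrib_left mult.left_commute)
  also have "\<dots> = (\<Sum>r\<in>{1..<m}. \<Sum>i\<in>{1..m}. \<Sum>h\<in>{1..m}.
     (t (Suc r) - t r) * (p i h * of_bool (i \<le> r \<and> r < h) + p i h * of_bool (h \<le> r \<and> r < i)))"
    by (subst sum.swap[of _ "{1..<m}"], intro sum.cong refl sum.swap)
  also have "\<dots> = (\<Sum>r\<in>{1..<m}. \<bar>\<Sum>i\<in>{1..r}. a i - b i\<bar> * (t (Suc r) - t r))"
  proof (rule sum.cong[OF refl])
    fix r assume r: "r \<in> {1..<m}"
    have "(\<Sum>i\<in>{1..m}. \<Sum>h\<in>{1..m}.
       (t (Suc r) - t r) * (p i h * of_bool (i \<le> r \<and> r < h) + p i h * of_bool (h \<le> r \<and> r < i)))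
      = (t (Suc r) - t r) * (max 0 (A r - B r) + max 0 (B r - A r))"
      unfolding sepA[OF r, symmetric] sepB[OF r, symmetric]
      by (simp only: sum_distrib_left[symmetric] sum.distrib)
    also have "max 0 (A r - B r) + max 0 (B r - A r) = \<bar>\<Sum>i\<in>{1..r}. a i - b i\<bar>"
      unfolding sum_subtractf A_def B_def by auto
    finally show "(\<Sum>i\<in>{1..m}. \<Sum>h\<in>{1..m}.
       (t (Suc r) - t r) * (p i h * of_bool (i \<le> r \<and> r < h) + p i h * of_bool (h \<le> r \<and> r < i)))
       = \<bar>\<Sum>i\<in>{1..r}. a i - b i\<bar> * (t (Suc r) - t r)" by (simp add: mult.commute)
  qed
  finally have cost: "(\<Sum>i\<in>{1..m}. \<Sum>h\<in>{1..m}. p i h * \<bar>t i - t h\<bar>) =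
    (\<Sum>r\<in>{1..<m}. \<bar>\<Sum>i\<in>{1..r}. a i - b i\<bar> * (t (Suc r) - t r))" .
  show ?thesis
    unfolding wasserstein1_mixing[OF a b] cost[symmetric]
  proof (rule cINF_lower[OF _ pc], rule bdd_belowI2[where m = 0])
    fix q assume "q \<in> couplings m a m b"
    then show "0 \<le> (\<Sum>j\<in>{1..m}. \<Sum>h\<in>{1..m}. q j h * \<bar>t j - t h\<bar>)"
      by (intro sum_nonneg mult_nonneg_nonneg) (auto simp: couplings_def)
  qed
qed

section \<open>From moments to the Wasserstein distance\<close>

text \<open>The cdf bound needs both mixtures on one increasing list of atoms. Pushing the weights
  onto a larger support merges repeated atoms and gives weight 0, as an empty sum, to the points
  that are missed.\<close>

lemma mixing_common_support:
  assumes w: "w \<in> weight_simplex k" and t: "bij_betw t {1..m} N" and sub: "\<theta> ` {1..k} \<subseteq> N"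
  obtains a where "a \<in> weight_simplex m" "mixing m a t = mixing k w \<theta>"
    "\<And>f :: real \<Rightarrow> real. (\<Sum>i\<in>{1..m}. a i * f (t i)) = (\<Sum>j\<in>{1..k}. w j * f (\<theta> j))"
proof -
  \<comment> \<open>The restricted lambda makes \<open>a\<close> extensional, as membership in
    \<open>weight_simplex\<close> demands.\<close>
  define a where "a = (\<lambda>i\<in>{1..m}. \<Sum>j | j \<in> {1..k} \<and> \<theta> j = t i. w j)"
  have w0: "0 \<le> w j" if "j \<in> {1..k}" for j using w that by (auto simp: weight_simplex_def)
  have sum: "(\<Sum>i\<in>{1..m}. a i * f (t i)) = (\<Sum>j\<in>{1..k}. w j * f (\<theta> j))" for f :: "real \<Rightarrow> real"
  proof -
    have "(\<Sum>i\<in>{1..m}. a i * f (t i)) = (\<Sum>i\<in>{1..m}. \<Sum>j | j \<in> {1..k} \<and> \<theta> j = t i. w j * f (\<theta> j))"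
      by (intro sum.cong) (auto simp: a_def sum_distrib_right)
    also have "\<dots> = (\<Sum>j\<in>{1..k}. \<Sum>i | i \<in> {1..m} \<and> \<theta> j = t i. w j * f (\<theta> j))"
      by (rule sum.swap_restrict) auto
    also have "\<dots> = (\<Sum>j\<in>{1..k}. w j * f (\<theta> j))"
    proof (rule sum.cong[OF refl])
      fix j assume "j \<in> {1..k}"
      then have "\<theta> j \<in> t ` {1..m}" using sub t by (auto simp: bij_betw_def)
      then obtain i where i: "i \<in> {1..m}" "\<theta> j = t i" by blast
      have "i' = i" if "i' \<in> {1..m}" "\<theta> j = t i'" for i'
        using that i t by (intro inj_onD[of t "{1..m}"]) (simp_all add: bij_betw_def)
      with i have "{i. i \<in> {1..m} \<and> \<theta> j = t i} = {i}" by blast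
      then show "(\<Sum>i | i \<in> {1..m} \<and> \<theta> j = t i. w j * f (\<theta> j)) = w j * f (\<theta> j)" by simp
    qed
    finally show ?thesis .
  qed
  have a0: "0 \<le> a i" if "i \<in> {1..m}" for i
    using that w0 by (auto simp: a_def intro!: sum_nonneg)
  have a1: "(\<Sum>i\<in>{1..m}. a i) = 1"
    using sum[of "\<lambda>_. 1"] w by (simp add: weight_simplex_def)
  have "a i \<le> 1" if "i \<in> {1..m}" for i
    using member_le_sum[of i "{1..m}" a] that a0 a1 by auto
  with a0 a1 have a: "a \<in> weight_simplex m" by (auto simp: weight_simplex_def a_def PiE_iff)
  have "mixing m a t = mixing k w \<theta>"
  proof (rule measure_eqI)
    fix B assume "B \<in> sets (mixing m a t)"
    then have B: "B \<in> sets borel" by simp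
    have "(\<Sum>i\<in>{1..m}. ennreal (a i) * indicator B (t i)) = ennreal (\<Sum>i\<in>{1..m}. a i * indicator B (t i))"
      using a0 by (subst sum_ennreal[symmetric]) (auto simp: ennreal_mult ennreal_indicator)
    also have "\<dots> = (\<Sum>j\<in>{1..k}. ennreal (w j) * indicator B (\<theta> j))"
      unfolding sum using w0 by (subst sum_ennreal[symmetric]) (auto simp: ennreal_mult ennreal_indicator)
    finally show "emeasure (mixing m a t) B = emeasure (mixing k w \<theta>) B"
      by (simp add: emeasure_mixing[OF a B] emeasure_mixing[OF w B])
  qed simp
  with a sum show ?thesis using that by blast
qed

lemma sorted_enumeration:
  fixes N :: "real set"
  assumes "finite N"
  obtains t where "bij_betw t {1..card N} N" "strict_mono_on {1..card N} t"
proof -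
  define l where "l = sorted_list_of_set N"
  have l: "distinct l" "sorted_wrt (<) l" "set l = N" "length l = card N"
    using assms strict_sorted_list_of_set[of N] by (simp_all only: l_def) auto
  have "bij_betw (\<lambda>i. i - 1) {1..card N} {..<card N}"
    by (rule bij_betwI[where g = Suc]) auto
  moreover have "bij_betw ((!) l) {..<card N} N"
    using l by (intro bij_betw_nth) auto
  ultimately have "bij_betw (\<lambda>i. l ! (i - 1)) {1..card N} N"
    using bij_betw_trans by (force simp: comp_def)
  moreover have "strict_mono_on {1..card N} (\<lambda>i. l ! (i - 1))"
    using l by (intro strict_mono_onI) (simp add: sorted_wrt_nth_less)
  ultimately show ?thesis by (rule that)
qed

text \<open>Wu and Yang: the cdf difference at a gap \<open>g\<close> between consecutive atoms is at most
  \<open>(2 * (1 + L) / g) ^ (2 * K - 1)\<close> times the largest moment difference.\<close>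

lemma moment_comparison:
  assumes w: "w \<in> weight_simplex k" "\<theta> \<in> atom_box L k"
    and w': "w' \<in> weight_simplex k'" "\<theta>' \<in> atom_box L k'"
    and k: "k \<le> K" "k' \<le> K" "1 \<le> K" and L: "0 < L" and \<tau>: "0 < \<tau>"
    and W: "2 * real K * \<tau> \<le> wasserstein1 (mixing k w \<theta>) (mixing k' w' \<theta>')"
  shows "\<exists>r\<in>{1..2 * K - 1}. (\<tau> / (2 * (1 + L))) ^ (2 * K - 1)
    \<le> \<bar>(\<Sum>j\<in>{1..k}. w j * \<theta> j ^ r) - (\<Sum>h\<in>{1..k'}. w' h * \<theta>' h ^ r)\<bar>"
proof (rule ccontr)
  define d where "d = 2 * K - 1"
  define \<delta> where "\<delta> = (\<tau> / (2 * (1 + L))) ^ d"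
  assume "\<not> ?thesis"
  then have small: "\<not> \<delta> \<le> \<bar>(\<Sum>j\<in>{1..k}. w j * \<theta> j ^ r) - (\<Sum>h\<in>{1..k'}. w' h * \<theta>' h ^ r)\<bar>"
    if "r \<in> {1..d}" for r using that unfolding \<delta>_def d_def by blast
  have \<delta>: "0 < \<delta>" using \<tau> L by (simp add: \<delta>_def)
  define N where "N = \<theta> ` {1..k} \<union> \<theta>' ` {1..k'}"
  define m where "m = card N"
  have fin: "finite N" by (simp add: N_def)
  have NL: "N \<subseteq> {-L..L}" using w w' by (auto simp: N_def atom_box_def)
  have md: "m \<le> Suc d"
    using card_Un_le[of "\<theta> ` {1..k}" "\<theta>' ` {1..k'}"] card_image_le[of "{1..k}" \<theta>]
      card_image_le[of "{1..k'}" \<theta>'] k unfolding m_def d_def N_def by simp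
  obtain t where bij: "bij_betw t {1..m} N" and sm: "strict_mono_on {1..m} t"
    using sorted_enumeration[OF fin] unfolding m_def .
  have tN: "t i \<in> N" if "i \<in> {1..m}" for i using bij that by (auto simp: bij_betw_def)
  have mono: "t i \<le> t j" if "1 \<le> i" "i \<le> j" "j \<le> m" for i j
    using strict_mono_onD[OF sm, of i j] that by (cases "i = j") auto
  obtain a where a: "a \<in> weight_simplex m" "mixing m a t = mixing k w \<theta>"
    "\<And>f :: real \<Rightarrow> real. (\<Sum>i\<in>{1..m}. a i * f (t i)) = (\<Sum>j\<in>{1..k}. w j * f (\<theta> j))"
    by (rule mixing_common_support[OF w(1) bij, of \<theta>]) (auto simp: N_def)
  obtain b where b: "b \<in> weight_simplex m" "mixing m b t = mixing k' w' \<theta>'"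
    "\<And>f :: real \<Rightarrow> real. (\<Sum>i\<in>{1..m}. b i * f (t i)) = (\<Sum>j\<in>{1..k'}. w' j * f (\<theta>' j))"
    by (rule mixing_common_support[OF w'(1) bij, of \<theta>']) (auto simp: N_def)
  \<comment> \<open>The separating polynomials have a constant term, so order 0 is included; that
    moment of \<open>a - b\<close> vanishes because both weight vectors sum to 1.\<close>
  have mom: "\<bar>\<Sum>i\<in>{1..m}. (a i - b i) * t i ^ r\<bar> \<le> \<delta>" if "r \<le> d" for r
  proof (cases "r = 0")
    case True
    then show ?thesis using a(1) b(1) \<delta> by (simp add: weight_simplex_def sum_subtractf)
  next
    case False
    then show ?thesis using small[of r] that a(3)[of "\<lambda>x. x ^ r"] b(3)[of "\<lambda>x. x ^ r"]
      by (simp add: left_diff_distrib sum_subtractf)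
  qed
  \<comment> \<open>A gap contributes at most \<tau> whatever its length \<open>g\<close>: if
    \<open>g \<le> \<tau>\<close>, because the cdf difference is at most 1; otherwise because that
    difference is at most \<open>(\<tau> / g)^d \<le> \<tau> / g\<close>.\<close>
  have gap: "\<bar>\<Sum>i\<in>{1..r}. a i - b i\<bar> * (t (Suc r) - t r) \<le> \<tau>" if r: "r \<in> {1..<m}" for r
  proof (cases "t (Suc r) - t r \<le> \<tau>")
    case True
    have le1: "(\<Sum>i\<in>{1..r}. v i) \<le> 1 \<and> 0 \<le> (\<Sum>i\<in>{1..r}. v i)" if "v \<in> weight_simplex m" for v
    proof -
      have "(\<Sum>i\<in>{1..r}. v i) \<le> (\<Sum>i\<in>{1..m}. v i)"
        using that r by (intro sum_mono2) (auto simp: weight_simplex_def PiE_iff)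
      moreover have "0 \<le> (\<Sum>i\<in>{1..r}. v i)"
        using that r by (intro sum_nonneg) (auto simp: weight_simplex_def PiE_iff)
      ultimately show ?thesis using that by (simp add: weight_simplex_def)
    qed
    have "\<bar>\<Sum>i\<in>{1..r}. a i - b i\<bar> \<le> 1"
      using le1[OF a(1)] le1[OF b(1)] unfolding sum_subtractf by linarith
    then have "\<bar>\<Sum>i\<in>{1..r}. a i - b i\<bar> * (t (Suc r) - t r) \<le> 1 * (t (Suc r) - t r)"
      using mono[of r "Suc r"] r by (intro mult_right_mono) auto
    then show ?thesis using True by simp
  next
    case False
    define g where "g = t (Suc r) - t r"
    have g: "\<tau> < g" "0 < g" using False \<tau> by (auto simp: g_def)
    have "t (Suc r) \<le> L" "- L \<le> t r" using tN[of r] tN[of "Suc r"] r NL by auto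
    then have gL: "g \<le> 2 * (1 + L)" by (simp add: g_def)
    have inj: "inj_on t {1..m}" using bij by (simp add: bij_betw_def)
    have "card (t ` {1..r}) + card (t ` {Suc r..m}) = m"
      using r by (subst (1 2) card_image) (auto intro: inj_on_subset[OF inj])
    then have card: "card (t ` {1..r}) + card (t ` {Suc r..m}) \<le> Suc d" using md by simp
    have sep: "s + g \<le> u" if su: "s \<in> t ` {1..r}" "u \<in> t ` {Suc r..m}" for s u
    proof -
      from su obtain i j where ij: "s = t i" "i \<in> {1..r}" "u = t j" "j \<in> {Suc r..m}" by auto
      then show ?thesis using mono[of i r] mono[of "Suc r" j] r by (auto simp: g_def)
    qed
    have "t ` {1..r} \<subseteq> {-L..L}" "t ` {Suc r..m} \<subseteq> {-L..L}"
      using tN NL r by (auto simp: subset_iff)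
    \<comment> \<open>Integrating a polynomial that is 1 on the first \<open>r\<close> atoms and 0
      on the others against \<open>a - b\<close> yields the cdf difference. There are at most
      \<open>2 * K\<close> atoms, so degree \<open>d = 2 * K - 1\<close> suffices.\<close>
    from separating_polynomial[OF _ _ this g(2) gL sep card]
    obtain c where c: "\<forall>s\<in>t ` {1..r}. (\<Sum>i\<le>d. c i * s ^ i) = 1"
       "\<forall>s\<in>t ` {Suc r..m}. (\<Sum>i\<le>d. c i * s ^ i) = 0" "(\<Sum>i\<le>d. \<bar>c i\<bar>) \<le> (2 * (1 + L) / g) ^ d"
      by blast
    have "(\<Sum>i\<in>{1..r}. a i - b i) = (\<Sum>i\<in>{1..m}. (a i - b i) * (\<Sum>s\<le>d. c s * t i ^ s))"
    proof (rule sum.mono_neutral_cong_left)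
      show "\<forall>i\<in>{1..m} - {1..r}. (a i - b i) * (\<Sum>s\<le>d. c s * t i ^ s) = 0"
        using c(2) by auto
      show "a i - b i = (a i - b i) * (\<Sum>s\<le>d. c s * t i ^ s)" if "i \<in> {1..r}" for i
        using c(1) that by auto
    qed (use r in auto)
    also have "\<dots> = (\<Sum>i\<in>{1..m}. \<Sum>s\<le>d. c s * ((a i - b i) * t i ^ s))"
      by (simp only: sum_distrib_left mult.left_commute)
    also have "\<dots> = (\<Sum>s\<le>d. c s * (\<Sum>i\<in>{1..m}. (a i - b i) * t i ^ s))"
      unfolding sum_distrib_left by (rule sum.swap)
    finally have "\<bar>\<Sum>i\<in>{1..r}. a i - b i\<bar> \<le> (\<Sum>s\<le>d. \<bar>c s * (\<Sum>i\<in>{1..m}. (a i - b i) * t i ^ s)\<bar>)"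
      by (elim ssubst) (rule sum_abs)
    also have "\<dots> \<le> (\<Sum>s\<le>d. \<bar>c s\<bar> * \<delta>)"
      unfolding abs_mult by (intro sum_mono mult_left_mono mom) auto
    also have "\<dots> \<le> (2 * (1 + L) / g) ^ d * \<delta>"
      unfolding sum_distrib_right[symmetric] using c(3) \<delta> by (intro mult_right_mono) auto
    also have "\<dots> = (\<tau> / g) ^ d"
    proof -
      have "2 * (1 + L) / g * (\<tau> / (2 * (1 + L))) = \<tau> / g" using L by simp
      then show ?thesis unfolding \<delta>_def power_mult_distrib[symmetric] by (rule arg_cong)
    qed
    also have "\<dots> \<le> (\<tau> / g) ^ 1"
      using g \<tau> k by (intro power_decreasing) (auto simp: d_def)
    finally have "\<bar>\<Sum>i\<in>{1..r}. a i - b i\<bar> * g \<le> \<tau> / g * g"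
      using g by (intro mult_right_mono) auto
    then show ?thesis using g by (simp add: g_def)
  qed
  have "wasserstein1 (mixing k w \<theta>) (mixing k' w' \<theta>')
      \<le> (\<Sum>r\<in>{1..<m}. \<bar>\<Sum>i\<in>{1..r}. a i - b i\<bar> * (t (Suc r) - t r))"
    unfolding a(2)[symmetric] b(2)[symmetric]
    using mono by (intro wasserstein1_le_cdf_distance a b) auto
  also have "\<dots> \<le> real (m - 1) * \<tau>"
    using sum_bounded_above[of "{1..<m}", OF gap] by simp
  also have "\<dots> \<le> real d * \<tau>"
    using md \<tau> by (intro mult_right_mono) auto
  also have "\<dots> < 2 * real K * \<tau>"
    using k \<tau> by (intro mult_strict_right_mono) (auto simp: d_def)
  finally show False using W by simp
qed

section \<open>Hermite polynomials\<close>

text \<open>The probabilists' Hermite polynomials, orthogonal under the standard normal law.\<close>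

fun hermite :: "nat \<Rightarrow> real \<Rightarrow> real" where
  "hermite 0 x = 1"
| "hermite (Suc 0) x = x"
| "hermite (Suc (Suc n)) x = x * hermite (Suc n) x - real (Suc n) * hermite n x"

text \<open>The derivative is also \<open>n * H_(n-1)\<close>; the form chosen avoids the index
  \<open>n - 1\<close> and makes the terms with \<open>x\<close> cancel when \<open>H_n\<close> is
  multiplied by a normal density and differentiated.\<close>

lemma DERIV_hermite:
  "(hermite n has_real_derivative x * hermite n x - hermite (Suc n) x) (at x)"
proof (induction n x rule: hermite.induct)
  case (1 x)
  have "hermite 0 = (\<lambda>x. 1)" by auto
  then show ?case by simp
next
  case (2 x)
  have "hermite (Suc 0) = (\<lambda>x. x)" by auto
  then show ?case by simp
next
  case (3 n x)
  have *: "hermite (Suc (Suc n)) = (\<lambda>x. x * hermite (Suc n) x - real (Suc n) * hermite n x)" by auto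
  show ?case
    unfolding * by (rule derivative_eq_intros 3 refl)+ (simp add: algebra_simps)
qed

lemma continuous_on_hermite: "continuous_on A (hermite n)"
  by (meson DERIV_hermite DERIV_isCont continuous_at_imp_continuous_on)

lemma borel_measurable_hermite[measurable]: "hermite n \<in> borel_measurable borel"
  by (intro borel_measurable_continuous_onI continuous_on_hermite)

text \<open>With \<open>y = |x| + sqrt R\<close> the recursion preserves the bound by powers of
  \<open>y\<close>, because \<open>|x| * y + R \<le> y * y\<close>. Fixing \<open>R\<close> above
  all degrees keeps the base the same throughout the induction.\<close>

lemma abs_hermite_le:
  assumes "0 \<le> R" "real n \<le> R"
  shows "\<bar>hermite n x\<bar> \<le> (\<bar>x\<bar> + sqrt R) ^ n"
  using assms(2)
proof (induction n x rule: hermite.induct)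
  case (3 n x)
  define y where "y = \<bar>x\<bar> + sqrt R"
  have y0: "0 \<le> y" using assms by (simp add: y_def)
  have IH: "\<bar>hermite (Suc n) x\<bar> \<le> y ^ Suc n" "\<bar>hermite n x\<bar> \<le> y ^ n"
    using 3 by (auto simp: y_def)
  have "\<bar>hermite (Suc (Suc n)) x\<bar> \<le> \<bar>x\<bar> * \<bar>hermite (Suc n) x\<bar> + real (Suc n) * \<bar>hermite n x\<bar>"
    using abs_triangle_ineq4[of "x * hermite (Suc n) x" "real (Suc n) * hermite n x"]
    by (simp add: abs_mult del: of_nat_Suc)
  also have "\<dots> \<le> \<bar>x\<bar> * y ^ Suc n + R * y ^ n"
    using IH 3(3) y0 by (intro add_mono mult_left_mono mult_mono) auto
  also have "\<dots> = (\<bar>x\<bar> * y + R) * y ^ n" by (simp add: algebra_simps)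
  also have "\<dots> \<le> (y * y) * y ^ n"
  proof (rule mult_right_mono)
    have "y * y = \<bar>x\<bar> * y + sqrt R * \<bar>x\<bar> + R"
      using assms by (simp add: y_def algebra_simps)
    moreover have "0 \<le> sqrt R * \<bar>x\<bar>" using assms by simp
    ultimately show "\<bar>x\<bar> * y + R \<le> y * y" by linarith
  qed (use y0 in simp)
  finally show ?case by (simp add: y_def mult_ac)
qed (use assms in auto)

text \<open>Here \<open>1 + u \<le> exp u\<close> is applied with \<open>u = |x| / sqrt R\<close>.
  The rate \<open>sqrt R\<close> is balanced: after squaring, its Gaussian exponential moment is
  only geometric in \<open>R\<close>, beside the factor \<open>R ^ n\<close>.\<close>

lemma abs_hermite_le_exp:
  assumes "1 \<le> R" "real n \<le> R"
  shows "\<bar>hermite n x\<bar> \<le> sqrt R ^ n * exp (sqrt R * \<bar>x\<bar>)"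
proof -
  have R: "0 < sqrt R" using assms by simp
  have "\<bar>hermite n x\<bar> \<le> (\<bar>x\<bar> + sqrt R) ^ n" using assms by (intro abs_hermite_le) auto
  also have "\<dots> = sqrt R ^ n * (1 + \<bar>x\<bar> / sqrt R) ^ n"
    using R by (simp add: power_mult_distrib[symmetric] field_simps)
  also have "\<dots> \<le> sqrt R ^ n * exp (\<bar>x\<bar> / sqrt R) ^ n"
    using R by (intro mult_left_mono power_mono exp_ge_add_one_self) auto
  also have "exp (\<bar>x\<bar> / sqrt R) ^ n = exp (real n * (\<bar>x\<bar> / sqrt R))"
    by (simp add: exp_of_nat_mult[symmetric])
  also have "real n * (\<bar>x\<bar> / sqrt R) \<le> R * (\<bar>x\<bar> / sqrt R)"
    using assms R by (intro mult_right_mono) auto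
  also have "\<dots> = sqrt R * \<bar>x\<bar>" using assms by (simp add: real_div_sqrt mult.commute flip: times_divide_eq_left)
  finally show ?thesis using R by simp
qed

section \<open>Gaussian moments of Hermite polynomials\<close>

text \<open>Completing the square: an exponential weight is a shift of the mean. This yields the
  moment generating function and, later, decay at infinity against exponentially growing
  factors.\<close>

lemma normal_density_exp_tilt:
  "exp (c * x) * normal_density \<theta> 1 x = exp (c * \<theta> + c\<^sup>2 / 2) * normal_density (\<theta> + c) 1 x"
  unfolding normal_density_def
  by (simp add: exp_add[symmetric] field_simps power2_eq_square)

lemma normal_mgf:
  "has_bochner_integral lborel (\<lambda>x. exp (c * x) * normal_density \<theta> 1 x) (exp (c * \<theta> + c\<^sup>2 / 2))"
  unfolding normal_density_exp_tilt
  using has_bochner_integral_mult_right[of "exp (c * \<theta> + c\<^sup>2 / 2)" lborel "normal_density (\<theta> + c) 1" 1]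
  by (simp add: has_bochner_integral_iff)

lemma normal_exp_abs:
  assumes "\<bar>\<theta>\<bar> \<le> L" "0 \<le> c"
  shows "integrable lborel (\<lambda>x. exp (c * \<bar>x\<bar>) * normal_density \<theta> 1 x)"
    and "(\<integral>x. exp (c * \<bar>x\<bar>) * normal_density \<theta> 1 x \<partial>lborel) \<le> 2 * exp (c * L + c\<^sup>2 / 2)"
proof -
  let ?f = "\<lambda>x. exp (c * x) * normal_density \<theta> 1 x + exp (- c * x) * normal_density \<theta> 1 x"
  have hb: "has_bochner_integral lborel ?f (exp (c * \<theta> + c\<^sup>2 / 2) + exp (- c * \<theta> + (- c)\<^sup>2 / 2))"
    by (intro has_bochner_integral_add normal_mgf)
  have le: "exp (c * \<bar>x\<bar>) * normal_density \<theta> 1 x \<le> ?f x" for x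
    unfolding distrib_right[symmetric] by (intro mult_right_mono) (auto simp: abs_if)
  have f: "integrable lborel ?f" "integral\<^sup>L lborel ?f = exp (c * \<theta> + c\<^sup>2 / 2) + exp (- c * \<theta> + (- c)\<^sup>2 / 2)"
    using hb unfolding has_bochner_integral_iff by blast+
  show int: "integrable lborel (\<lambda>x. exp (c * \<bar>x\<bar>) * normal_density \<theta> 1 x)"
  proof (rule Bochner_Integration.integrable_bound[OF f(1)])
    show "AE x in lborel. norm (exp (c * \<bar>x\<bar>) * normal_density \<theta> 1 x) \<le> norm (?f x)"
      by (intro AE_I2) (simp only: real_norm_def abs_of_nonneg le add_nonneg_nonneg mult_nonneg_nonneg
        exp_ge_zero normal_density_nonneg)
  qed measurable
  have "(\<integral>x. exp (c * \<bar>x\<bar>) * normal_density \<theta> 1 x \<partial>lborel) \<le> integral\<^sup>L lborel ?f"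
    by (rule integral_mono[OF int f(1) le])
  also have "\<dots> = exp (c * \<theta> + c\<^sup>2 / 2) + exp (- c * \<theta> + (- c)\<^sup>2 / 2)"
    by (rule f(2))
  also have "\<dots> \<le> exp (c * L + c\<^sup>2 / 2) + exp (c * L + c\<^sup>2 / 2)"
  proof (intro add_mono)
    have "c * \<theta> \<le> c * L" "c * - \<theta> \<le> c * L" 
      using mult_left_mono[of \<theta> L c] mult_left_mono[of "- \<theta>" L c] assms by (auto simp: abs_le_iff)
    then show "exp (c * \<theta> + c\<^sup>2 / 2) \<le> exp (c * L + c\<^sup>2 / 2)"
      "exp (- c * \<theta> + (- c)\<^sup>2 / 2) \<le> exp (c * L + c\<^sup>2 / 2)" by auto
  qed
  finally show "(\<integral>x. exp (c * \<bar>x\<bar>) * normal_density \<theta> 1 x \<partial>lborel) \<le> 2 * exp (c * L + c\<^sup>2 / 2)" by simp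
qed

lemma hermite_normal_integrable:
  "integrable lborel (\<lambda>x. hermite n x * normal_density \<theta> 1 x)"
proof -
  define R where "R = real n + 1"
  have R: "1 \<le> R" "real n \<le> R" by (auto simp: R_def)
  show ?thesis
  proof (rule Bochner_Integration.integrable_bound)
    show "integrable lborel (\<lambda>x. sqrt R ^ n * (exp (sqrt R * \<bar>x\<bar>) * normal_density \<theta> 1 x))"
      using R by (intro integrable_mult_right normal_exp_abs(1)[where L = "\<bar>\<theta>\<bar>"]) auto
    show "AE x in lborel. norm (hermite n x * normal_density \<theta> 1 x)
        \<le> norm (sqrt R ^ n * (exp (sqrt R * \<bar>x\<bar>) * normal_density \<theta> 1 x))"
      using abs_hermite_le_exp[OF R] R
      by (auto simp: abs_mult mult.assoc[symmetric] intro!: mult_right_mono)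
  qed measurable
qed

lemma normal_density_tendsto_0:
  "((\<lambda>x. normal_density m 1 x) \<longlongrightarrow> 0) at_top" "((\<lambda>x. normal_density m 1 x) \<longlongrightarrow> 0) at_bot"
proof -
  have nd: "normal_density m 1 x \<le> exp (- (x - m)\<^sup>2 / 2)" for x
  proof -
    have "1 \<le> sqrt (2 * pi)" using pi_gt3 by simp
    then have "1 / sqrt (2 * pi) * exp (- (x - m)\<^sup>2 / 2) \<le> 1 * exp (- (x - m)\<^sup>2 / 2)"
      by (intro mult_right_mono) auto
    then show ?thesis unfolding normal_density_def by simp
  qed
  have sq: "- (x - m)\<^sup>2 / 2 \<le> 1 / 2 + m - x" "- (x - m)\<^sup>2 / 2 \<le> 1 / 2 - m + x" for x
    using zero_le_power2[of "x - m - 1"] zero_le_power2[of "x - m + 1"]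
    by (simp_all add: power2_eq_square field_simps)
  have b1: "normal_density m 1 x \<le> exp (1 / 2 + m) * exp (- x)" for x
    using order_trans[OF nd exp_mono[OF sq(1)]] by (simp add: exp_add[symmetric])
  have b2: "normal_density m 1 x \<le> exp (1 / 2 - m) * exp x" for x
    using order_trans[OF nd exp_mono[OF sq(2)]] by (simp add: exp_add[symmetric])
  have "((\<lambda>x::real. exp (- x)) \<longlongrightarrow> 0) at_top"
    by (rule filterlim_compose[OF exp_at_bot filterlim_uminus_at_bot_at_top])
  then have 1: "((\<lambda>x. exp (1 / 2 + m) * exp (- x)) \<longlongrightarrow> 0) at_top"
    by (rule tendsto_mult_right_zero)
  have 2: "((\<lambda>x. exp (1 / 2 - m) * exp x) \<longlongrightarrow> 0) at_bot"
    by (rule tendsto_mult_right_zero[OF exp_at_bot])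
  show "((\<lambda>x. normal_density m 1 x) \<longlongrightarrow> 0) at_top"
    by (rule tendsto_sandwich[OF _ _ tendsto_const 1]) (use b1 in auto)
  show "((\<lambda>x. normal_density m 1 x) \<longlongrightarrow> 0) at_bot"
    by (rule tendsto_sandwich[OF _ _ tendsto_const 2]) (use b2 in auto)
qed

text \<open>The exponential bound on the Hermite polynomial is absorbed by tilting, with
  \<open>c\<close> on the right half-line and \<open>- c\<close> on the left. These are the boundary
  terms of the integration by parts for the mean.\<close>

lemma hermite_normal_tendsto_0:
  "((\<lambda>x. hermite n x * normal_density \<theta> 1 x) \<longlongrightarrow> 0) at_top"
  "((\<lambda>x. hermite n x * normal_density \<theta> 1 x) \<longlongrightarrow> 0) at_bot"
proof -
  define R where "R = real n + 1"
  define c where "c = sqrt R"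
  define K where "K s = c ^ n * exp (s * \<theta> + s\<^sup>2 / 2)" for s
  have R: "1 \<le> R" "real n \<le> R" by (auto simp: R_def)
  have b: "norm (hermite n x * normal_density \<theta> 1 x) \<le> c ^ n * (exp (c * \<bar>x\<bar>) * normal_density \<theta> 1 x)" for x
    using abs_hermite_le_exp[OF R] unfolding c_def
    by (auto simp: abs_mult mult.assoc[symmetric] intro!: mult_right_mono)
  have b1: "norm (hermite n x * normal_density \<theta> 1 x) \<le> K c * normal_density (\<theta> + c) 1 x" if "0 \<le> x" for x
    using b[of x] that normal_density_exp_tilt[of c x \<theta>] by (simp add: K_def)
  have b2: "norm (hermite n x * normal_density \<theta> 1 x) \<le> K (- c) * normal_density (\<theta> + - c) 1 x" if "x \<le> 0" for x
    using b[of x] that normal_density_exp_tilt[of "- c" x \<theta>] by (simp add: K_def)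
  show "((\<lambda>x. hermite n x * normal_density \<theta> 1 x) \<longlongrightarrow> 0) at_top"
    by (rule Lim_null_comparison[OF _ tendsto_mult_right_zero[OF normal_density_tendsto_0(1)]])
       (use b1 in \<open>auto intro: eventually_mono[OF eventually_ge_at_top[of 0]]\<close>)
  show "((\<lambda>x. hermite n x * normal_density \<theta> 1 x) \<longlongrightarrow> 0) at_bot"
    by (rule Lim_null_comparison[OF _ tendsto_mult_right_zero[OF normal_density_tendsto_0(2)]])
       (use b2 in \<open>auto intro: eventually_mono[OF eventually_le_at_bot[of 0]]\<close>)
qed

lemma DERIV_normal_density:
  "(normal_density \<theta> 1 has_real_derivative - (x - \<theta>) * normal_density \<theta> 1 x) (at x)"
  unfolding normal_density_def by (rule derivative_eq_intros refl | simp add: field_simps)+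

text \<open>Stein's identity: \<open>(H\<^sub>n \<phi>\<^sub>\<theta>)' = (\<theta> H\<^sub>n - H\<^sub>n\<^sub>+\<^sub>1) \<phi>\<^sub>\<theta>\<close> integrates to zero.\<close>

lemma hermite_normal_mean:
  "(\<integral>x. hermite n x * normal_density \<theta> 1 x \<partial>lborel) = \<theta> ^ n"
proof (induction n)
  case (Suc n)
  let ?F = "\<lambda>x. hermite n x * normal_density \<theta> 1 x"
  let ?f = "\<lambda>x. \<theta> * (hermite n x * normal_density \<theta> 1 x) - hermite (Suc n) x * normal_density \<theta> 1 x"
  have int: "integrable lborel ?f"
    by (intro Bochner_Integration.integrable_diff integrable_mult_right hermite_normal_integrable)
  have "(LBINT x=-\<infinity>..\<infinity>. ?f x) = 0 - 0"
  proof (rule interval_integral_FTC_integrable)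
    show "(?F has_vector_derivative ?f x) (at x)" for x
      unfolding has_real_derivative_iff_has_vector_derivative[symmetric]
      by (rule derivative_eq_intros DERIV_hermite DERIV_normal_density refl)+ (simp add: algebra_simps)
    show "isCont ?f x" for x
      by (intro continuous_intros continuous_on_interior[OF continuous_on_hermite[of UNIV]])
         (auto intro!: DERIV_isCont[OF DERIV_normal_density] continuous_on_interior[OF continuous_on_hermite[of UNIV]])
    show "set_integrable lborel (einterval (- \<infinity>) \<infinity>) ?f"
      using int by (simp add: set_integrable_def)
    show "((?F \<circ> real_of_ereal) \<longlongrightarrow> 0) (at_right (- \<infinity>))" "((?F \<circ> real_of_ereal) \<longlongrightarrow> 0) (at_left \<infinity>)"
      using hermite_normal_tendsto_0 by (simp_all add: ereal_tendsto_simps)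
  qed simp
  then have "(\<integral>x. ?f x \<partial>lborel) = 0"
    by (simp add: interval_lebesgue_integral_def set_lebesgue_integral_def)
  then show ?case
    using Suc by (simp add: hermite_normal_integrable del: hermite.simps)
qed simp

text \<open>One bound for all degrees \<open>n \<le> R\<close>, so that a single variance constant
  serves all moments under test. Only its shape, a constant times \<open>R\<close> to the power
  \<open>R\<close>, matters for the rate.\<close>

lemma hermite_normal_second_moment:
  assumes "1 \<le> R" "n \<le> R" "\<bar>\<theta>\<bar> \<le> L"
  shows "integrable lborel (\<lambda>x. (hermite n x)\<^sup>2 * normal_density \<theta> 1 x)"
    and "(\<integral>x. (hermite n x)\<^sup>2 * normal_density \<theta> 1 x \<partial>lborel) \<le> 2 * (real R * exp (2 * L + 2)) ^ R"
proof -
  define c where "c = sqrt (real R)"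
  have c: "1 \<le> c" "c * c = real R" "0 \<le> c" using assms by (auto simp: c_def)
  have L: "0 \<le> L" using assms by linarith
  have le: "(hermite n x)\<^sup>2 * normal_density \<theta> 1 x
      \<le> real R ^ R * (exp ((2 * c) * \<bar>x\<bar>) * normal_density \<theta> 1 x)" for x
  proof -
    have "\<bar>hermite n x\<bar> \<le> c ^ n * exp (c * \<bar>x\<bar>)"
      using abs_hermite_le_exp[of "real R" n x] assms by (simp add: c_def)
    then have "(hermite n x)\<^sup>2 \<le> (c ^ n * exp (c * \<bar>x\<bar>))\<^sup>2"
      by (metis abs_ge_zero power2_abs power_mono)
    also have "\<dots> = real R ^ n * exp (2 * c * \<bar>x\<bar>)"
      using c by (simp add: power_mult_distrib exp_double[symmetric] mult_ac power2_eq_square flip: power_mult_distrib exp_add)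
    also have "\<dots> \<le> real R ^ R * exp (2 * c * \<bar>x\<bar>)"
      using assms by (intro mult_right_mono power_increasing) auto
    finally show ?thesis by (simp add: mult.assoc[symmetric] mult_right_mono)
  qed
  have int: "integrable lborel (\<lambda>x. real R ^ R * (exp ((2 * c) * \<bar>x\<bar>) * normal_density \<theta> 1 x))"
    using c assms by (intro integrable_mult_right normal_exp_abs(1)[where L = L]) auto
  show I: "integrable lborel (\<lambda>x. (hermite n x)\<^sup>2 * normal_density \<theta> 1 x)"
    using le by (intro Bochner_Integration.integrable_bound[OF int]) auto
  have "(\<integral>x. (hermite n x)\<^sup>2 * normal_density \<theta> 1 x \<partial>lborel)
      \<le> (\<integral>x. real R ^ R * (exp ((2 * c) * \<bar>x\<bar>) * normal_density \<theta> 1 x) \<partial>lborel)"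
    using le by (intro integral_mono[OF I int]) auto
  also have "\<dots> \<le> real R ^ R * (2 * exp (2 * c * L + (2 * c)\<^sup>2 / 2))"
    using normal_exp_abs(2)[of \<theta> L "2 * c"] assms c by simp
  also have "exp (2 * c * L + (2 * c)\<^sup>2 / 2) \<le> exp (real R * (2 * L + 2))"
  proof (rule exp_mono)
    have "c * (2 * L) \<le> (c * c) * (2 * L)"
      using c(1,3) L mult_left_mono[OF c(1,3)] by (intro mult_right_mono) auto
    then show "2 * c * L + (2 * c)\<^sup>2 / 2 \<le> real R * (2 * L + 2)"
      using c by (simp add: power2_eq_square algebra_simps)
  qed
  finally have "(\<integral>x. (hermite n x)\<^sup>2 * normal_density \<theta> 1 x \<partial>lborel)
      \<le> real R ^ R * (2 * exp (real R * (2 * L + 2)))" by (simp add: mult_left_mono)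
  also have "real R ^ R * (2 * exp (real R * (2 * L + 2))) = 2 * (real R * exp (2 * L + 2)) ^ R"
    by (simp add: power_mult_distrib exp_of_nat_mult)
  finally show "(\<integral>x. (hermite n x)\<^sup>2 * normal_density \<theta> 1 x \<partial>lborel) \<le> 2 * (real R * exp (2 * L + 2)) ^ R"
    by simp
qed

section \<open>Robust moment tests\<close>

lemma nn_integral_mixing:
  assumes "w \<in> weight_simplex k" and [measurable]: "f \<in> borel_measurable borel"
  shows "(\<integral>\<^sup>+ t. f t \<partial>mixing k w \<theta>) = (\<Sum>j\<in>{1..k}. ennreal (w j) * f (\<theta> j))"
  unfolding mixing_def
  by (subst nn_integral_distr) (auto simp: nn_integral_point_measure_finite mult.commute)

lemma mix_density_mixing:
  assumes w: "w \<in> weight_simplex k"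
  shows "mix_density (mixing k w \<theta>) x = ennreal (\<Sum>j\<in>{1..k}. w j * normal_density (\<theta> j) 1 x)"
proof -
  have "mix_density (mixing k w \<theta>) x = (\<Sum>j\<in>{1..k}. ennreal (w j) * ennreal (normal_density (\<theta> j) 1 x))"
    unfolding mix_density_def by (rule nn_integral_mixing[OF w]) (simp add: normal_density_def)
  also have "\<dots> = (\<Sum>j\<in>{1..k}. ennreal (w j * normal_density (\<theta> j) 1 x))"
    using w by (intro sum.cong refl ennreal_mult[symmetric]) (auto simp: weight_simplex_def)
  also have "\<dots> = ennreal (\<Sum>j\<in>{1..k}. w j * normal_density (\<theta> j) 1 x)"
    using w by (intro sum_ennreal) (auto simp: weight_simplex_def intro!: mult_nonneg_nonneg)
  finally show ?thesis .
qed

lemma nn_integral_mix_density: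
  assumes w: "w \<in> weight_simplex k" and [measurable]: "h \<in> borel_measurable borel"
  shows "(\<integral>\<^sup>+ x. mix_density (mixing k w \<theta>) x * h x \<partial>lborel)
    = (\<Sum>j\<in>{1..k}. ennreal (w j) * (\<integral>\<^sup>+ x. ennreal (normal_density (\<theta> j) 1 x) * h x \<partial>lborel))"
proof -
  have "mix_density (mixing k w \<theta>) x * h x
      = (\<Sum>j\<in>{1..k}. ennreal (w j) * (ennreal (normal_density (\<theta> j) 1 x) * h x))" for x
    unfolding mix_density_def
    by (subst nn_integral_mixing[OF w]) (simp_all add: normal_density_def sum_distrib_right mult.assoc)
  then show ?thesis
    by (simp add: nn_integral_sum nn_integral_cmult)
qed

lemma nn_integral_mix_density_le:
  assumes w: "w \<in> weight_simplex k" and [measurable]: "h \<in> borel_measurable borel"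
    and le: "\<And>j. j \<in> {1..k} \<Longrightarrow> (\<integral>\<^sup>+ x. ennreal (normal_density (\<theta> j) 1 x) * h x \<partial>lborel) \<le> ennreal (b j)"
    and b: "\<And>j. j \<in> {1..k} \<Longrightarrow> 0 \<le> b j"
  shows "(\<integral>\<^sup>+ x. mix_density (mixing k w \<theta>) x * h x \<partial>lborel) \<le> ennreal (\<Sum>j\<in>{1..k}. w j * b j)"
proof -
  have "(\<integral>\<^sup>+ x. mix_density (mixing k w \<theta>) x * h x \<partial>lborel) \<le> (\<Sum>j\<in>{1..k}. ennreal (w j) * ennreal (b j))"
    unfolding nn_integral_mix_density[OF w assms(2)] by (intro sum_mono mult_left_mono le) auto
  also have "\<dots> = ennreal (\<Sum>j\<in>{1..k}. w j * b j)"
    using w b by (subst sum_ennreal[symmetric]) (auto simp: weight_simplex_def ennreal_mult PiE_iff)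
  finally show ?thesis .
qed

section \<open>Catoni products of Hermite polynomials\<close>

text \<open>The second-order Taylor polynomial of the exponential; its logarithm is the influence
  function of Catoni's mean estimator on the positive half-line. Its expectation needs two moments
  only, where \<open>exp\<close> would need exponential moments.\<close>

definition catoni :: "real \<Rightarrow> real" where
  "catoni y = 1 + y + y\<^sup>2 / 2"

lemma catoni_pos: "0 < catoni y"
proof -
  have "catoni y = ((1 + y)\<^sup>2 + 1) / 2" by (simp add: catoni_def power2_eq_square algebra_simps)
  also have "0 < \<dots>" by (intro divide_pos_pos add_nonneg_pos) auto
  finally show ?thesis .
qed

text \<open>The product is \<open>(1 + y^2/2)^2 - y^2 = 1 + y^4/4\<close>. Hence
  \<open>catoni (- y)\<close> dominates \<open>1 / catoni y\<close>, which turns a small statistic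
  into a large one for the opposite direction.\<close>

lemma catoni_mult_catoni_uminus: "1 \<le> catoni y * catoni (- y)"
proof -
  have "catoni y * catoni (- y) = 1 + (y\<^sup>2)\<^sup>2 / 4"
    by (simp add: catoni_def power2_eq_square algebra_simps)
  then show ?thesis by simp
qed

lemma borel_measurable_catoni[measurable]: "catoni \<in> borel_measurable borel"
  unfolding catoni_def by measurable

definition hermite_var :: "real \<Rightarrow> nat \<Rightarrow> real" where
  "hermite_var L R = 6 * (real R * exp (2 * L + 2)) ^ R"

lemma power_le_hermite_var:
  assumes "1 \<le> R" "r \<le> R" "\<bar>t\<bar> \<le> L ^ r" "0 \<le> L"
  shows "6 * t\<^sup>2 \<le> hermite_var L R"
proof -
  have "t\<^sup>2 \<le> (L ^ r)\<^sup>2" using assms by (metis abs_ge_zero power2_abs power_mono)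
  also have "(L ^ r)\<^sup>2 \<le> (exp L ^ r)\<^sup>2"
    using order_trans[OF _ exp_ge_add_one_self[of L], of L] assms by (intro power_mono) auto
  also have "\<dots> = exp (2 * L) ^ r" 
    by (simp add: power_mult[symmetric] mult.commute exp_of_nat_mult[symmetric])
  also have "\<dots> \<le> exp (2 * L) ^ R" using assms by (intro power_increasing) auto
  also have "\<dots> \<le> (real R * exp (2 * L + 2)) ^ R"
  proof (rule power_mono)
    have "1 * exp (2 * L) \<le> real R * exp (2 * L + 2)" using assms by (intro mult_mono) auto
    then show "exp (2 * L) \<le> real R * exp (2 * L + 2)" by simp
  qed simp
  finally show ?thesis by (simp add: hermite_var_def)
qed

lemma normal_catoni_hermite:
  assumes R: "1 \<le> R" "r \<le> R" and \<theta>: "\<bar>\<theta>\<bar> \<le> L" and m: "\<bar>m\<bar> \<le> L ^ r"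
  shows "(\<integral>\<^sup>+ x. ennreal (normal_density \<theta> 1 x) * ennreal (catoni (s * (hermite r x - m))) \<partial>lborel)
    \<le> ennreal (1 + s * (\<theta> ^ r - m) + s\<^sup>2 * hermite_var L R / 2)"
proof -
  let ?n = "normal_density \<theta> 1"
  let ?f = "\<lambda>x. (1 - s * m + s\<^sup>2 * m\<^sup>2 / 2) * ?n x + (s - s\<^sup>2 * m) * (hermite r x * ?n x)
    + s\<^sup>2 / 2 * ((hermite r x)\<^sup>2 * ?n x)"
  note i2 = hermite_normal_second_moment[OF R \<theta>]
  have L: "0 \<le> L" using \<theta> by linarith
  have f: "?n x * catoni (s * (hermite r x - m)) = ?f x" for x
    by (simp add: catoni_def power2_eq_square algebra_simps add_divide_distrib diff_divide_distrib)
  have int: "integrable lborel ?f"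
    by (intro Bochner_Integration.integrable_add integrable_mult_right hermite_normal_integrable i2) auto
  have "(\<integral>\<^sup>+ x. ennreal (?n x) * ennreal (catoni (s * (hermite r x - m))) \<partial>lborel) = (\<integral>\<^sup>+ x. ennreal (?f x) \<partial>lborel)"
    unfolding f[symmetric] by (intro nn_integral_cong ennreal_mult[symmetric] less_imp_le[OF catoni_pos]) auto
  also have "\<dots> = ennreal (integral\<^sup>L lborel ?f)"
    using int unfolding f[symmetric]
    by (intro nn_integral_eq_integral) (auto intro!: AE_I2 mult_nonneg_nonneg less_imp_le[OF catoni_pos])
  also have "integral\<^sup>L lborel ?f = (1 - s * m + s\<^sup>2 * m\<^sup>2 / 2) + (s - s\<^sup>2 * m) * \<theta> ^ r
      + s\<^sup>2 / 2 * (\<integral>x. (hermite r x)\<^sup>2 * ?n x \<partial>lborel)"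
    by (simp add: hermite_normal_integrable i2 hermite_normal_mean)
  also have "\<dots> = 1 + s * (\<theta> ^ r - m)
      + s\<^sup>2 / 2 * ((\<integral>x. (hermite r x)\<^sup>2 * ?n x \<partial>lborel) + m\<^sup>2 - 2 * m * \<theta> ^ r)"
    by (simp add: power2_eq_square algebra_simps)
  \<comment> \<open>The second moment of \<open>H_r\<close> takes a third of
    \<open>hermite_var\<close>; the centring is at most \<open>2 * m^2 + (\<theta>^r)^2\<close>,
    three terms of at most a sixth each.\<close>
  also have "\<dots> \<le> 1 + s * (\<theta> ^ r - m) + s\<^sup>2 / 2 * hermite_var L R"
  proof (intro add_left_mono mult_left_mono)
    have "\<bar>\<theta> ^ r\<bar> \<le> L ^ r" unfolding power_abs using \<theta> by (intro power_mono) auto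
    then have "6 * (\<theta> ^ r)\<^sup>2 \<le> hermite_var L R" "6 * m\<^sup>2 \<le> hermite_var L R"
      using power_le_hermite_var[OF R _ L] m by blast+
    moreover have "m\<^sup>2 - 2 * m * \<theta> ^ r \<le> 2 * m\<^sup>2 + (\<theta> ^ r)\<^sup>2"
      using zero_le_power2[of "m + \<theta> ^ r"] by (simp add: power2_sum)
    moreover have "0 \<le> m\<^sup>2" by simp
    moreover have "(\<integral>x. (hermite r x)\<^sup>2 * ?n x \<partial>lborel) \<le> hermite_var L R / 3"
      using i2(2) by (simp add: hermite_var_def)
    ultimately show "(\<integral>x. (hermite r x)\<^sup>2 * ?n x \<partial>lborel) + m\<^sup>2 - 2 * m * \<theta> ^ r \<le> hermite_var L R"
      unfolding add_diff_eq[symmetric] by argo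
  qed auto
  finally show ?thesis by (simp add: ennreal_leI)
qed

text \<open>The bound for a single normal is affine in \<open>\<theta>^r\<close>, so averaging over
  the weights replaces this power by the moment of the mixture. The centre \<open>m\<close> stays
  free because the statistic centred at the true moment is also evaluated under
  alternatives.\<close>

lemma mixture_catoni_hermite:
  assumes w: "w \<in> weight_simplex k" and \<theta>: "\<theta> \<in> atom_box L k" and L: "0 \<le> L"
    and R: "1 \<le> R" "r \<le> R" and m: "\<bar>m\<bar> \<le> L ^ r"
  shows "(\<integral>\<^sup>+ x. mix_density (mixing k w \<theta>) x * ennreal (catoni (s * (hermite r x - m))) \<partial>lborel)
    \<le> ennreal (exp (s * ((\<Sum>j\<in>{1..k}. w j * \<theta> j ^ r) - m) + s\<^sup>2 * hermite_var L R / 2))"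
proof -
  let ?b = "\<lambda>j. 1 + s * (\<theta> j ^ r - m) + s\<^sup>2 * hermite_var L R / 2"
  have w1: "(\<Sum>j\<in>{1..k}. w j) = 1" using w by (simp add: weight_simplex_def)
  have \<theta>L: "\<bar>\<theta> j\<bar> \<le> L" if "j \<in> {1..k}" for j
    using \<theta> that unfolding atom_box_def by (fastforce simp: abs_le_iff)
  \<comment> \<open>The bound is at least \<open>catoni (s * (\<theta> j ^ r - m))\<close>, since
    \<open>hermite_var\<close> dominates the squared difference, and \<open>catoni\<close> is
    positive.\<close>
  have b0: "0 \<le> ?b j" if j: "j \<in> {1..k}" for j
  proof -
    have "\<bar>\<theta> j ^ r\<bar> \<le> L ^ r" unfolding power_abs using \<theta>L[OF j] by (intro power_mono) auto
    then have "6 * (\<theta> j ^ r)\<^sup>2 \<le> hermite_var L R" "6 * m\<^sup>2 \<le> hermite_var L R"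
      using power_le_hermite_var[OF R _ L] m by blast+
    moreover have "(\<theta> j ^ r - m)\<^sup>2 \<le> 2 * (\<theta> j ^ r)\<^sup>2 + 2 * m\<^sup>2"
      using zero_le_power2[of "m + \<theta> j ^ r"] by (simp add: power2_sum power2_diff algebra_simps)
    ultimately have "(\<theta> j ^ r - m)\<^sup>2 \<le> hermite_var L R" 
      using zero_le_power2[of m] zero_le_power2[of "\<theta> j ^ r"] by linarith
    then have "s\<^sup>2 * (\<theta> j ^ r - m)\<^sup>2 \<le> s\<^sup>2 * hermite_var L R" by (intro mult_left_mono) auto
    then show ?thesis
      using catoni_pos[of "s * (\<theta> j ^ r - m)"] by (simp add: catoni_def power_mult_distrib)
  qed
  have "(\<integral>\<^sup>+ x. mix_density (mixing k w \<theta>) x * ennreal (catoni (s * (hermite r x - m))) \<partial>lborel)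
    \<le> ennreal (\<Sum>j\<in>{1..k}. w j * ?b j)"
    by (intro nn_integral_mix_density_le w normal_catoni_hermite R \<theta>L m b0) auto
  also have "(\<Sum>j\<in>{1..k}. w j * ?b j)
      = (\<Sum>j\<in>{1..k}. w j) * (1 - s * m + s\<^sup>2 * hermite_var L R / 2) + s * (\<Sum>j\<in>{1..k}. w j * \<theta> j ^ r)"
    unfolding sum_distrib_left sum_distrib_right sum.distrib[symmetric]
    by (intro sum.cong) (auto simp: algebra_simps)
  also have "\<dots> = 1 + (s * ((\<Sum>j\<in>{1..k}. w j * \<theta> j ^ r) - m) + s\<^sup>2 * hermite_var L R / 2)"
    unfolding w1 by (simp add: algebra_simps)
  also have "ennreal \<dots> \<le> ennreal (exp (s * ((\<Sum>j\<in>{1..k}. w j * \<theta> j ^ r) - m) + s\<^sup>2 * hermite_var L R / 2))"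
    by (intro ennreal_leI exp_ge_add_one_self)
  finally show ?thesis .
qed

lemma abs_mixing_moment_le:
  assumes w: "w \<in> weight_simplex k" and \<theta>: "\<theta> \<in> atom_box L k"
  shows "\<bar>\<Sum>j\<in>{1..k}. w j * \<theta> j ^ r\<bar> \<le> L ^ r"
proof -
  have "\<bar>\<Sum>j\<in>{1..k}. w j * \<theta> j ^ r\<bar> \<le> (\<Sum>j\<in>{1..k}. w j * L ^ r)"
  proof (intro order_trans[OF sum_abs] sum_mono)
    fix j assume j: "j \<in> {1..k}"
    have "\<theta> j \<in> {-L..L}" using \<theta> j unfolding atom_box_def by blast
    moreover have "w j \<in> {0..1}" using w j unfolding weight_simplex_def by blast
    ultimately have "\<bar>\<theta> j\<bar> \<le> L" "0 \<le> w j" by (auto simp: abs_le_iff)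
    then show "\<bar>w j * \<theta> j ^ r\<bar> \<le> w j * L ^ r"
      by (simp add: abs_mult power_abs mult_left_mono power_mono)
  qed
  then show ?thesis using w by (simp add: sum_distrib_right[symmetric] weight_simplex_def)
qed

text \<open>Positivity and finiteness are what allow densities to be cancelled in
  \<open>ennreal\<close> quotients.\<close>

lemma mix_density_pos:
  assumes "\<nu> \<in> mixing_dists L"
  shows "0 < mix_density \<nu> x" "mix_density \<nu> x < \<infinity>"
proof -
  obtain k w \<theta> where w: "w \<in> weight_simplex k" and \<nu>: "\<nu> = mixing k w \<theta>"
    using assms by (auto simp: mixing_dists_def mixing_dists_k_def)
  have "(\<Sum>j\<in>{1..k}. w j) = 1" using w by (simp add: weight_simplex_def)
  then obtain j where j: "j \<in> {1..k}" "w j \<noteq> 0" by (metis sum.neutral zero_neq_one)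
  have "0 < (\<Sum>j\<in>{1..k}. w j * normal_density (\<theta> j) 1 x)"
  proof (rule sum_pos2[OF _ j(1)])
    have "0 < w j" using w j by (auto simp: weight_simplex_def PiE_iff less_le)
    then show "0 < w j * normal_density (\<theta> j) 1 x" by (simp add: normal_density_pos)
  qed (use w in \<open>auto simp: weight_simplex_def PiE_iff\<close>)
  then show "0 < mix_density \<nu> x" "mix_density \<nu> x < \<infinity>"
    by (simp_all add: \<nu> mix_density_mixing[OF w])
qed

section \<open>Posterior and tests\<close>

lemma mixing_dists_cases:
  assumes "\<nu> \<in> mixing_dists L"
  obtains k w \<theta> where "1 \<le> k" "w \<in> weight_simplex k" "\<theta> \<in> atom_box L k" "\<nu> = mixing k w \<theta>"
  using assms by (auto simp: mixing_dists_def mixing_dists_k_def)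

lemma borel_measurable_mix_density:
  assumes "\<nu> \<in> mixing_dists L"
  shows "mix_density \<nu> \<in> borel_measurable borel"
proof -
  obtain k w \<theta> where "w \<in> weight_simplex k" "\<nu> = mixing k w \<theta>"
    using assms by (rule mixing_dists_cases)
  then have "mix_density \<nu> = (\<lambda>x. ennreal (\<Sum>j\<in>{1..k}. w j * normal_density (\<theta> j) 1 x))"
    by (auto simp: mix_density_mixing)
  then show ?thesis by simp
qed

lemma nn_integral_mix_density_1:
  assumes "\<nu> \<in> mixing_dists L"
  shows "(\<integral>\<^sup>+ x. mix_density \<nu> x \<partial>lborel) = 1"
proof -
  obtain k w \<theta> where w: "w \<in> weight_simplex k" "\<nu> = mixing k w \<theta>"
    using assms by (rule mixing_dists_cases)
  have 1: "(\<integral>\<^sup>+ x. ennreal (normal_density t 1 x) \<partial>lborel) = 1" for t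
    by (subst nn_integral_eq_integral) auto
  have "(\<integral>\<^sup>+ x. mix_density \<nu> x \<partial>lborel) = (\<Sum>j\<in>{1..k}. ennreal (w j))"
    using nn_integral_mix_density[OF w(1), of "\<lambda>_. 1" \<theta>] w(2) by (simp add: 1)
  also have "\<dots> = 1" using w(1) by (subst sum_ennreal) (auto simp: weight_simplex_def)
  finally show ?thesis .
qed

lemma prob_space_gauss_mix:
  assumes "\<nu> \<in> mixing_dists L"
  shows "prob_space (gauss_mix \<nu>)"
proof
  show "emeasure (gauss_mix \<nu>) (space (gauss_mix \<nu>)) = 1"
    using nn_integral_mix_density_1[OF assms] borel_measurable_mix_density[OF assms]
    by (simp add: gauss_mix_eq_density[OF assms] emeasure_density)
qed

lemma sets_sample_dist: "sets (sample_dist n (gauss_mix \<nu>)) = sets (\<Pi>\<^sub>M i\<in>{1..n}. (borel :: real measure))"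
  unfolding sample_dist_def by (intro sets_PiM_cong refl) (simp add: gauss_mix_def)

lemma prob_space_sample_dist:
  "\<nu> \<in> mixing_dists L \<Longrightarrow> prob_space (sample_dist n (gauss_mix \<nu>))"
  unfolding sample_dist_def by (intro prob_space_PiM prob_space_gauss_mix)

lemma nn_integral_gauss_mix:
  assumes "\<nu> \<in> mixing_dists L" "f \<in> borel_measurable borel"
  shows "(\<integral>\<^sup>+ x. f x \<partial>gauss_mix \<nu>) = (\<integral>\<^sup>+ x. mix_density \<nu> x * f x \<partial>lborel)"
  unfolding gauss_mix_eq_density[OF assms(1)]
  using assms borel_measurable_mix_density[OF assms(1)] by (intro nn_integral_density) auto

lemma nn_integral_sample_dist_prod:
  assumes "\<nu> \<in> mixing_dists L" "f \<in> borel_measurable borel"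
  shows "(\<integral>\<^sup>+ x. (\<Prod>i\<in>{1..n}. f (x i)) \<partial>sample_dist n (gauss_mix \<nu>)) = (\<integral>\<^sup>+ y. mix_density \<nu> y * f y \<partial>lborel) ^ n"
proof -
  interpret product_sigma_finite "\<lambda>_. gauss_mix \<nu>"
    using prob_space_gauss_mix[OF assms(1)]
    by (simp add: product_sigma_finite_def prob_space_imp_sigma_finite)
  have "f \<in> borel_measurable (gauss_mix \<nu>)"
    using assms(2) by (simp add: gauss_mix_def cong: measurable_cong_sets)
  then show ?thesis
    unfolding sample_dist_def
    by (subst product_nn_integral_prod) (simp_all add: nn_integral_gauss_mix[OF assms])
qed

lemma prod_less_top_ennreal:
  fixes b :: "'a \<Rightarrow> ennreal"
  shows "(\<And>i. i \<in> I \<Longrightarrow> b i < top) \<Longrightarrow> (\<Prod>i\<in>I. b i) < top"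
  by (induction I rule: infinite_finite_induct) (auto simp: ennreal_mult_less_top)

lemma prod_divide_ennreal:
  fixes a b :: "'a \<Rightarrow> ennreal"
  assumes "\<And>i. i \<in> I \<Longrightarrow> 0 < b i \<and> b i < \<infinity>"
  shows "(\<Prod>i\<in>I. a i) / (\<Prod>i\<in>I. b i) = (\<Prod>i\<in>I. a i / b i)"
  using assms
proof (induction I rule: infinite_finite_induct)
  case (insert i I)
  have "(\<Prod>i\<in>I. b i) < \<infinity>" "0 < (\<Prod>i\<in>I. b i)"
    using insert by (auto intro!: prod_less_top_ennreal simp: zero_less_iff_neq_zero)
  then have "inverse (b i * (\<Prod>i\<in>I. b i)) = inverse (b i) * inverse (\<Prod>i\<in>I. b i)"
    using insert by (intro ennreal_inverse_mult) auto
  then show ?case using insert by (simp add: divide_ennreal_def mult_ac)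
qed auto

lemma likelihood_pos:
  assumes "\<nu> \<in> mixing_dists L"
  shows "0 < likelihood n \<nu> x" "likelihood n \<nu> x < \<infinity>"
  unfolding likelihood_def using mix_density_pos[OF assms]
  by (auto intro!: prod_less_top_ennreal simp: zero_less_iff_neq_zero)

text \<open>Change of measure: the true density cancels factor by factor, so a product statistic
  weighted by the likelihood ratio is integrated as if the sample came from the alternative.\<close>

lemma nn_integral_likelihood_ratio_prod:
  assumes \<nu>0: "\<nu>\<^sub>0 \<in> mixing_dists L" and \<nu>: "\<nu> \<in> mixing_dists L" and [measurable]: "f \<in> borel_measurable borel"
  shows "(\<integral>\<^sup>+ x. likelihood n \<nu> x / likelihood n \<nu>\<^sub>0 x * (\<Prod>i\<in>{1..n}. f (x i)) \<partial>sample_dist n (gauss_mix \<nu>\<^sub>0))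
    = (\<integral>\<^sup>+ y. mix_density \<nu> y * f y \<partial>lborel) ^ n"
proof -
  note [measurable] = borel_measurable_mix_density[OF \<nu>0] borel_measurable_mix_density[OF \<nu>]
  have "likelihood n \<nu> x / likelihood n \<nu>\<^sub>0 x * (\<Prod>i\<in>{1..n}. f (x i))
      = (\<Prod>i\<in>{1..n}. mix_density \<nu> (x i) / mix_density \<nu>\<^sub>0 (x i) * f (x i))" for x
    unfolding likelihood_def using mix_density_pos[OF \<nu>0]
    by (subst prod_divide_ennreal) (auto simp: prod.distrib)
  then have "(\<integral>\<^sup>+ x. likelihood n \<nu> x / likelihood n \<nu>\<^sub>0 x * (\<Prod>i\<in>{1..n}. f (x i)) \<partial>sample_dist n (gauss_mix \<nu>\<^sub>0))
      = (\<integral>\<^sup>+ y. mix_density \<nu>\<^sub>0 y * (mix_density \<nu> y / mix_density \<nu>\<^sub>0 y * f y) \<partial>lborel) ^ n"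
    using nn_integral_sample_dist_prod[OF \<nu>0, of "\<lambda>y. mix_density \<nu> y / mix_density \<nu>\<^sub>0 y * f y" n] by simp
  moreover have "mix_density \<nu>\<^sub>0 y * (mix_density \<nu> y / mix_density \<nu>\<^sub>0 y * f y) = mix_density \<nu> y * f y" for y
  proof -
    have "mix_density \<nu>\<^sub>0 y * (mix_density \<nu> y / mix_density \<nu>\<^sub>0 y) = mix_density \<nu> y"
      using mix_density_pos[OF \<nu>0, of y] mult_divide_eq_ennreal[of "mix_density \<nu>\<^sub>0 y" "mix_density \<nu> y"]
      by (simp add: ennreal_times_divide mult.commute less_top[symmetric] zero_less_iff_neq_zero)
    then show ?thesis by (simp add: mult.assoc[symmetric])
  qed
  ultimately show ?thesis by simp
qed

lemma space_mixing_space: "space (mixing_space L) = mixing_dists L"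
proof -
  have "mixing_dists L \<subseteq> space (prob_algebra borel)"
    by (auto simp: mixing_dists_def mixing_dists_k_def space_prob_algebra prob_space_mixing)
  then show ?thesis by (auto simp: mixing_space_def space_restrict_space)
qed

text \<open>Measurability jointly in the mixing distribution and the observation underlies the
  exchange of the prior integral with the sample integral.\<close>

lemma measurable_mix_density[measurable]:
  "(\<lambda>z. mix_density (fst z) (snd z)) \<in> borel_measurable (mixing_space L \<Otimes>\<^sub>M borel)"
  unfolding mix_density_def
proof (rule nn_integral_measurable_subprob_algebra2[where N = borel])
  have "(\<lambda>\<nu>. \<nu>) \<in> mixing_space L \<rightarrow>\<^sub>M prob_algebra borel"
    unfolding mixing_space_def by (rule measurable_restrict_space1) simp
  then have "(\<lambda>\<nu>. \<nu>) \<in> mixing_space L \<rightarrow>\<^sub>M subprob_algebra borel"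
    by (rule measurable_prob_algebraD)
  then show "fst \<in> mixing_space L \<Otimes>\<^sub>M (borel :: real measure) \<rightarrow>\<^sub>M subprob_algebra borel"
    by (rule measurable_compose[OF measurable_fst])
  show "(\<lambda>(x, y). ennreal (normal_density y 1 (snd x)))
      \<in> borel_measurable ((mixing_space L \<Otimes>\<^sub>M borel) \<Otimes>\<^sub>M borel)"
    unfolding normal_density_def by measurable
qed

lemma measurable_likelihood:
  "(\<lambda>z. likelihood n (fst z) (snd z)) \<in> borel_measurable (mixing_space L \<Otimes>\<^sub>M (\<Pi>\<^sub>M i\<in>{1..n}. borel))"
  unfolding likelihood_def
proof (rule borel_measurable_prod_ennreal)
  fix i assume i: "i \<in> {1..n}"
  have "(\<lambda>z. (fst z, snd z i)) \<in> mixing_space L \<Otimes>\<^sub>M (\<Pi>\<^sub>M i\<in>{1..n}. borel) \<rightarrow>\<^sub>M mixing_space L \<Otimes>\<^sub>M borel"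
    using i by (intro measurable_Pair measurable_fst measurable_compose[OF measurable_snd measurable_component_singleton])
  from measurable_compose[OF this measurable_mix_density]
  show "(\<lambda>z. mix_density (fst z) (snd z i)) \<in> borel_measurable (mixing_space L \<Otimes>\<^sub>M (\<Pi>\<^sub>M i\<in>{1..n}. borel))"
    by simp
qed

lemma ennreal_inverse_antimono: "a \<le> b \<Longrightarrow> inverse b \<le> inverse (a :: ennreal)"
  by (simp add: less_eq_ennreal.rep_eq inverse_ennreal.rep_eq ereal_inverse_antimono)

section \<open>From tests and evidence to the posterior\<close>

lemma emeasure_posterior_le_1:
  assumes [measurable_cong]: "sets P = sets (mixing_space L)" and x: "x \<in> space (\<Pi>\<^sub>M i\<in>{1..n}. borel)"
  shows "emeasure (posterior n P x) U \<le> 1"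
proof -
  let ?D = "\<integral>\<^sup>+ \<nu>. likelihood n \<nu> x \<partial>P"
  have [measurable]: "(\<lambda>\<nu>. likelihood n \<nu> x) \<in> borel_measurable P"
    using measurable_compose[OF measurable_Pair2'[OF x] measurable_likelihood] by simp
  have "emeasure (posterior n P x) U \<le> emeasure (posterior n P x) (space P)"
    using emeasure_space[of "posterior n P x" U] by (simp add: posterior_def)
  also have "\<dots> = (\<integral>\<^sup>+ \<nu>. likelihood n \<nu> x * inverse ?D \<partial>P)"
    unfolding posterior_def by (subst emeasure_density) (auto intro!: nn_integral_cong simp: divide_ennreal_def)
  also have "\<dots> = ?D * inverse ?D" by (rule nn_integral_multc) simp
  \<comment> \<open>The evidence may be 0 or infinite at a given sample; the product is then 0, by
    \<open>0 * top = 0\<close>.\<close>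
  also have "\<dots> \<le> 1"
    by (cases "?D = 0 \<or> ?D = top") (auto simp: ennreal_mult_divide_eq divide_ennreal_def[symmetric] less_top ennreal_divide_self)
  finally show ?thesis .
qed

text \<open>\<open>E\<close> is the event on which the evidence is bounded below, \<open>T\<close> the rejection region.\<close>

lemma posterior_expectation_le:
  assumes P: "P \<in> space (prob_algebra (mixing_space L))" and \<nu>0: "\<nu>\<^sub>0 \<in> mixing_dists L"
    and E: "E \<in> sets (\<Pi>\<^sub>M i\<in>{1..n}. (borel :: real measure))" and T: "T \<in> sets (\<Pi>\<^sub>M i\<in>{1..n}. (borel :: real measure))"
    and U: "U \<in> sets (mixing_space L)" and \<rho>: "0 < \<rho>"
    and ev: "\<And>x. x \<in> E \<Longrightarrow> ennreal \<rho> * likelihood n \<nu>\<^sub>0 x \<le> (\<integral>\<^sup>+ \<nu>. likelihood n \<nu> x \<partial>P)"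
  defines "Q \<equiv> sample_dist n (gauss_mix \<nu>\<^sub>0)"
  shows "(\<integral>\<^sup>+ x. emeasure (posterior n P x) U \<partial>Q) \<le> emeasure Q (space Q - E) + emeasure Q T +
    ennreal (1 / \<rho>) * (\<integral>\<^sup>+ \<nu>. indicator U \<nu> *
      (\<integral>\<^sup>+ x. indicator (- T) x * (likelihood n \<nu> x / likelihood n \<nu>\<^sub>0 x) \<partial>Q) \<partial>P)"
proof -
  have sQ[measurable_cong]: "sets Q = sets (\<Pi>\<^sub>M i\<in>{1..n}. borel)"
    unfolding Q_def by (rule sets_sample_dist)
  have sP[measurable_cong]: "sets P = sets (mixing_space L)" and "prob_space P"
    using P by (auto simp: space_prob_algebra)
  then interpret P: prob_space P by simp
  interpret Q: prob_space Q unfolding Q_def using \<nu>0 by (rule prob_space_sample_dist)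
  interpret PQ: pair_sigma_finite P Q ..
  note spQ = sets_eq_imp_space_eq[OF sQ]
  note [measurable] = E T U
  have lm[measurable]: "(\<lambda>z. likelihood n (fst z) (snd z)) \<in> borel_measurable (P \<Otimes>\<^sub>M Q)"
    using measurable_likelihood[of n L] by (simp cong: measurable_cong_sets sets_pair_measure_cong add: sP sQ)
  have l1: "(\<lambda>\<nu>. likelihood n \<nu> x) \<in> borel_measurable P" if "x \<in> space Q" for x
    using measurable_compose[OF measurable_Pair2'[OF that] lm] by simp
  have \<nu>0P: "\<nu>\<^sub>0 \<in> space P" using \<nu>0 sets_eq_imp_space_eq[OF sP] by (simp add: space_mixing_space)
  have l0[measurable]: "(\<lambda>x. likelihood n \<nu>\<^sub>0 x) \<in> borel_measurable Q"
    using measurable_compose[OF measurable_Pair1'[OF \<nu>0P] lm] by simp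
  define F where "F \<nu> x = indicator U \<nu> * (indicator (- T) x * (likelihood n \<nu> x / likelihood n \<nu>\<^sub>0 x))" for \<nu> x
  have Tc[measurable]: "(indicator (- T) :: _ \<Rightarrow> ennreal) \<in> borel_measurable Q"
  proof -
    have "(indicator (space Q - T) :: _ \<Rightarrow> ennreal) \<in> borel_measurable Q" by measurable
    then show ?thesis by (rule measurable_cong[THEN iffD1, rotated]) (auto simp: indicator_def)
  qed
  have Fm[measurable]: "case_prod F \<in> borel_measurable (P \<Otimes>\<^sub>M Q)"
    unfolding F_def split_beta by measurable
  \<comment> \<open>Off \<open>E\<close> and on \<open>T\<close> the posterior mass is bounded by 1.
    Elsewhere the evidence bound replaces the denominator by the likelihood of the truth, which
    leaves a likelihood ratio restricted to acceptance.\<close>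
  have pointwise: "emeasure (posterior n P x) U
      \<le> indicator (space Q - E) x + indicator T x + ennreal (1 / \<rho>) * (\<integral>\<^sup>+ \<nu>. F \<nu> x \<partial>P)"
    if x: "x \<in> space Q" for x
  proof (cases "x \<in> E \<and> x \<notin> T")
    case False
    have "emeasure (posterior n P x) U \<le> 1"
      using emeasure_posterior_le_1[OF sP] x spQ by simp
    also have "1 \<le> (indicator (space Q - E) x + indicator T x :: ennreal)"
      using False x by (auto simp: indicator_def)
    finally show ?thesis by (simp add: add_increasing2)
  next
    case True
    let ?D = "\<integral>\<^sup>+ \<nu>. likelihood n \<nu> x \<partial>P"
    have "inverse ?D \<le> inverse (ennreal \<rho> * likelihood n \<nu>\<^sub>0 x)"
      using True by (intro ennreal_inverse_antimono ev) auto
    also have "\<dots> = ennreal (1 / \<rho>) * inverse (likelihood n \<nu>\<^sub>0 x)"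
      using likelihood_pos[OF \<nu>0, of n x] \<rho>
      by (subst ennreal_inverse_mult) (auto simp: inverse_ennreal inverse_eq_divide)
    finally have inv: "inverse ?D \<le> ennreal (1 / \<rho>) * inverse (likelihood n \<nu>\<^sub>0 x)" .
    have "emeasure (posterior n P x) U = (\<integral>\<^sup>+ \<nu>. likelihood n \<nu> x / ?D * indicator U \<nu> \<partial>P)"
      unfolding posterior_def using l1[OF x] U sP by (intro emeasure_density) auto
    also have "\<dots> \<le> (\<integral>\<^sup>+ \<nu>. ennreal (1 / \<rho>) * F \<nu> x \<partial>P)"
    proof (rule nn_integral_mono)
      fix \<nu>
      have "likelihood n \<nu> x * inverse ?D * indicator U \<nu>
          \<le> likelihood n \<nu> x * (ennreal (1 / \<rho>) * inverse (likelihood n \<nu>\<^sub>0 x)) * indicator U \<nu>"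
        by (intro mult_right_mono mult_left_mono inv) auto
      then show "likelihood n \<nu> x / ?D * indicator U \<nu> \<le> ennreal (1 / \<rho>) * F \<nu> x"
        using True by (simp add: F_def divide_ennreal_def mult_ac)
    qed
    also have "\<dots> = ennreal (1 / \<rho>) * (\<integral>\<^sup>+ \<nu>. F \<nu> x \<partial>P)"
      using measurable_compose[OF measurable_Pair2'[OF x] Fm] by (intro nn_integral_cmult) simp
    finally show ?thesis by (simp add: add_increasing)
  qed
  have "(\<integral>\<^sup>+ x. emeasure (posterior n P x) U \<partial>Q)
      \<le> (\<integral>\<^sup>+ x. indicator (space Q - E) x + indicator T x + ennreal (1 / \<rho>) * (\<integral>\<^sup>+ \<nu>. F \<nu> x \<partial>P) \<partial>Q)"
    by (rule nn_integral_mono) (rule pointwise)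
  also have "\<dots> = emeasure Q (space Q - E) + emeasure Q T + ennreal (1 / \<rho>) * (\<integral>\<^sup>+ x. (\<integral>\<^sup>+ \<nu>. F \<nu> x \<partial>P) \<partial>Q)"
    by (subst nn_integral_add nn_integral_cmult; (measurable; fail)?)+
  also have "(\<integral>\<^sup>+ x. (\<integral>\<^sup>+ \<nu>. F \<nu> x \<partial>P) \<partial>Q) = (\<integral>\<^sup>+ \<nu>. (\<integral>\<^sup>+ x. F \<nu> x \<partial>Q) \<partial>P)"
    by (rule PQ.Fubini'[OF Fm])
  also have "\<dots> = (\<integral>\<^sup>+ \<nu>. indicator U \<nu> * (\<integral>\<^sup>+ x. indicator (- T) x * (likelihood n \<nu> x / likelihood n \<nu>\<^sub>0 x) \<partial>Q) \<partial>P)"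
  proof (rule nn_integral_cong)
    fix \<nu> assume \<nu>: "\<nu> \<in> space P"
    have [measurable]: "(\<lambda>x. likelihood n \<nu> x) \<in> borel_measurable Q"
      using measurable_compose[OF measurable_Pair1'[OF \<nu>] lm] by simp
    show "(\<integral>\<^sup>+ x. F \<nu> x \<partial>Q)
        = indicator U \<nu> * (\<integral>\<^sup>+ x. indicator (- T) x * (likelihood n \<nu> x / likelihood n \<nu>\<^sub>0 x) \<partial>Q)"
      unfolding F_def by (rule nn_integral_cmult) measurable
  qed
  finally show ?thesis .
qed

section \<open>Error bounds for the moment tests\<close>

lemma mixing_in_dists:
  "1 \<le> k \<Longrightarrow> w \<in> weight_simplex k \<Longrightarrow> \<theta> \<in> atom_box L k \<Longrightarrow> mixing k w \<theta> \<in> mixing_dists L"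
  by (auto simp: mixing_dists_def mixing_dists_k_def)

text \<open>Rejection region of a one-sided test of the value \<open>m\<close> for the moment of
  order \<open>r\<close>: the sign of \<open>s\<close> is the direction, its size the scale, and
  \<open>exp c\<close> the critical value.\<close>

definition catoni_region :: "nat \<Rightarrow> nat \<Rightarrow> real \<Rightarrow> real \<Rightarrow> real \<Rightarrow> (nat \<Rightarrow> real) set" where
  "catoni_region n r s m c = {x \<in> space (\<Pi>\<^sub>M i\<in>{1..n}. borel).
    ennreal (exp c) \<le> (\<Prod>i\<in>{1..n}. ennreal (catoni (s * (hermite r (x i) - m))))}"

lemma measurable_catoni_prod:
  "(\<lambda>x. \<Prod>i\<in>{1..n}. ennreal (catoni (s * (hermite r (x i) - m)))) \<in> borel_measurable (\<Pi>\<^sub>M i\<in>{1..n}. borel)"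
proof (rule borel_measurable_prod_ennreal)
  fix i assume "i \<in> {1..n}"
  then have [measurable]: "(\<lambda>x. x i) \<in> borel_measurable (\<Pi>\<^sub>M i\<in>{1..n}. (borel :: real measure))"
    by (rule measurable_component_singleton)
  show "(\<lambda>x. ennreal (catoni (s * (hermite r (x i) - m)))) \<in> borel_measurable (\<Pi>\<^sub>M i\<in>{1..n}. borel)"
    by measurable
qed

lemma sets_catoni_region: "catoni_region n r s m c \<in> sets (\<Pi>\<^sub>M i\<in>{1..n}. borel)"
proof -
  note [measurable] = measurable_catoni_prod
  show ?thesis unfolding catoni_region_def by measurable
qed

lemma ennreal_exp_power_mult: "ennreal (exp a) * ennreal (exp b) ^ n = ennreal (exp (a + real n * b))"
  by (simp add: ennreal_power ennreal_mult[symmetric] exp_add exp_of_nat_mult)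

text \<open>Markov's inequality; the expectation of the product factorises over the sample. When
  \<open>m\<close> is the true moment, the linear term vanishes.\<close>

lemma catoni_region_level:
  assumes k: "1 \<le> k" and w: "w \<in> weight_simplex k" and \<theta>: "\<theta> \<in> atom_box L k" and L: "0 \<le> L"
    and R: "1 \<le> R" "r \<le> R" and m: "\<bar>m\<bar> \<le> L ^ r"
  shows "emeasure (sample_dist n (gauss_mix (mixing k w \<theta>))) (catoni_region n r s m c)
    \<le> ennreal (exp (- c + real n * (s * ((\<Sum>j\<in>{1..k}. w j * \<theta> j ^ r) - m) + s\<^sup>2 * hermite_var L R / 2)))"
proof -
  let ?Q = "sample_dist n (gauss_mix (mixing k w \<theta>))"
  let ?e = "s * ((\<Sum>j\<in>{1..k}. w j * \<theta> j ^ r) - m) + s\<^sup>2 * hermite_var L R / 2"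
  let ?f = "\<lambda>x. \<Prod>i\<in>{1..n}. ennreal (catoni (s * (hermite r (x i) - m)))"
  note \<nu>0 = mixing_in_dists[OF k w \<theta>]
  note sQ = sets_sample_dist[of n "mixing k w \<theta>"]
  have reg: "catoni_region n r s m c \<in> sets ?Q" using sets_catoni_region sQ by simp
  have fm: "?f \<in> borel_measurable ?Q"
    using measurable_catoni_prod by (simp cong: measurable_cong_sets add: sQ)
  have "emeasure ?Q (catoni_region n r s m c) = (\<integral>\<^sup>+ x. indicator (catoni_region n r s m c) x \<partial>?Q)"
    using reg by simp
  also have "\<dots> \<le> (\<integral>\<^sup>+ x. ennreal (exp (- c)) * ?f x \<partial>?Q)"
  proof (intro nn_integral_mono)
    fix x
    have "1 \<le> ennreal (exp (- c)) * ?f x" if "ennreal (exp c) \<le> ?f x"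
      using mult_left_mono[OF that, of "ennreal (exp (- c))"]
      by (simp add: ennreal_mult[symmetric] exp_add[symmetric])
    then show "indicator (catoni_region n r s m c) x \<le> ennreal (exp (- c)) * ?f x"
      by (auto simp: indicator_def catoni_region_def)
  qed
  also have "\<dots> = ennreal (exp (- c)) * (\<integral>\<^sup>+ x. ?f x \<partial>?Q)"
    using fm by (rule nn_integral_cmult)
  also have "(\<integral>\<^sup>+ x. ?f x \<partial>?Q)
      = (\<integral>\<^sup>+ y. mix_density (mixing k w \<theta>) y * ennreal (catoni (s * (hermite r y - m))) \<partial>lborel) ^ n"
    by (rule nn_integral_sample_dist_prod[OF \<nu>0]) measurable
  also have "\<dots> \<le> ennreal (exp ?e) ^ n"
    by (intro power_mono mixture_catoni_hermite w \<theta> L R m) auto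
  finally show ?thesis by (simp add: mult_left_mono ennreal_exp_power_mult)
qed

text \<open>Outside the region the product with \<open>s\<close> is at most \<open>exp c\<close>, so
  \<open>exp c\<close> times the product with \<open>- s\<close> is at least 1 and can be inserted
  under the integral. \<open>T\<close> is only required to contain the region because it will be a
  union of several.\<close>

lemma catoni_region_power:
  assumes \<nu>0: "\<nu>\<^sub>0 \<in> mixing_dists L"
    and k: "1 \<le> k" and w: "w \<in> weight_simplex k" and \<theta>: "\<theta> \<in> atom_box L k" and L: "0 \<le> L"
    and R: "1 \<le> R" "r \<le> R" and m: "\<bar>m\<bar> \<le> L ^ r" and T: "catoni_region n r s m c \<subseteq> T"
  shows "(\<integral>\<^sup>+ x. indicator (- T) x * (likelihood n (mixing k w \<theta>) x / likelihood n \<nu>\<^sub>0 x)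
        \<partial>sample_dist n (gauss_mix \<nu>\<^sub>0))
    \<le> ennreal (exp (c + real n * (- s * ((\<Sum>j\<in>{1..k}. w j * \<theta> j ^ r) - m) + s\<^sup>2 * hermite_var L R / 2)))"
proof -
  let ?Q = "sample_dist n (gauss_mix \<nu>\<^sub>0)"
  let ?lr = "\<lambda>x. likelihood n (mixing k w \<theta>) x / likelihood n \<nu>\<^sub>0 x"
  let ?e = "- s * ((\<Sum>j\<in>{1..k}. w j * \<theta> j ^ r) - m) + (- s)\<^sup>2 * hermite_var L R / 2"
  let ?f = "\<lambda>s x. \<Prod>i\<in>{1..n}. ennreal (catoni (s * (hermite r (x i) - m)))"
  note \<nu> = mixing_in_dists[OF k w \<theta>]
  note sQ = sets_sample_dist[of n "\<nu>\<^sub>0"]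
  note spQ = sets_eq_imp_space_eq[OF sQ]
  have lm: "likelihood n \<nu> \<in> borel_measurable ?Q" if "\<nu> \<in> mixing_dists L" for \<nu>
  proof -
    have "\<nu> \<in> space (mixing_space L)" using that by (simp add: space_mixing_space)
    from measurable_compose[OF measurable_Pair1'[OF this] measurable_likelihood]
    show ?thesis by (simp cong: measurable_cong_sets add: sQ)
  qed
  note [measurable] = lm[OF \<nu>] lm[OF \<nu>0]
  have [measurable]: "?f s \<in> borel_measurable ?Q" for s
    using measurable_catoni_prod by (simp cong: measurable_cong_sets add: sQ)
  have "(\<integral>\<^sup>+ x. indicator (- T) x * ?lr x \<partial>?Q) \<le> (\<integral>\<^sup>+ x. ennreal (exp c) * (?lr x * ?f (- s) x) \<partial>?Q)"
  proof (rule nn_integral_mono)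
    fix x assume x: "x \<in> space ?Q"
    show "indicator (- T) x * ?lr x \<le> ennreal (exp c) * (?lr x * ?f (- s) x)"
    proof (cases "x \<in> T")
      case False
      then have "?f s x \<le> ennreal (exp c)"
        using T x spQ by (auto simp: catoni_region_def)
      moreover have "1 \<le> ?f s x * ?f (- s) x"
        unfolding prod.distrib[symmetric]
      proof (rule prod_ge_1)
        fix i
        have "1 \<le> ennreal (catoni (s * (hermite r (x i) - m)) * catoni (- (s * (hermite r (x i) - m))))"
          using catoni_mult_catoni_uminus by (metis ennreal_1 ennreal_leI)
        then show "1 \<le> ennreal (catoni (s * (hermite r (x i) - m))) * ennreal (catoni (- s * (hermite r (x i) - m)))"
          by (simp add: ennreal_mult less_imp_le[OF catoni_pos])
      qed
      ultimately have "1 \<le> ennreal (exp c) * ?f (- s) x"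
        by (meson mult_right_mono order_trans zero_le)
      then have "1 * ?lr x \<le> ennreal (exp c) * ?f (- s) x * ?lr x" by (rule mult_right_mono) simp
      then show ?thesis using False by (simp add: mult_ac)
    qed simp
  qed
  also have "\<dots> = ennreal (exp c) * (\<integral>\<^sup>+ x. ?lr x * ?f (- s) x \<partial>?Q)"
    by (rule nn_integral_cmult) measurable
  also have "(\<integral>\<^sup>+ x. ?lr x * ?f (- s) x \<partial>?Q)
      = (\<integral>\<^sup>+ y. mix_density (mixing k w \<theta>) y * ennreal (catoni (- s * (hermite r y - m))) \<partial>lborel) ^ n"
    by (rule nn_integral_likelihood_ratio_prod[OF \<nu>0 \<nu>]) measurable
  also have "\<dots> \<le> ennreal (exp ?e) ^ n"
    by (intro power_mono mixture_catoni_hermite w \<theta> L R m) auto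
  finally show ?thesis by (simp add: mult_left_mono ennreal_exp_power_mult)
qed

lemma hermite_var_pos: "1 \<le> R \<Longrightarrow> 0 < hermite_var L R"
  by (simp add: hermite_var_def)

text \<open>The union of the \<open>2 * R\<close> one-sided regions depends on the truth alone. Each
  alternative with a deviating moment is rejected by one of them, and enlarging the region only
  improves the power.\<close>

lemma moment_test:
  fixes n :: nat
  assumes k0: "1 \<le> k\<^sub>0" and w0: "w\<^sub>0 \<in> weight_simplex k\<^sub>0" and \<theta>0: "\<theta>\<^sub>0 \<in> atom_box L k\<^sub>0" and L: "0 \<le> L"
    and R: "1 \<le> R" and \<delta>: "0 < \<delta>"
  defines "\<nu>\<^sub>0 \<equiv> mixing k\<^sub>0 w\<^sub>0 \<theta>\<^sub>0"
  defines "e \<equiv> exp (- (real n * \<delta>\<^sup>2 / (8 * hermite_var L R)))"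
  obtains T where "T \<in> sets (\<Pi>\<^sub>M i\<in>{1..n}. borel)"
    "emeasure (sample_dist n (gauss_mix \<nu>\<^sub>0)) T \<le> ennreal (2 * real R * e)"
    "\<And>k w \<theta> r. 1 \<le> k \<Longrightarrow> w \<in> weight_simplex k \<Longrightarrow> \<theta> \<in> atom_box L k \<Longrightarrow> r \<in> {1..R} \<Longrightarrow>
       \<delta> \<le> \<bar>(\<Sum>j\<in>{1..k}. w j * \<theta> j ^ r) - (\<Sum>j\<in>{1..k\<^sub>0}. w\<^sub>0 j * \<theta>\<^sub>0 j ^ r)\<bar> \<Longrightarrow>
       (\<integral>\<^sup>+ x. indicator (- T) x * (likelihood n (mixing k w \<theta>) x / likelihood n \<nu>\<^sub>0 x)
          \<partial>sample_dist n (gauss_mix \<nu>\<^sub>0)) \<le> ennreal e"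
proof -
  define V where "V = hermite_var L R"
  \<comment> \<open>With \<open>c\<close> at half of \<open>n * \<alpha> * \<delta>\<close> both
    error exponents become \<open>n * (\<alpha>^2 * V - \<alpha> * \<delta>) / 2\<close>. This
    \<alpha> minimises that expression, with value
    \<open>- n * \<delta>^2 / (8 * V)\<close>.\<close>
  define \<alpha> where "\<alpha> = \<delta> / (2 * V)"
  define c where "c = real n * \<alpha> * \<delta> / 2"
  define m where "m r = (\<Sum>j\<in>{1..k\<^sub>0}. w\<^sub>0 j * \<theta>\<^sub>0 j ^ r)" for r
  let ?Q = "sample_dist n (gauss_mix \<nu>\<^sub>0)"
  have V: "0 < V" using hermite_var_pos[OF R] by (simp add: V_def)
  have m: "\<bar>m r\<bar> \<le> L ^ r" for r unfolding m_def by (rule abs_mixing_moment_le[OF w0 \<theta>0])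
  have \<alpha>: "0 < \<alpha>" using V \<delta> by (simp add: \<alpha>_def)
  have \<alpha>e: "- c + real n * (\<alpha>\<^sup>2 * V / 2) = - (real n * \<delta>\<^sup>2 / (8 * V))"
    using V by (simp add: c_def \<alpha>_def field_simps power2_eq_square)
  have \<nu>0: "\<nu>\<^sub>0 \<in> mixing_dists L" unfolding \<nu>\<^sub>0_def by (rule mixing_in_dists[OF k0 w0 \<theta>0])
  define I where "I = {1..R} \<times> {\<alpha>, - \<alpha>}"
  define T where "T = (\<Union>(r, s)\<in>I. catoni_region n r s (m r) c)"
  have fin: "finite I" by (simp add: I_def)
  have level: "emeasure ?Q (catoni_region n r s (m r) c) \<le> ennreal e" if "(r, s) \<in> I" for r s
  proof -
    have s: "s\<^sup>2 = \<alpha>\<^sup>2" and r: "r \<le> R" using that by (auto simp: I_def)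
    show ?thesis
      using catoni_region_level[OF k0 w0 \<theta>0 L R r m[of r], of n s c]
      unfolding \<nu>\<^sub>0_def[symmetric] m_def[symmetric] V_def[symmetric] s e_def diff_self mult_zero_right add_0 \<alpha>e .
  qed
  have "emeasure ?Q T \<le> (\<Sum>(r, s)\<in>I. emeasure ?Q (catoni_region n r s (m r) c))"
    unfolding T_def split_beta using fin
    by (intro emeasure_subadditive_finite image_subsetI) (simp_all only: sets_sample_dist sets_catoni_region)
  also have "\<dots> \<le> (\<Sum>(r, s)\<in>I. ennreal e)"
    by (intro sum_mono) (auto intro: level)
  also have "\<dots> = ennreal (2 * real R * e)"
    using \<alpha> by (simp add: I_def card_cartesian_product ennreal_of_nat_eq_real_of_nat ennreal_mult[symmetric] e_def mult_ac)
  finally have T1: "emeasure ?Q T \<le> ennreal (2 * real R * e)" .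
  have T2: "(\<integral>\<^sup>+ x. indicator (- T) x * (likelihood n (mixing k w \<theta>) x / likelihood n \<nu>\<^sub>0 x) \<partial>?Q) \<le> ennreal e"
    if A: "1 \<le> k" "w \<in> weight_simplex k" "\<theta> \<in> atom_box L k" and r: "r \<in> {1..R}"
      and d: "\<delta> \<le> \<bar>(\<Sum>j\<in>{1..k}. w j * \<theta> j ^ r) - (\<Sum>j\<in>{1..k\<^sub>0}. w\<^sub>0 j * \<theta>\<^sub>0 j ^ r)\<bar>" for k w \<theta> r
  proof -
    define \<Delta> where "\<Delta> = (\<Sum>j\<in>{1..k}. w j * \<theta> j ^ r) - m r"
    define s where "s = (if 0 \<le> \<Delta> then \<alpha> else - \<alpha>)"
    have s2: "s\<^sup>2 = \<alpha>\<^sup>2" by (simp add: s_def)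
    have "\<delta> \<le> \<bar>\<Delta>\<bar>" using d by (simp add: \<Delta>_def m_def)
    then have "\<alpha> * \<delta> \<le> \<alpha> * \<bar>\<Delta>\<bar>" using \<alpha> by (intro mult_left_mono) auto
    also have "\<dots> = s * \<Delta>" by (simp add: s_def)
    finally have "\<alpha> * \<delta> \<le> s * \<Delta>" .
    then have "real n * (\<alpha> * \<delta>) \<le> real n * (s * \<Delta>)" by (rule mult_left_mono) simp
    then have "c + real n * (- s * \<Delta> + s\<^sup>2 * V / 2) \<le> - c + real n * (\<alpha>\<^sup>2 * V / 2)"
      by (simp add: s2 c_def algebra_simps)
    then have ex: "c + real n * (- s * \<Delta> + s\<^sup>2 * V / 2) \<le> - (real n * \<delta>\<^sup>2 / (8 * V))"
      unfolding \<alpha>e .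
    have rs: "(r, s) \<in> I" "r \<le> R" using r by (auto simp: I_def s_def)
    then have sub: "catoni_region n r s (m r) c \<subseteq> T" by (auto simp: T_def)
    have "(\<integral>\<^sup>+ x. indicator (- T) x * (likelihood n (mixing k w \<theta>) x / likelihood n \<nu>\<^sub>0 x) \<partial>?Q)
        \<le> ennreal (exp (c + real n * (- s * \<Delta> + s\<^sup>2 * V / 2)))"
      unfolding \<Delta>_def V_def by (rule catoni_region_power[OF \<nu>0 A L R rs(2) m sub])
    also have "\<dots> \<le> ennreal e" unfolding e_def V_def[symmetric] using ex by (intro ennreal_leI) simp
    finally show ?thesis .
  qed
  have "T \<in> sets (\<Pi>\<^sub>M i\<in>{1..n}. borel)"
    unfolding T_def split_beta using fin by (intro sets.finite_UN sets_catoni_region)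
  then show ?thesis using T1 T2 by (rule that)
qed

section \<open>Tails of the sample\<close>

text \<open>Chernoff's bound with slope \<open>u\<close>: on the tail
  \<open>exp (u * (|y| - L - u)) \<ge> 1\<close>, and the terms in \<open>u * L\<close> cancel in
  the exponential moment.\<close>

lemma gauss_mix_tail:
  assumes k: "1 \<le> k" and w: "w \<in> weight_simplex k" and \<theta>: "\<theta> \<in> atom_box L k" and u: "0 \<le> u"
  shows "emeasure (gauss_mix (mixing k w \<theta>)) {y. L + u < \<bar>y\<bar>} \<le> ennreal (2 * exp (- u\<^sup>2 / 2))"
proof -
  note \<nu> = mixing_in_dists[OF k w \<theta>]
  have \<theta>L: "\<bar>\<theta> j\<bar> \<le> L" if "j \<in> {1..k}" for j
  proof -
    have "\<theta> j \<in> {-L..L}" using \<theta> that unfolding atom_box_def by blast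
    then show ?thesis by (auto simp: abs_le_iff)
  qed
  have single: "(\<integral>\<^sup>+ y. ennreal (normal_density t 1 y) * indicator {y. L + u < \<bar>y\<bar>} y \<partial>lborel)
      \<le> ennreal (2 * exp (- u\<^sup>2 / 2))" if t: "\<bar>t\<bar> \<le> L" for t
  proof -
    let ?g = "\<lambda>y. exp (- (u * (L + u))) * (exp (u * \<bar>y\<bar>) * normal_density t 1 y)"
    have int: "integrable lborel ?g" by (intro integrable_mult_right normal_exp_abs(1)[OF t u])
    have "(\<integral>\<^sup>+ y. ennreal (normal_density t 1 y) * indicator {y. L + u < \<bar>y\<bar>} y \<partial>lborel)
        \<le> (\<integral>\<^sup>+ y. ennreal (?g y) \<partial>lborel)"
    proof (rule nn_integral_mono)
      fix y
      have "normal_density t 1 y \<le> ?g y" if "L + u < \<bar>y\<bar>"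
      proof -
        have "u * (L + u) \<le> u * \<bar>y\<bar>" using that u by (intro mult_left_mono) auto
        then have "1 \<le> exp (- (u * (L + u))) * exp (u * \<bar>y\<bar>)" by (simp add: exp_add[symmetric])
        from mult_right_mono[OF this, of "normal_density t 1 y"] show ?thesis by (simp add: mult.assoc)
      qed
      then show "ennreal (normal_density t 1 y) * indicator {y. L + u < \<bar>y\<bar>} y \<le> ennreal (?g y)"
        by (auto simp: indicator_def intro!: ennreal_leI)
    qed
    also have "\<dots> = ennreal (integral\<^sup>L lborel ?g)"
      by (intro nn_integral_eq_integral int) auto
    also have "\<dots> \<le> ennreal (exp (- (u * (L + u))) * (2 * exp (u * L + u\<^sup>2 / 2)))"
      using normal_exp_abs(2)[OF t u] by (intro ennreal_leI) simp
    also have "exp (- (u * (L + u))) * (2 * exp (u * L + u\<^sup>2 / 2)) = 2 * exp (- u\<^sup>2 / 2)"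
    proof -
      have "- (u * (L + u)) + (u * L + u\<^sup>2 / 2) = - u\<^sup>2 / 2"
        by (simp add: power2_eq_square algebra_simps)
      then show ?thesis by (simp add: exp_add[symmetric])
    qed
    finally show ?thesis .
  qed
  have "emeasure (gauss_mix (mixing k w \<theta>)) {y. L + u < \<bar>y\<bar>}
      = (\<integral>\<^sup>+ y. mix_density (mixing k w \<theta>) y * indicator {y. L + u < \<bar>y\<bar>} y \<partial>lborel)"
    unfolding gauss_mix_eq_density[OF \<nu>] using borel_measurable_mix_density[OF \<nu>]
    by (subst emeasure_density) auto
  also have "\<dots> \<le> ennreal (\<Sum>j\<in>{1..k}. w j * (2 * exp (- u\<^sup>2 / 2)))"
    by (intro nn_integral_mix_density_le w single \<theta>L) auto
  also have "(\<Sum>j\<in>{1..k}. w j * (2 * exp (- u\<^sup>2 / 2))) = 2 * exp (- u\<^sup>2 / 2)"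
    using w unfolding sum_distrib_right[symmetric] by (simp add: weight_simplex_def)
  finally show ?thesis .
qed

lemma sample_tail:
  fixes n :: nat
  assumes k: "1 \<le> k" and w: "w \<in> weight_simplex k" and \<theta>: "\<theta> \<in> atom_box L k" and u: "0 \<le> u"
  defines "Q \<equiv> sample_dist n (gauss_mix (mixing k w \<theta>))"
    and "E \<equiv> {x \<in> space (\<Pi>\<^sub>M i\<in>{1..n}. borel). \<forall>i\<in>{1..n}. \<bar>x i\<bar> \<le> L + u}"
  shows "E \<in> sets (\<Pi>\<^sub>M i\<in>{1..n}. borel)" "emeasure Q (space Q - E) \<le> ennreal (real n * (2 * exp (- u\<^sup>2 / 2)))"
proof -
  let ?G = "gauss_mix (mixing k w \<theta>)"
  let ?B = "{y. L + u < \<bar>y\<bar>}"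
  note \<nu> = mixing_in_dists[OF k w \<theta>]
  have comp: "(\<lambda>x. x i) \<in> borel_measurable (\<Pi>\<^sub>M i\<in>{1..n}. (borel :: real measure))" if "i \<in> {1..n}" for i
    using that by (rule measurable_component_singleton)
  show "E \<in> sets (\<Pi>\<^sub>M i\<in>{1..n}. borel)"
    unfolding E_def by (intro sets.sets_Collect_finite_All) (use comp in \<open>auto intro!: borel_measurable_le\<close>)
  have sQ: "sets Q = sets (\<Pi>\<^sub>M i\<in>{1..n}. borel)" unfolding Q_def by (rule sets_sample_dist)
  have compQ: "(\<lambda>x. x i) \<in> borel_measurable Q" if "i \<in> {1..n}" for i
    using comp[OF that] by (simp cong: measurable_cong_sets add: sQ)
  have B: "?B \<in> sets borel" by measurable
  have BQ: "(\<lambda>x. x i) -` ?B \<inter> space Q \<in> sets Q" if "i \<in> {1..n}" for i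
    using compQ[OF that] B by (rule measurable_sets)
  have "space Q - E \<subseteq> (\<Union>i\<in>{1..n}. (\<lambda>x. x i) -` ?B \<inter> space Q)"
    using sets_eq_imp_space_eq[OF sQ] by (auto simp: E_def)
  then have "emeasure Q (space Q - E) \<le> emeasure Q (\<Union>i\<in>{1..n}. (\<lambda>x. x i) -` ?B \<inter> space Q)"
    using BQ by (intro emeasure_mono sets.finite_UN) auto
  also have "\<dots> \<le> (\<Sum>i\<in>{1..n}. emeasure Q ((\<lambda>x. x i) -` ?B \<inter> space Q))"
    using BQ by (intro emeasure_subadditive_finite) auto
  also have "\<dots> \<le> (\<Sum>i\<in>{1..n}. ennreal (2 * exp (- u\<^sup>2 / 2)))"
  proof (rule sum_mono)
    fix i assume i: "i \<in> {1..n}"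
    have "emeasure Q ((\<lambda>x. x i) -` ?B \<inter> space Q) = emeasure (distr Q ?G (\<lambda>x. x i)) ?B"
      using compQ[OF i] B by (subst emeasure_distr) (auto simp: gauss_mix_def cong: measurable_cong_sets)
    also have "distr Q ?G (\<lambda>x. x i) = ?G"
      unfolding Q_def sample_dist_def using i
      by (intro distr_PiM_component prob_space_gauss_mix[OF \<nu>])
    also have "emeasure ?G ?B \<le> ennreal (2 * exp (- u\<^sup>2 / 2))"
      by (rule gauss_mix_tail[OF k w \<theta> u])
    finally show "emeasure Q ((\<lambda>x. x i) -` ?B \<inter> space Q) \<le> ennreal (2 * exp (- u\<^sup>2 / 2))" .
  qed
  also have "\<dots> = ennreal (real n * (2 * exp (- u\<^sup>2 / 2)))"
    by (simp add: ennreal_of_nat_eq_real_of_nat ennreal_mult[symmetric])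
  finally show "emeasure Q (space Q - E) \<le> ennreal (real n * (2 * exp (- u\<^sup>2 / 2)))" .
qed

section \<open>Lower bound for the evidence\<close>

lemma normal_density_le_1: "normal_density t 1 x \<le> 1"
proof -
  have "1 \<le> sqrt (2 * pi)" using pi_gt3 by simp
  then have "1 / sqrt (2 * pi) * exp (- (x - t)\<^sup>2 / 2) \<le> 1 * 1"
    by (intro mult_mono) auto
  then show ?thesis by (simp add: normal_density_def)
qed

lemma abs_mult_normal_density_le_1: "\<bar>x - t\<bar> * normal_density t 1 x \<le> 1"
proof -
  have "u \<le> 1 + u\<^sup>2 / 2" for u :: real
    using zero_le_power2[of "u - 1"] by (simp add: power2_diff)
  from this[of "\<bar>x - t\<bar>"] have "\<bar>x - t\<bar> \<le> 1 + (x - t)\<^sup>2 / 2" by simp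
  also have "\<dots> \<le> exp ((x - t)\<^sup>2 / 2)" by (rule exp_ge_add_one_self)
  finally have "\<bar>x - t\<bar> * exp (- (x - t)\<^sup>2 / 2) \<le> 1"
    by (simp add: exp_minus field_simps)
  moreover have "1 \<le> sqrt (2 * pi)" using pi_gt3 by simp
  ultimately have "1 / sqrt (2 * pi) * (\<bar>x - t\<bar> * exp (- (x - t)\<^sup>2 / 2)) \<le> 1 * 1"
    by (intro mult_mono) auto
  then show ?thesis by (simp add: normal_density_def mult_ac)
qed

text \<open>Mean and argument enter symmetrically, so the mean value theorem applies in the mean;
  the derivative is at most 1 by the preceding bound.\<close>

lemma normal_density_lipschitz: "\<bar>normal_density s 1 x - normal_density t 1 x\<bar> \<le> \<bar>s - t\<bar>"
proof -
  have sym: "normal_density s 1 x = normal_density x 1 s" for s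
    by (simp add: normal_density_def power2_commute)
  have "norm (normal_density x 1 s - normal_density x 1 t) \<le> 1 * norm (s - t)"
  proof (rule field_differentiable_bound[of UNIV])
    show "(normal_density x 1 has_field_derivative - (z - x) * normal_density x 1 z) (at z within UNIV)" for z
      by (rule DERIV_normal_density)
    show "norm (- (z - x) * normal_density x 1 z) \<le> 1" for z
      using abs_mult_normal_density_le_1[of z x] by (simp add: abs_mult abs_minus_commute)
  qed auto
  then show ?thesis by (simp add: sym)
qed

text \<open>Additive closeness becomes multiplicative because the true density is at least of order
  \<open>n^-4\<close> on the truncated range. Of the six powers of \<open>n\<close>, four pay for
  this, one for the relative precision \<open>1 / (2 n)\<close>, and the last absorbs the constant
  \<open>12 * exp (4 * L^2)\<close>.\<close>

lemma mixture_density_ratio: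
  assumes w0: "w\<^sub>0 \<in> weight_simplex k" and \<theta>0: "\<theta>\<^sub>0 \<in> atom_box L k" and w: "w \<in> weight_simplex k"
    and dw: "(\<Sum>j\<in>{1..k}. \<bar>w j - w\<^sub>0 j\<bar>) \<le> 1 / real n ^ 6"
    and d\<theta>: "\<And>j. j \<in> {1..k} \<Longrightarrow> \<bar>\<theta> j - \<theta>\<^sub>0 j\<bar> \<le> 1 / real n ^ 6"
    and n: "1 \<le> n" "12 * exp (4 * L\<^sup>2) \<le> real n" and y: "\<bar>y\<bar> \<le> L + 2 * sqrt (ln (real n))" and L: "0 \<le> L"
  shows "(1 - 1 / (2 * real n)) * (\<Sum>j\<in>{1..k}. w\<^sub>0 j * normal_density (\<theta>\<^sub>0 j) 1 y)
    \<le> (\<Sum>j\<in>{1..k}. w j * normal_density (\<theta> j) 1 y)"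
proof -
  define p0 where "p0 = (\<Sum>j\<in>{1..k}. w\<^sub>0 j * normal_density (\<theta>\<^sub>0 j) 1 y)"
  define p where "p = (\<Sum>j\<in>{1..k}. w j * normal_density (\<theta> j) 1 y)"
  have w0': "0 \<le> w\<^sub>0 j" if "j \<in> {1..k}" for j
    using w0 that by (auto simp: weight_simplex_def PiE_iff)
  have w01: "(\<Sum>j\<in>{1..k}. w\<^sub>0 j) = 1" using w0 by (simp add: weight_simplex_def)
  have ln0: "0 \<le> ln (real n)" using n by simp
  have "p0 - p = (\<Sum>j\<in>{1..k}. (w\<^sub>0 j - w j) * normal_density (\<theta> j) 1 y
      + w\<^sub>0 j * (normal_density (\<theta>\<^sub>0 j) 1 y - normal_density (\<theta> j) 1 y))"
    unfolding p0_def p_def sum_subtractf[symmetric] by (intro sum.cong) (auto simp: algebra_simps)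
  also have "\<dots> \<le> (\<Sum>j\<in>{1..k}. \<bar>w j - w\<^sub>0 j\<bar> + w\<^sub>0 j * (1 / real n ^ 6))"
  proof (intro sum_mono add_mono)
    fix j assume j: "j \<in> {1..k}"
    have "(w\<^sub>0 j - w j) * normal_density (\<theta> j) 1 y \<le> \<bar>w j - w\<^sub>0 j\<bar> * 1"
      by (intro mult_mono normal_density_le_1) auto
    then show "(w\<^sub>0 j - w j) * normal_density (\<theta> j) 1 y \<le> \<bar>w j - w\<^sub>0 j\<bar>" by simp
    have "\<bar>normal_density (\<theta>\<^sub>0 j) 1 y - normal_density (\<theta> j) 1 y\<bar> \<le> \<bar>\<theta>\<^sub>0 j - \<theta> j\<bar>"
      by (rule normal_density_lipschitz)
    then have "normal_density (\<theta>\<^sub>0 j) 1 y - normal_density (\<theta> j) 1 y \<le> 1 / real n ^ 6"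
      using d\<theta>[OF j] by (simp add: abs_minus_commute)
    then show "w\<^sub>0 j * (normal_density (\<theta>\<^sub>0 j) 1 y - normal_density (\<theta> j) 1 y) \<le> w\<^sub>0 j * (1 / real n ^ 6)"
      using w0'[OF j] by (intro mult_left_mono) auto
  qed
  also have "\<dots> \<le> 1 / real n ^ 6 + 1 / real n ^ 6"
    using dw unfolding sum.distrib sum_distrib_right[symmetric] w01 by simp
  finally have diff: "p0 - p \<le> 2 / real n ^ 6" by simp
  \<comment> \<open>The squared distance is at most \<open>8 * L^2 + 8 * ln n\<close>, whence
    \<open>n^-4\<close>; the factor 1/3 is a lower bound for
    \<open>1 / sqrt (2 * pi)\<close>.\<close>
  have low: "exp (- 4 * L\<^sup>2) / (3 * real n ^ 4) \<le> normal_density (\<theta>\<^sub>0 j) 1 y" if j: "j \<in> {1..k}" for j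
  proof -
    have "\<theta>\<^sub>0 j \<in> {-L..L}" using \<theta>0 j unfolding atom_box_def by blast
    then have "\<bar>y - \<theta>\<^sub>0 j\<bar> \<le> 2 * L + 2 * sqrt (ln (real n))" using y by (auto simp: abs_le_iff)
    then have "(y - \<theta>\<^sub>0 j)\<^sup>2 \<le> (2 * L + 2 * sqrt (ln (real n)))\<^sup>2"
      by (metis abs_ge_zero power2_abs power_mono)
    also have "\<dots> \<le> 8 * L\<^sup>2 + 8 * (sqrt (ln (real n)))\<^sup>2"
      using zero_le_power2[of "2 * L - 2 * sqrt (ln (real n))"] by (simp add: power2_eq_square algebra_simps)
    also have "\<dots> = 8 * L\<^sup>2 + 8 * ln (real n)" using ln0 by simp
    finally have e: "- 4 * L\<^sup>2 - 4 * ln (real n) \<le> - (y - \<theta>\<^sub>0 j)\<^sup>2 / 2" by simp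
    have "exp (- 4 * L\<^sup>2) / (3 * real n ^ 4) = 1 / 3 * exp (- 4 * L\<^sup>2 - 4 * ln (real n))"
    proof -
      have "exp (4 * ln (real n)) = real n ^ 4"
        using n exp_of_nat_mult[of 4 "ln (real n)"] by simp
      then show ?thesis by (simp add: exp_diff)
    qed
    also have "\<dots> \<le> 1 / sqrt (2 * pi) * exp (- (y - \<theta>\<^sub>0 j)\<^sup>2 / 2)"
    proof (intro mult_mono)
      have "sqrt (2 * pi) \<le> sqrt (3\<^sup>2)" using pi_less_4 by (intro real_sqrt_le_mono) simp
      then have "sqrt (2 * pi) \<le> 3" by simp
      moreover have "0 < sqrt (2 * pi)" by simp
      ultimately show "1 / 3 \<le> 1 / sqrt (2 * pi)" by (intro divide_left_mono) auto
    qed (use e in auto)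
    finally show ?thesis by (simp add: normal_density_def)
  qed
  have "exp (- 4 * L\<^sup>2) / (3 * real n ^ 4) = (\<Sum>j\<in>{1..k}. w\<^sub>0 j) * (exp (- 4 * L\<^sup>2) / (3 * real n ^ 4))"
    by (simp only: w01 mult_1)
  also have "\<dots> \<le> p0"
    unfolding p0_def sum_distrib_right using w0' low by (intro sum_mono mult_left_mono) auto
  finally have p0: "exp (- 4 * L\<^sup>2) / (3 * real n ^ 4) \<le> p0" .
  have "2 / real n ^ 6 \<le> 1 / (2 * real n) * (exp (- 4 * L\<^sup>2) / (3 * real n ^ 4))"
  proof -
    have "12 * exp (4 * L\<^sup>2) * exp (- 4 * L\<^sup>2) \<le> real n * exp (- 4 * L\<^sup>2)"
      using n by (intro mult_right_mono) auto
    then have "12 \<le> real n * exp (- 4 * L\<^sup>2)" by (simp add: mult.assoc exp_add[symmetric])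
    then have "12 / (6 * real n ^ 6) \<le> real n * exp (- 4 * L\<^sup>2) / (6 * real n ^ 6)"
      by (intro divide_right_mono) auto
    also have "\<dots> = 1 / (2 * real n) * (exp (- 4 * L\<^sup>2) / (3 * real n ^ 4))"
      using n by (simp add: field_simps power_def[symmetric] eval_nat_numeral)
    finally show ?thesis by simp
  qed
  also have "\<dots> \<le> 1 / (2 * real n) * p0" using p0 n by (intro mult_left_mono) auto
  finally have "p0 - p \<le> 1 / (2 * real n) * p0" using diff by linarith
  then show ?thesis unfolding p0_def[symmetric] p_def[symmetric] by (simp add: algebra_simps)
qed

text \<open>A relative loss of \<open>1 / (2 n)\<close> per observation costs a factor 1/2 over the
  whole sample, by Bernoulli's inequality.\<close>

lemma likelihood_ratio_lower:
  assumes w0: "w\<^sub>0 \<in> weight_simplex k" and \<theta>0: "\<theta>\<^sub>0 \<in> atom_box L k" and w: "w \<in> weight_simplex k"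
    and dw: "(\<Sum>j\<in>{1..k}. \<bar>w j - w\<^sub>0 j\<bar>) \<le> 1 / real n ^ 6"
    and d\<theta>: "\<And>j. j \<in> {1..k} \<Longrightarrow> \<bar>\<theta> j - \<theta>\<^sub>0 j\<bar> \<le> 1 / real n ^ 6"
    and n: "1 \<le> n" "12 * exp (4 * L\<^sup>2) \<le> real n" and L: "0 \<le> L"
    and x: "\<And>i. i \<in> {1..n} \<Longrightarrow> \<bar>x i\<bar> \<le> L + 2 * sqrt (ln (real n))"
  shows "ennreal (1 / 2) * likelihood n (mixing k w\<^sub>0 \<theta>\<^sub>0) x \<le> likelihood n (mixing k w \<theta>) x"
proof -
  let ?q = "1 - 1 / (2 * real n)"
  have q: "0 \<le> ?q" using n by (simp add: field_simps)
  have "1 / 2 = 1 + real n * (- (1 / (2 * real n)))" using n by simp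
  also have "\<dots> \<le> (1 + - (1 / (2 * real n))) ^ n"
    using n by (intro Bernoulli_inequality) (simp add: field_simps)
  finally have "1 / 2 \<le> ?q ^ n" by simp
  then have "ennreal (1 / 2) \<le> ennreal ?q ^ n" unfolding ennreal_power[OF q] by (rule ennreal_leI)
  then have "ennreal (1 / 2) * likelihood n (mixing k w\<^sub>0 \<theta>\<^sub>0) x
      \<le> ennreal ?q ^ n * likelihood n (mixing k w\<^sub>0 \<theta>\<^sub>0) x"
    by (rule mult_right_mono) simp
  also have "\<dots> = (\<Prod>i\<in>{1..n}. ennreal ?q * mix_density (mixing k w\<^sub>0 \<theta>\<^sub>0) (x i))"
    by (simp add: likelihood_def prod.distrib)
  also have "\<dots> \<le> likelihood n (mixing k w \<theta>) x"
    unfolding likelihood_def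
  proof (rule prod_mono_ennreal)
    fix i assume i: "i \<in> {1..n}"
    have "ennreal ?q * mix_density (mixing k w\<^sub>0 \<theta>\<^sub>0) (x i)
        = ennreal (?q * (\<Sum>j\<in>{1..k}. w\<^sub>0 j * normal_density (\<theta>\<^sub>0 j) 1 (x i)))"
      unfolding mix_density_mixing[OF w0] using q w0
      by (intro ennreal_mult[symmetric] sum_nonneg mult_nonneg_nonneg) (auto simp: weight_simplex_def PiE_iff)
    also have "\<dots> \<le> mix_density (mixing k w \<theta>) (x i)"
      unfolding mix_density_mixing[OF w]
      by (intro ennreal_leI mixture_density_ratio[OF w0 \<theta>0 w dw d\<theta> n x[OF i] L])
    finally show "ennreal ?q * mix_density (mixing k w\<^sub>0 \<theta>\<^sub>0) (x i) \<le> mix_density (mixing k w \<theta>) (x i)" .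
  qed
  finally show ?thesis .
qed

section \<open>Prior mass near the truth\<close>

lemma nn_integral_mixing_prior:
  assumes pc: "prior_components L \<Pi>k \<Pi>\<theta> \<Pi>w" and n: "1 \<le> n" and f: "f \<in> borel_measurable (mixing_space L)"
  shows "(\<integral>\<^sup>+ \<nu>. f \<nu> \<partial>mixing_prior L (\<Pi>k n) \<Pi>\<theta> \<Pi>w)
    = (\<integral>\<^sup>+ k. (\<integral>\<^sup>+ z. f (mixing k (snd z) (fst z)) \<partial>(\<Pi>\<theta> k \<Otimes>\<^sub>M \<Pi>w k)) \<partial>\<Pi>k n)"
proof -
  let ?g = "\<lambda>k. distr (\<Pi>\<theta> k \<Otimes>\<^sub>M \<Pi>w k) (mixing_space L) (\<lambda>(\<theta>, w). mixing k w \<theta>)"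
  have \<kappa>: "\<Pi>k n \<in> space (prob_algebra (count_space {1..}))" using pc n by (auto simp: prior_components_def)
  have S: "sets (\<Pi>k n) = sets (count_space {1..})" using \<kappa> by (simp add: space_prob_algebra)
  have meas: "(\<lambda>(\<theta>, w). mixing k w \<theta>) \<in> \<Pi>\<theta> k \<Otimes>\<^sub>M \<Pi>w k \<rightarrow>\<^sub>M mixing_space L"
    and g: "?g k \<in> space (subprob_algebra (mixing_space L))" if k: "1 \<le> k" for k
  proof -
    from pc k have T: "prob_space (\<Pi>\<theta> k)" "prob_space (\<Pi>w k)"
      and S[measurable_cong]:
          "sets (\<Pi>\<theta> k) = sets (restrict_space (\<Pi>\<^sub>M j\<in>{1..k}. borel) (atom_box L k))"
          "sets (\<Pi>w k) = sets (restrict_space (\<Pi>\<^sub>M j\<in>{1..k}. borel) (weight_simplex k))"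
      by (auto simp: prior_components_def space_prob_algebra)
    interpret T: prob_space "\<Pi>\<theta> k" by fact
    interpret W: prob_space "\<Pi>w k" by fact
    interpret P: pair_prob_space "\<Pi>\<theta> k" "\<Pi>w k" ..
    show m: "(\<lambda>(\<theta>, w). mixing k w \<theta>) \<in> \<Pi>\<theta> k \<Otimes>\<^sub>M \<Pi>w k \<rightarrow>\<^sub>M mixing_space L"
      using measurable_mixing[OF k, of L] by (simp cong: measurable_cong_sets add: S)
    then show "?g k \<in> space (subprob_algebra (mixing_space L))"
      by (auto simp: space_subprob_algebra intro!: prob_space_imp_subprob_space P.prob_space_distr)
  qed
  have "?g \<in> count_space {1..} \<rightarrow>\<^sub>M subprob_algebra (mixing_space L)"
    using g by (auto simp: measurable_count_space_eq1)
  then have "?g \<in> \<Pi>k n \<rightarrow>\<^sub>M subprob_algebra (mixing_space L)"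
    unfolding measurable_cong_sets[OF S refl] .
  then have "(\<integral>\<^sup>+ \<nu>. f \<nu> \<partial>mixing_prior L (\<Pi>k n) \<Pi>\<theta> \<Pi>w) = (\<integral>\<^sup>+ k. (\<integral>\<^sup>+ \<nu>. f \<nu> \<partial>?g k) \<partial>\<Pi>k n)"
    unfolding mixing_prior_def by (rule nn_integral_bind[OF f])
  also have "\<dots> = (\<integral>\<^sup>+ k. (\<integral>\<^sup>+ z. f (mixing k (snd z) (fst z)) \<partial>(\<Pi>\<theta> k \<Otimes>\<^sub>M \<Pi>w k)) \<partial>\<Pi>k n)"
  proof (rule nn_integral_cong)
    fix k assume "k \<in> space (\<Pi>k n)"
    then have k: "1 \<le> k" using sets_eq_imp_space_eq[OF S] by simp
    show "(\<integral>\<^sup>+ \<nu>. f \<nu> \<partial>?g k) = (\<integral>\<^sup>+ z. f (mixing k (snd z) (fst z)) \<partial>(\<Pi>\<theta> k \<Otimes>\<^sub>M \<Pi>w k))"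
      by (subst nn_integral_distr[OF meas[OF k]]) (simp_all add: f split_beta)
  qed
  finally show ?thesis .
qed

text \<open>The evidence is restricted to \<open>k\<close> components with parameters within
  \<open>n^-6\<close> of the truth, where the likelihood ratio is at least 1/2 for every sample in
  the range. The bound is therefore deterministic on that range, and the loss is only polynomial in
  \<open>n\<close> for fixed \<open>k\<close>, apart from the prior mass of
  \<open>k\<close>.\<close>

lemma evidence_lower:
  assumes pc: "prior_components L \<Pi>k \<Pi>\<theta> \<Pi>w" and P2: "prior_P2 c4 c5 \<Pi>w" and P3: "prior_P3 L c6 c7 \<Pi>\<theta>"
    and c: "0 < c4" "0 < c6"
    and k: "1 \<le> k" and w0: "w\<^sub>0 \<in> weight_simplex k" and \<theta>0: "\<theta>\<^sub>0 \<in> atom_box L k" and L: "0 \<le> L"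
    and n: "1 \<le> n" "12 * exp (4 * L\<^sup>2) \<le> real n" "real k < real n ^ 6"
    and xs: "x \<in> space (\<Pi>\<^sub>M i\<in>{1..n}. borel)"
    and x: "\<And>i. i \<in> {1..n} \<Longrightarrow> \<bar>x i\<bar> \<le> L + 2 * sqrt (ln (real n))"
  shows "ennreal (measure (\<Pi>k n) {k} * (c4 * c6 * (1 / real n ^ 6) powr ((c5 + c7) * real k)) / 2)
      * likelihood n (mixing k w\<^sub>0 \<theta>\<^sub>0) x
    \<le> (\<integral>\<^sup>+ \<nu>. likelihood n \<nu> x \<partial>mixing_prior L (\<Pi>k n) \<Pi>\<theta> \<Pi>w)"
proof -
  define \<eta> where "\<eta> = 1 / real n ^ 6"
  have "1 / real n ^ 6 < 1 / real k" using n k by (intro divide_strict_left_mono mult_pos_pos) auto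
  then have \<eta>: "\<eta> \<in> {0<..<1 / real k}" using n by (simp add: \<eta>_def)
  let ?l0 = "likelihood n (mixing k w\<^sub>0 \<theta>\<^sub>0) x"
  let ?W = "{w \<in> space (\<Pi>w k). (\<Sum>j\<in>{1..k}. \<bar>w j - w\<^sub>0 j\<bar>) \<le> \<eta>}"
  let ?T = "{\<theta> \<in> space (\<Pi>\<theta> k). (MAX j\<in>{1..k}. \<bar>\<theta> j - \<theta>\<^sub>0 j\<bar>) \<le> \<eta>}"
  have mW: "c4 * \<eta> powr (c5 * real k) \<le> measure (\<Pi>w k) ?W"
    using P2 k w0 \<eta> unfolding prior_P2_def by blast
  have mT: "c6 * \<eta> powr (c7 * real k) \<le> measure (\<Pi>\<theta> k) ?T"
    using P3 k \<theta>0 \<eta> unfolding prior_P3_def by blast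
  have \<eta>0: "0 < \<eta> powr a" for a using \<eta> by simp
  \<comment> \<open>Measurability is forced by the prior condition: a set outside the sigma-algebra
    has \<open>measure\<close> 0, whereas the condition provides positive mass.\<close>
  have sW: "?W \<in> sets (\<Pi>w k)"
  proof (rule ccontr)
    assume "?W \<notin> sets (\<Pi>w k)"
    then have "measure (\<Pi>w k) ?W = 0" by (rule measure_notin_sets)
    then show False using mW mult_pos_pos[OF c(1) \<eta>0[of "c5 * real k"]] by linarith
  qed
  have sT: "?T \<in> sets (\<Pi>\<theta> k)"
  proof (rule ccontr)
    assume "?T \<notin> sets (\<Pi>\<theta> k)"
    then have "measure (\<Pi>\<theta> k) ?T = 0" by (rule measure_notin_sets)
    then show False using mT mult_pos_pos[OF c(2) \<eta>0[of "c7 * real k"]] by linarith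
  qed
  from pc k have "prob_space (\<Pi>\<theta> k)" "prob_space (\<Pi>w k)"
    and S: "sets (\<Pi>w k) = sets (restrict_space (\<Pi>\<^sub>M j\<in>{1..k}. borel) (weight_simplex k))"
    by (auto simp: prior_components_def space_prob_algebra)
  then interpret T: prob_space "\<Pi>\<theta> k" + W: prob_space "\<Pi>w k" by auto
  interpret P: pair_prob_space "\<Pi>\<theta> k" "\<Pi>w k" ..
  have \<kappa>: "\<Pi>k n \<in> space (prob_algebra (count_space {1..}))" using pc n by (auto simp: prior_components_def)
  then interpret \<kappa>: prob_space "\<Pi>k n" by (simp add: space_prob_algebra)
  have S\<kappa>: "sets (\<Pi>k n) = sets (count_space {1..})" using \<kappa> by (simp add: space_prob_algebra)
  have spW: "w \<in> weight_simplex k" if "w \<in> space (\<Pi>w k)" for w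
    using that sets_eq_imp_space_eq[OF S] by (simp add: space_restrict_space)
  have lik: "(\<lambda>\<nu>. likelihood n \<nu> x) \<in> borel_measurable (mixing_space L)"
    using measurable_compose[OF measurable_Pair2'[OF xs] measurable_likelihood] by simp
  let ?I = "\<lambda>k. \<integral>\<^sup>+ z. likelihood n (mixing k (snd z) (fst z)) x \<partial>(\<Pi>\<theta> k \<Otimes>\<^sub>M \<Pi>w k)"
  have "ennreal (c4 * c6 * \<eta> powr ((c5 + c7) * real k) / 2)
      = ennreal (c6 * \<eta> powr (c7 * real k)) * ennreal (c4 * \<eta> powr (c5 * real k)) * ennreal (1 / 2)"
  proof -
    have eq: "c4 * c6 * \<eta> powr ((c5 + c7) * real k) / 2
        = (c6 * \<eta> powr (c7 * real k)) * (c4 * \<eta> powr (c5 * real k)) * (1 / 2)"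
      by (simp add: distrib_right powr_add)
    have mult3: "ennreal (a * b * d) = ennreal a * ennreal b * ennreal d" if "0 \<le> a" "0 \<le> b" "0 \<le> d" for a b d
      using that by (simp add: ennreal_mult)
    show ?thesis unfolding eq using c by (intro mult3 mult_nonneg_nonneg) auto
  qed
  also have "\<dots> \<le> emeasure (\<Pi>\<theta> k) ?T * emeasure (\<Pi>w k) ?W * ennreal (1 / 2)"
    using mW mT by (intro mult_mono) (auto simp: T.emeasure_eq_measure W.emeasure_eq_measure ennreal_leI)
  also have "\<dots> = emeasure (\<Pi>\<theta> k \<Otimes>\<^sub>M \<Pi>w k) (?T \<times> ?W) * ennreal (1 / 2)"
    using sT sW by (simp add: W.emeasure_pair_measure_Times)
  finally have mass: "ennreal (c4 * c6 * \<eta> powr ((c5 + c7) * real k) / 2) * ?l0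
      \<le> emeasure (\<Pi>\<theta> k \<Otimes>\<^sub>M \<Pi>w k) (?T \<times> ?W) * ennreal (1 / 2) * ?l0"
    by (rule mult_right_mono) simp
  also have "\<dots> = (\<integral>\<^sup>+ z. ennreal (1 / 2) * ?l0 * indicator (?T \<times> ?W) z \<partial>(\<Pi>\<theta> k \<Otimes>\<^sub>M \<Pi>w k))"
    using sT sW by (subst nn_integral_cmult_indicator) (auto simp: mult_ac)
  also have "\<dots> \<le> ?I k"
  proof (rule nn_integral_mono)
    fix z assume z: "z \<in> space (\<Pi>\<theta> k \<Otimes>\<^sub>M \<Pi>w k)"
    show "ennreal (1 / 2) * ?l0 * indicator (?T \<times> ?W) z \<le> likelihood n (mixing k (snd z) (fst z)) x"
    proof (cases "z \<in> ?T \<times> ?W")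
      case True
      then have "(MAX j\<in>{1..k}. \<bar>fst z j - \<theta>\<^sub>0 j\<bar>) \<le> \<eta>" "(\<Sum>j\<in>{1..k}. \<bar>snd z j - w\<^sub>0 j\<bar>) \<le> \<eta>" 
        "snd z \<in> space (\<Pi>w k)" by auto
      moreover then have "\<bar>fst z j - \<theta>\<^sub>0 j\<bar> \<le> \<eta>" if "j \<in> {1..k}" for j
        using that by (subst (asm) Max_le_iff) auto
      ultimately have "ennreal (1 / 2) * ?l0 \<le> likelihood n (mixing k (snd z) (fst z)) x"
        unfolding \<eta>_def by (intro likelihood_ratio_lower[OF w0 \<theta>0 _ _ _ n(1,2) L x] spW) auto
      then show ?thesis using True by simp
    qed simp
  qed
  finally have Ik: "ennreal (c4 * c6 * \<eta> powr ((c5 + c7) * real k) / 2) * ?l0 \<le> ?I k" .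
  have "ennreal (measure (\<Pi>k n) {k} * (c4 * c6 * \<eta> powr ((c5 + c7) * real k)) / 2) * ?l0
      = ennreal (c4 * c6 * \<eta> powr ((c5 + c7) * real k) / 2) * ?l0 * emeasure (\<Pi>k n) {k}"
    using c by (simp add: \<kappa>.emeasure_eq_measure ennreal_mult[symmetric] mult_ac)
  also have "\<dots> \<le> ?I k * emeasure (\<Pi>k n) {k}" by (intro mult_right_mono Ik) simp
  also have "\<dots> = (\<integral>\<^sup>+ k'. ?I k * indicator {k} k' \<partial>\<Pi>k n)"
    using k by (subst nn_integral_cmult_indicator) (auto simp: S\<kappa>)
  also have "\<dots> \<le> (\<integral>\<^sup>+ k'. ?I k' \<partial>\<Pi>k n)"
    by (intro nn_integral_mono) (auto simp: indicator_def)
  also have "\<dots> = (\<integral>\<^sup>+ \<nu>. likelihood n \<nu> x \<partial>mixing_prior L (\<Pi>k n) \<Pi>\<theta> \<Pi>w)"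
    by (rule nn_integral_mixing_prior[OF pc n(1) lik, symmetric])
  finally show ?thesis unfolding \<eta>_def .
qed

section \<open>The contraction rate\<close>

text \<open>Stated relative to the mass at \<open>k\<close>, so that this mass cancels later against
  the same factor in the evidence bound. The geometric series gives
  \<open>q / (1 - q) \<le> 2 * q\<close>.\<close>

lemma geometric_tail:
  fixes \<kappa> :: "nat measure"
  assumes \<kappa>: "\<kappa> \<in> space (prob_algebra (count_space {1..}))" and k: "1 \<le> k" and q: "0 \<le> q" "q \<le> 1 / 2"
    and ratio: "\<And>j. 1 \<le> j \<Longrightarrow> measure \<kappa> {j + 1} \<le> q * measure \<kappa> {j}"
  shows "measure \<kappa> {k<..} \<le> 2 * q * measure \<kappa> {k}"
proof -
  interpret prob_space \<kappa> using \<kappa> by (simp add: space_prob_algebra)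
  have S: "sets \<kappa> = sets (count_space {1..})" using \<kappa> by (simp add: space_prob_algebra)
  have le: "measure \<kappa> {k + Suc i} \<le> measure \<kappa> {k} * q * q ^ i" for i
  proof (induction i)
    case 0
    then show ?case using ratio[OF k] by (simp add: mult.commute)
  next
    case (Suc i)
    have "measure \<kappa> {k + Suc (Suc i)} \<le> q * measure \<kappa> {k + Suc i}" using ratio[of "k + Suc i"] k by simp
    also have "\<dots> \<le> q * (measure \<kappa> {k} * q * q ^ i)" using Suc q by (intro mult_left_mono) auto
    finally show ?case by (simp add: mult_ac)
  qed
  have geo: "summable (\<lambda>i. measure \<kappa> {k} * q * q ^ i)"
    "(\<Sum>i. measure \<kappa> {k} * q * q ^ i) = measure \<kappa> {k} * q * (1 / (1 - q))"
    using q by (simp_all add: summable_mult suminf_mult suminf_geometric)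
  have un: "{k<..} = (\<Union>i. {k + Suc i})"
    by (auto simp: image_iff) (metis less_iff_Suc_add)
  have "(\<lambda>i. measure \<kappa> {k + Suc i}) sums measure \<kappa> (\<Union>i. {k + Suc i})"
    by (rule finite_measure_UNION) (auto simp: S disjoint_family_on_def)
  then have "measure \<kappa> {k<..} \<le> measure \<kappa> {k} * q * (1 / (1 - q))"
    unfolding un geo(2)[symmetric] using le geo(1)
    by (metis sums_unique sums_summable suminf_le)
  also have "\<dots> \<le> measure \<kappa> {k} * q * 2"
    using q by (intro mult_left_mono) (auto simp: field_simps)
  finally show ?thesis by (simp add: mult_ac)
qed

text \<open>The terms come from the truncation of the sample, the level of the test and, divided by
  the evidence factor \<rho>, the prior-weighted acceptance probability: at most \<open>e\<close> in
  models with up to \<open>k\<close> components, and the whole prior mass of the larger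
  ones.\<close>

lemma posterior_bound_fixed_n:
  fixes n k :: nat
  assumes pc: "prior_components L \<Pi>k \<Pi>\<theta> \<Pi>w" and P2: "prior_P2 c4 c5 \<Pi>w" and P3: "prior_P3 L c6 c7 \<Pi>\<theta>"
    and c: "0 < c4" "0 < c6" and L: "0 < L"
    and k: "1 \<le> k" and w0: "w\<^sub>0 \<in> weight_simplex k" and \<theta>0: "\<theta>\<^sub>0 \<in> atom_box L k"
    and n: "1 \<le> n" "12 * exp (4 * L\<^sup>2) \<le> real n" "real k < real n ^ 6"
    and m: "0 < measure (\<Pi>k n) {k}" and \<tau>: "0 < \<tau>"
  defines "e \<equiv> exp (- (real n * ((\<tau> / (2 * (1 + L))) ^ (2 * k - 1))\<^sup>2 / (8 * hermite_var L (2 * k - 1))))"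
    and "\<rho> \<equiv> measure (\<Pi>k n) {k} * (c4 * c6 * (1 / real n ^ 6) powr ((c5 + c7) * real k)) / 2"
    and "\<nu>\<^sub>0 \<equiv> mixing k w\<^sub>0 \<theta>\<^sub>0"
  shows "(\<integral>\<^sup>+ x. emeasure (posterior n (mixing_prior L (\<Pi>k n) \<Pi>\<theta> \<Pi>w) x)
        {\<nu> \<in> mixing_dists L. 2 * real k * \<tau> \<le> wasserstein1 \<nu> \<nu>\<^sub>0} \<partial>sample_dist n (gauss_mix \<nu>\<^sub>0))
    \<le> ennreal (2 / real n + 4 * real k * e + (e + measure (\<Pi>k n) {k<..}) / \<rho>)"
proof -
  let ?P = "mixing_prior L (\<Pi>k n) \<Pi>\<theta> \<Pi>w"
  let ?U = "{\<nu> \<in> mixing_dists L. 2 * real k * \<tau> \<le> wasserstein1 \<nu> \<nu>\<^sub>0}"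
  let ?Q = "sample_dist n (gauss_mix \<nu>\<^sub>0)"
  \<comment> \<open>Makes each observation leave the range with probability at most
    \<open>2 / n^2\<close>, hence some observation with probability at most
    \<open>2 / n\<close>.\<close>
  define u where "u = 2 * sqrt (ln (real n))"
  define R where "R = 2 * k - 1"
  define \<delta> where "\<delta> = (\<tau> / (2 * (1 + L))) ^ R"
  have R: "1 \<le> R" "R \<le> 2 * k" using k by (auto simp: R_def)
  have \<delta>: "0 < \<delta>" using \<tau> L by (simp add: \<delta>_def)
  have e: "e = exp (- (real n * \<delta>\<^sup>2 / (8 * hermite_var L R)))" by (simp add: e_def \<delta>_def R_def)
  have e0: "0 < e" by (simp add: e_def)
  have u: "0 \<le> u" "exp (- u\<^sup>2 / 2) = 1 / real n ^ 2"
  proof -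
    have l: "0 \<le> ln (real n)" using n by simp
    then show "0 \<le> u" by (simp add: u_def)
    have "- u\<^sup>2 / 2 = - (2 * ln (real n))" using l by (simp add: u_def power_mult_distrib)
    then show "exp (- u\<^sup>2 / 2) = 1 / real n ^ 2"
      using n exp_of_nat_mult[of 2 "ln (real n)"] by (simp add: exp_minus inverse_eq_divide)
  qed
  have \<rho>: "0 < \<rho>" using m c n by (simp add: \<rho>_def)
  have \<nu>0: "\<nu>\<^sub>0 \<in> mixing_dists L" unfolding \<nu>\<^sub>0_def by (rule mixing_in_dists[OF k w0 \<theta>0])
  have P: "?P \<in> space (prob_algebra (mixing_space L))"
    using mixing_prior_in_prob_algebra[OF pc n(1)] .
  have SP: "sets ?P = sets (mixing_space L)" using P by (simp add: space_prob_algebra)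
  have \<kappa>: "\<Pi>k n \<in> space (prob_algebra (count_space {1..}))" using pc n by (auto simp: prior_components_def)
  then interpret \<kappa>: prob_space "\<Pi>k n" by (simp add: space_prob_algebra)
  have S\<kappa>: "sets (\<Pi>k n) = sets (count_space {1..})" using \<kappa> by (simp add: space_prob_algebra)
  show ?thesis
  \<comment> \<open>For an event outside the sigma-algebra \<open>emeasure\<close> is 0 by
    convention, and the bound is trivial.\<close>
  proof (cases "?U \<in> sets (mixing_space L)")
    case False
    then have "emeasure (posterior n ?P x) ?U = 0" for x
      by (intro emeasure_notin_sets) (simp add: posterior_def SP)
    then show ?thesis by simp
  next
    case U: True
    from moment_test[OF k w0 \<theta>0 less_imp_le[OF L] R(1) \<delta>, of n, folded \<nu>\<^sub>0_def e]
    obtain T where T: "T \<in> sets (\<Pi>\<^sub>M i\<in>{1..n}. borel)" "emeasure ?Q T \<le> ennreal (2 * real R * e)"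
      "\<And>k' w \<theta> r. 1 \<le> k' \<Longrightarrow> w \<in> weight_simplex k' \<Longrightarrow> \<theta> \<in> atom_box L k' \<Longrightarrow> r \<in> {1..R} \<Longrightarrow>
         \<delta> \<le> \<bar>(\<Sum>j\<in>{1..k'}. w j * \<theta> j ^ r) - (\<Sum>j\<in>{1..k}. w\<^sub>0 j * \<theta>\<^sub>0 j ^ r)\<bar> \<Longrightarrow>
         (\<integral>\<^sup>+ x. indicator (- T) x * (likelihood n (mixing k' w \<theta>) x / likelihood n \<nu>\<^sub>0 x) \<partial>?Q) \<le> ennreal e"
      by blast
    define E where "E = {x \<in> space (\<Pi>\<^sub>M i\<in>{1..n}. (borel :: real measure)). \<forall>i\<in>{1..n}. \<bar>x i\<bar> \<le> L + u}"
    note E = sample_tail[OF k w0 \<theta>0 u(1), of n, folded \<nu>\<^sub>0_def E_def]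
    define H where "H \<nu> = indicator ?U \<nu> *
      (\<integral>\<^sup>+ x. indicator (- T) x * (likelihood n \<nu> x / likelihood n \<nu>\<^sub>0 x) \<partial>?Q)" for \<nu>
    interpret Q: prob_space ?Q using \<nu>0 by (rule prob_space_sample_dist)
    have sQ[measurable_cong]: "sets ?Q = sets (\<Pi>\<^sub>M i\<in>{1..n}. borel)" by (rule sets_sample_dist)
    have ev: "ennreal \<rho> * likelihood n \<nu>\<^sub>0 x \<le> (\<integral>\<^sup>+ \<nu>. likelihood n \<nu> x \<partial>?P)" if "x \<in> E" for x
      unfolding \<rho>_def \<nu>\<^sub>0_def
      by (rule evidence_lower[OF pc P2 P3 c k w0 \<theta>0 less_imp_le[OF L] n]) (use that in \<open>auto simp: E_def u_def\<close>)
    have Hm: "H \<in> borel_measurable (mixing_space L)"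
    proof -
      note [measurable] = T(1) U
      have lm[measurable]: "(\<lambda>z. likelihood n (fst z) (snd z)) \<in> borel_measurable (mixing_space L \<Otimes>\<^sub>M ?Q)"
        using measurable_likelihood[of n L] by (simp cong: measurable_cong_sets sets_pair_measure_cong add: sQ)
      have "\<nu>\<^sub>0 \<in> space (mixing_space L)" using \<nu>0 by (simp add: space_mixing_space)
      from measurable_compose[OF measurable_Pair1'[OF this] lm]
      have [measurable]: "likelihood n \<nu>\<^sub>0 \<in> borel_measurable ?Q" by simp
      have [measurable]: "(indicator (- T) :: _ \<Rightarrow> ennreal) \<in> borel_measurable ?Q"
      proof -
        have "(indicator (space ?Q - T) :: _ \<Rightarrow> ennreal) \<in> borel_measurable ?Q" by measurable
        then show ?thesis by (rule measurable_cong[THEN iffD1, rotated]) (auto simp: indicator_def)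
      qed
      have "(\<lambda>(\<nu>, x). indicator (- T) x * (likelihood n \<nu> x / likelihood n \<nu>\<^sub>0 x))
          \<in> borel_measurable (mixing_space L \<Otimes>\<^sub>M ?Q)"
        unfolding split_beta by measurable
      then have [measurable]: "(\<lambda>\<nu>. \<integral>\<^sup>+ x. indicator (- T) x * (likelihood n \<nu> x / likelihood n \<nu>\<^sub>0 x) \<partial>?Q)
          \<in> borel_measurable (mixing_space L)"
        by (rule Q.borel_measurable_nn_integral)
      show ?thesis unfolding H_def by measurable
    qed
    have H1: "H \<nu> \<le> 1" if \<nu>: "\<nu> \<in> mixing_dists L" for \<nu>
    proof -
      have "(\<integral>\<^sup>+ x. indicator (- T) x * (likelihood n \<nu> x / likelihood n \<nu>\<^sub>0 x) \<partial>?Q)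
          \<le> (\<integral>\<^sup>+ x. likelihood n \<nu> x / likelihood n \<nu>\<^sub>0 x * (\<Prod>i\<in>{1..n}. 1) \<partial>?Q)"
        by (intro nn_integral_mono) (auto simp: indicator_def)
      also have "\<dots> = (\<integral>\<^sup>+ y. mix_density \<nu> y * 1 \<partial>lborel) ^ n"
        by (rule nn_integral_likelihood_ratio_prod[OF \<nu>0 \<nu>]) simp
      also have "\<dots> = 1" by (simp add: nn_integral_mix_density_1[OF \<nu>])
      finally show ?thesis by (auto simp: H_def indicator_def)
    qed
    have He: "H (mixing k' w \<theta>) \<le> ennreal e"
      if k': "1 \<le> k'" "k' \<le> k" and w: "w \<in> weight_simplex k'" and \<theta>: "\<theta> \<in> atom_box L k'" for k' w \<theta>
    proof (cases "mixing k' w \<theta> \<in> ?U")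
      case True
      then obtain r where r: "r \<in> {1..R}"
        "\<delta> \<le> \<bar>(\<Sum>j\<in>{1..k'}. w j * \<theta> j ^ r) - (\<Sum>j\<in>{1..k}. w\<^sub>0 j * \<theta>\<^sub>0 j ^ r)\<bar>"
        using moment_comparison[OF w \<theta> w0 \<theta>0 k'(2) order_refl k L \<tau>] unfolding \<nu>\<^sub>0_def \<delta>_def R_def by blast
      from T(3)[OF k'(1) w \<theta> r] show ?thesis by (simp add: H_def indicator_def)
    qed (simp add: H_def)
    have "(\<integral>\<^sup>+ \<nu>. H \<nu> \<partial>?P) = (\<integral>\<^sup>+ k'. (\<integral>\<^sup>+ z. H (mixing k' (snd z) (fst z)) \<partial>(\<Pi>\<theta> k' \<Otimes>\<^sub>M \<Pi>w k')) \<partial>\<Pi>k n)"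
      by (rule nn_integral_mixing_prior[OF pc n(1) Hm])
    also have "\<dots> \<le> (\<integral>\<^sup>+ k'. ennreal e + indicator {k<..} k' \<partial>\<Pi>k n)"
    proof (rule nn_integral_mono)
      fix k' assume "k' \<in> space (\<Pi>k n)"
      then have k': "1 \<le> k'" using sets_eq_imp_space_eq[OF S\<kappa>] by simp
      from pc k' have "prob_space (\<Pi>\<theta> k')" "prob_space (\<Pi>w k')"
        and S: "sets (\<Pi>\<theta> k') = sets (restrict_space (\<Pi>\<^sub>M j\<in>{1..k'}. borel) (atom_box L k'))"
          "sets (\<Pi>w k') = sets (restrict_space (\<Pi>\<^sub>M j\<in>{1..k'}. borel) (weight_simplex k'))"
        by (auto simp: prior_components_def space_prob_algebra)
      then interpret T: prob_space "\<Pi>\<theta> k'" + W: prob_space "\<Pi>w k'" by auto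
      interpret PP: pair_prob_space "\<Pi>\<theta> k'" "\<Pi>w k'" ..
      have sp: "fst z \<in> atom_box L k'" "snd z \<in> weight_simplex k'" if "z \<in> space (\<Pi>\<theta> k' \<Otimes>\<^sub>M \<Pi>w k')" for z
        using that sets_eq_imp_space_eq[OF S(1)] sets_eq_imp_space_eq[OF S(2)]
        by (auto simp: space_pair_measure space_restrict_space)
      \<comment> \<open>Up to \<open>k\<close> components the comparison of \<open>2 * k - 1\<close>
        moments gives the test power. Beyond that only the total mass 1 of the likelihood ratio is
        available, and the prior has to supply smallness.\<close>
      define b :: ennreal where "b = (if k' \<le> k then ennreal e else 1)"
      have "(\<integral>\<^sup>+ z. H (mixing k' (snd z) (fst z)) \<partial>(\<Pi>\<theta> k' \<Otimes>\<^sub>M \<Pi>w k')) \<le> (\<integral>\<^sup>+ z. b \<partial>(\<Pi>\<theta> k' \<Otimes>\<^sub>M \<Pi>w k'))"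
      proof (rule nn_integral_mono)
        fix z assume "z \<in> space (\<Pi>\<theta> k' \<Otimes>\<^sub>M \<Pi>w k')"
        note z = sp[OF this]
        show "H (mixing k' (snd z) (fst z)) \<le> b"
          using He[OF k' _ z(2,1)] H1[OF mixing_in_dists[OF k' z(2,1)]] by (simp add: b_def)
      qed
      also have "\<dots> = b" by (simp add: PP.emeasure_space_1)
      also have "b \<le> ennreal e + indicator {k<..} k'" by (auto simp: b_def indicator_def add_increasing)
      finally show "(\<integral>\<^sup>+ z. H (mixing k' (snd z) (fst z)) \<partial>(\<Pi>\<theta> k' \<Otimes>\<^sub>M \<Pi>w k')) \<le> ennreal e + indicator {k<..} k'" .
    qed
    also have "\<dots> = ennreal e + emeasure (\<Pi>k n) {k<..}"
    proof -
      have "{k<..} \<in> sets (\<Pi>k n)" using k by (auto simp: S\<kappa>)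
      then show ?thesis by (simp add: nn_integral_add \<kappa>.emeasure_space_1)
    qed
    also have "\<dots> = ennreal (e + measure (\<Pi>k n) {k<..})"
      using e0 by (simp add: \<kappa>.emeasure_eq_measure)
    finally have HP: "(\<integral>\<^sup>+ \<nu>. H \<nu> \<partial>?P) \<le> ennreal (e + measure (\<Pi>k n) {k<..})" .
    have "(\<integral>\<^sup>+ x. emeasure (posterior n ?P x) ?U \<partial>?Q)
        \<le> emeasure ?Q (space ?Q - E) + emeasure ?Q T + ennreal (1 / \<rho>) * (\<integral>\<^sup>+ \<nu>. H \<nu> \<partial>?P)"
      unfolding H_def by (rule posterior_expectation_le[OF P \<nu>0 E(1) T(1) U \<rho> ev])
    also have "\<dots> \<le> ennreal (real n * (2 * exp (- u\<^sup>2 / 2))) + ennreal (4 * real k * e)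
        + ennreal (1 / \<rho>) * ennreal (e + measure (\<Pi>k n) {k<..})"
    proof (intro add_mono mult_left_mono HP E(2))
      have "2 * real R * e \<le> 4 * real k * e" using R e0 by (intro mult_right_mono) auto
      then show "emeasure ?Q T \<le> ennreal (4 * real k * e)"
        using T(2) by (meson ennreal_leI order_trans)
    qed simp
    also have "\<dots> = ennreal (2 / real n + 4 * real k * e + (e + measure (\<Pi>k n) {k<..}) / \<rho>)"
      using e0 \<rho> n unfolding u(2)
      by (simp add: ennreal_mult[symmetric] ennreal_plus[symmetric] power2_eq_square del: ennreal_plus)
    finally show ?thesis .
  qed
qed

section \<open>Choice of constants and the limit\<close>

text \<open>Put \<open>R = 2 k - 1\<close> and \<open>a = ln^2 n / n\<close>. The root
  \<open>1 / (2 R)\<close> in the rate returns \<open>a\<close> after the powers, one factor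
  \<open>k\<close> cancels the division by \<open>2 k\<close>, and the remaining
  \<open>sqrt k\<close> yields \<open>k^R\<close>, matching the variance. In \<open>M\<close>, the
  factors \<open>2\<close> and \<open>2 * (1 + L)\<close> undo the normalisation of \<tau>; the
  remaining \<open>16 * exp (L + 1)\<close> squares to \<open>256 * C\<close>, leaving
  \<open>128^R / 48\<close> beside \<open>ln^2 n\<close>.\<close>

lemma rate_exponent:
  fixes n k :: nat
  assumes L: "0 < L" and k: "1 \<le> k" and n: "2 \<le> n"
  defines "M \<equiv> 64 * (1 + L) * exp (L + 1)"
  defines "\<tau> \<equiv> M * contraction_rate n k / (2 * real k)"
  shows "real k * (ln (real n))\<^sup>2
    \<le> real n * ((\<tau> / (2 * (1 + L))) ^ (2 * k - 1))\<^sup>2 / (8 * hermite_var L (2 * k - 1))"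
proof -
  define R where "R = 2 * k - 1"
  define C where "C = exp (2 * L + 2)"
  define a where "a = (ln (real n))\<^sup>2 / real n"
  have R: "1 \<le> R" "R \<le> 2 * k" "k \<le> R" "2 * real R = 4 * real k - 2" using k by (auto simp: R_def)
  have a: "0 < a" using n by (simp add: a_def)
  have C: "0 < C" by (simp add: C_def)
  have kp: "real k powr (3 / 2) / real k = sqrt (real k)"
  proof -
    have "real k powr (3 / 2) = real k powr (1 + 1 / 2)" by simp
    also have "\<dots> = real k * sqrt (real k)" using k unfolding powr_add by (simp add: powr_half_sqrt)
    finally show ?thesis using k by simp
  qed
  have "\<tau> / (2 * (1 + L)) = 16 * exp (L + 1) * (real k powr (3 / 2) / real k) * a powr (1 / (4 * real k - 2))"
  proof -
    have id: "64 * l * x * (K * y) / (2 * r) / (2 * l) = 16 * x * (K / r) * y" if "0 < l" "0 < r" for l x K y r :: real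
      using that by (simp add: field_simps)
    show ?thesis
      unfolding \<tau>_def M_def contraction_rate_def a_def by (rule id) (use k L in auto)
  qed
  also have "\<dots> = 16 * exp (L + 1) * sqrt (real k) * a powr (1 / (2 * real R))"
    unfolding kp R(4) ..
  finally have \<tau>L: "\<tau> / (2 * (1 + L)) = 16 * exp (L + 1) * sqrt (real k) * a powr (1 / (2 * real R))" .
  have "((\<tau> / (2 * (1 + L))) ^ R)\<^sup>2 = ((16 * exp (L + 1) * sqrt (real k))\<^sup>2) ^ R * (a powr (1 / (2 * real R))) ^ (2 * R)"
  proof -
    have "((x * y) ^ R)\<^sup>2 = (x\<^sup>2) ^ R * y ^ (2 * R)" for x y :: real
      by (simp add: power_mult_distrib power_mult[symmetric] mult.commute)
    then show ?thesis unfolding \<tau>L by simp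
  qed
  also have "(a powr (1 / (2 * real R))) ^ (2 * R) = a"
    using a R(1) by (simp add: powr_realpow[symmetric] powr_powr)
  also have "(16 * exp (L + 1) * sqrt (real k))\<^sup>2 = 256 * C * real k"
    by (simp add: power_mult_distrib C_def exp_double[symmetric])
  finally have sq: "((\<tau> / (2 * (1 + L))) ^ R)\<^sup>2 = (256 * C * real k) ^ R * a" .
  have "hermite_var L R = 6 * (real R * C) ^ R" by (simp add: hermite_var_def C_def)
  also have "\<dots> \<le> 6 * (2 * real k * C) ^ R"
    using R C by (intro mult_left_mono power_mono mult_right_mono) auto
  finally have V: "hermite_var L R \<le> 6 * (2 * real k * C) ^ R" .
  have "real k * (ln (real n))\<^sup>2 \<le> 128 ^ R / 48 * (ln (real n))\<^sup>2"
  proof (rule mult_right_mono)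
    have "real k \<le> 2 ^ k" by (simp add: less_imp_le of_nat_less_two_power)
    moreover have "0 \<le> real k" by simp
    ultimately have "48 * real k \<le> 64 * 2 ^ k" by linarith
    also have "\<dots> \<le> 64 ^ k * 2 ^ k" using k self_le_power[of "64::real" k] by (intro mult_right_mono) auto
    also have "\<dots> = 128 ^ k" by (simp add: power_mult_distrib[symmetric])
    also have "\<dots> \<le> (128::real) ^ R" using R by (intro power_increasing) auto
    finally show "real k \<le> 128 ^ R / 48" by simp
  qed simp
  also have "\<dots> = real n * ((256 * C * real k) ^ R * a) / (8 * (6 * (2 * real k * C) ^ R))"
  proof -
    have "256 * C * real k = 128 * (2 * real k * C)" by simp
    then have pw: "(256 * C * real k) ^ R = 128 ^ R * (2 * real k * C) ^ R" by (metis power_mult_distrib)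
    have id: "x / 48 * y = N * (x * D * (y / N)) / (8 * (6 * D))" if "0 < D" "0 < N" for x y D N :: real
      using that by (simp add: field_simps)
    show ?thesis unfolding pw a_def using C k n by (intro id) auto
  qed
  also have "\<dots> \<le> real n * ((256 * C * real k) ^ R * a) / (8 * hermite_var L R)"
    using V hermite_var_pos[OF R(1), of L] a C by (intro divide_left_mono mult_nonneg_nonneg mult_pos_pos) auto
  finally show ?thesis unfolding R_def[symmetric] sq .
qed

lemma posterior_bound_explicit:
  fixes n :: nat and kbar :: "nat \<Rightarrow> nat"
  assumes pc: "prior_components L \<Pi>k \<Pi>\<theta> \<Pi>w" and P1: "prior_P1 A c1 c2 c3 kbar \<Pi>k"
    and P2: "prior_P2 c4 c5 \<Pi>w" and P3: "prior_P3 L c6 c7 \<Pi>\<theta>"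
    and c: "0 < c1" "0 < c2" "0 < c4" "0 < c5" "0 < c6" "0 < c7"
    and A: "6 * (c5 + c7) + 1 \<le> A" and L: "0 < L"
    and k: "1 \<le> k" "k \<le> kbar n" and \<nu>0: "\<nu>\<^sub>0 \<in> mixing_dists_k L k"
    and n: "2 \<le> n" "12 * exp (4 * L\<^sup>2) \<le> real n" "real k < real n ^ 6" "2 * c1 \<le> real n" "1 \<le> ln (real n)"
    and kb: "c3 * real (kbar n) + 6 * (c5 + c7) \<le> ln (real n) / 2"
  shows "(\<integral>\<^sup>+ x. emeasure (posterior n (mixing_prior L (\<Pi>k n) \<Pi>\<theta> \<Pi>w) x)
      {\<nu> \<in> mixing_dists L. wasserstein1 \<nu> \<nu>\<^sub>0 \<ge> 64 * (1 + L) * exp (L + 1) * contraction_rate n k}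
        \<partial>sample_dist n (gauss_mix \<nu>\<^sub>0))
    \<le> ennreal (2 / real n + 4 * exp (- (ln (real n))\<^sup>2) + 2 / (c2 * c4 * c6) * exp (- (ln (real n))\<^sup>2 / 2)
        + 4 * c1 / (c4 * c6) * (1 / real n))"
proof -
  define l where "l = ln (real n)"
  \<comment> \<open>The power of \<open>n\<close> lost per component: a radius \<open>n^-6\<close>
    under the exponent \<open>(c5 + c7) * k\<close> is \<open>exp (- B * k * l)\<close>.\<close>
  define B where "B = 6 * (c5 + c7)"
  define m where "m = measure (\<Pi>k n) {k}"
  define q where "q = c1 * exp (- A * real (kbar n) * l)"
  define \<tau> where "\<tau> = 64 * (1 + L) * exp (L + 1) * contraction_rate n k / (2 * real k)"
  define e where "e = exp (- (real n * ((\<tau> / (2 * (1 + L))) ^ (2 * k - 1))\<^sup>2 / (8 * hermite_var L (2 * k - 1))))"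
  define \<rho> where "\<rho> = m * (c4 * c6 * (1 / real n ^ 6) powr ((c5 + c7) * real k)) / 2"
  obtain w\<^sub>0 \<theta>\<^sub>0 where \<nu>: "w\<^sub>0 \<in> weight_simplex k" "\<theta>\<^sub>0 \<in> atom_box L k" "\<nu>\<^sub>0 = mixing k w\<^sub>0 \<theta>\<^sub>0"
    using \<nu>0 by (auto simp: mixing_dists_k_def)
  have l: "1 \<le> l" using n by (simp add: l_def)
  have B: "0 < B" using c by (simp add: B_def)
  have kb1: "1 \<le> real (kbar n)" "real k \<le> real (kbar n)" "1 \<le> real k" using k by auto
  have A1: "1 \<le> A" using A B by (simp add: B_def)
  have expl: "exp (- l) = 1 / real n" using n by (simp add: l_def exp_minus inverse_eq_divide)
  have m_low: "c2 * exp (- (c3 * real (kbar n) * l) * real k) \<le> m"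
    using P1 k n(1) unfolding prior_P1_def m_def l_def by auto
  then have m: "0 < m" using c by (smt (verit) exp_gt_zero mult_pos_pos)
  have \<tau>: "0 < \<tau>" using k n L by (simp add: \<tau>_def contraction_rate_def)
  have U: "{\<nu> \<in> mixing_dists L. wasserstein1 \<nu> \<nu>\<^sub>0 \<ge> 64 * (1 + L) * exp (L + 1) * contraction_rate n k}
      = {\<nu> \<in> mixing_dists L. 2 * real k * \<tau> \<le> wasserstein1 \<nu> \<nu>\<^sub>0}"
    using k by (simp add: \<tau>_def)
  have main: "(\<integral>\<^sup>+ x. emeasure (posterior n (mixing_prior L (\<Pi>k n) \<Pi>\<theta> \<Pi>w) x)
      {\<nu> \<in> mixing_dists L. wasserstein1 \<nu> \<nu>\<^sub>0 \<ge> 64 * (1 + L) * exp (L + 1) * contraction_rate n k}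
        \<partial>sample_dist n (gauss_mix \<nu>\<^sub>0))
    \<le> ennreal (2 / real n + 4 * real k * e + (e + measure (\<Pi>k n) {k<..}) / \<rho>)"
    unfolding U unfolding e_def \<rho>_def m_def \<nu>(3)
    using n by (intro posterior_bound_fixed_n[OF pc P2 P3 c(3,5) L k(1) \<nu>(1,2) _ n(2,3) m[unfolded m_def] \<tau>]) simp
  have e_le: "e \<le> exp (- (real k * l\<^sup>2))"
    using rate_exponent[OF L k(1) n(1)] unfolding e_def \<tau>_def l_def by simp
  have ql: "q \<le> c1 * exp (- l)"
  proof -
    have "1 * 1 \<le> A * real (kbar n)" using A1 kb1 by (intro mult_mono) auto
    then have "1 * l \<le> A * real (kbar n) * l" using l by (intro mult_right_mono) auto
    then show ?thesis using c by (simp add: q_def)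
  qed
  also have "c1 * exp (- l) \<le> 1 / 2" using n(1,4) by (simp add: expl field_simps)
  finally have q: "0 \<le> q" "q \<le> 1 / 2" using c by (auto simp: q_def)
  have tail: "measure (\<Pi>k n) {k<..} \<le> 2 * q * m"
    unfolding m_def
  proof (rule geometric_tail[OF _ k(1) q])
    show "\<Pi>k n \<in> space (prob_algebra (count_space {1..}))" using pc n by (auto simp: prior_components_def)
    show "measure (\<Pi>k n) {j + 1} \<le> q * measure (\<Pi>k n) {j}" if "1 \<le> j" for j
      using P1 that n(1) unfolding prior_P1_def q_def l_def by auto
  qed
  have \<rho>_eq: "1 / \<rho> = 2 / (c4 * c6) * exp (B * real k * l) / m"
  proof -
    have "(1 / real n ^ 6) powr ((c5 + c7) * real k) = exp ((c5 + c7) * real k * ln (1 / real n ^ 6))"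
      using n by (simp add: powr_def)
    also have "ln (1 / real n ^ 6) = - 6 * l" using n by (simp add: ln_div ln_realpow l_def)
    also have "(c5 + c7) * real k * (- 6 * l) = - (B * real k * l)" by (simp add: B_def algebra_simps)
    finally show ?thesis by (simp add: \<rho>_def exp_minus inverse_eq_divide mult_ac)
  qed
  \<comment> \<open>The factor \<open>k\<close> is absorbed by \<open>k \<le> exp (k - 1)\<close>
    and \<open>l \<ge> 1\<close>, at the price of lowering the exponent from \<open>k * l^2\<close>
    to \<open>l^2\<close>.\<close>
  have t1: "4 * real k * e \<le> 4 * exp (- l\<^sup>2)"
  proof -
    have "real k \<le> exp (real k - 1)" using exp_ge_add_one_self[of "real k - 1"] by simp
    also have "real k - 1 \<le> (real k - 1) * l\<^sup>2"
      using kb1 l one_le_power[of l 2] mult_left_mono[of 1 "l\<^sup>2" "real k - 1"] by simp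
    finally have "real k \<le> exp ((real k - 1) * l\<^sup>2)" by simp
    then have "real k * e \<le> exp ((real k - 1) * l\<^sup>2) * exp (- (real k * l\<^sup>2))"
      using e_le by (intro mult_mono) (auto simp: e_def)
    also have "\<dots> = exp (- l\<^sup>2)" by (simp add: exp_add[symmetric] algebra_simps)
    finally show ?thesis by simp
  qed
  \<comment> \<open>Here the lower bound on the prior mass of \<open>k\<close> is used: the evidence
    costs \<open>exp (k * l * (c3 * kbar + B))\<close>, and \<open>kb\<close> makes this exponent at
    most half of the test exponent \<open>k * l^2\<close>.\<close>
  have t2: "e / \<rho> \<le> 2 / (c2 * c4 * c6) * exp (- l\<^sup>2 / 2)"
  proof -
    have "e / \<rho> = e * (1 / \<rho>)" by simp
    also have "\<dots> = 2 / (c4 * c6) * (exp (B * real k * l) * e / m)" unfolding \<rho>_eq by simp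
    also have "\<dots> \<le> 2 / (c4 * c6) * (exp (B * real k * l) * exp (- (real k * l\<^sup>2))
        / (c2 * exp (- (c3 * real (kbar n) * l) * real k)))"
      using c m m_low e_le by (intro mult_left_mono frac_le) auto
    also have "\<dots> = 2 / (c2 * c4 * c6) * exp (real k * l * (c3 * real (kbar n) + B - l))"
    proof -
      have ex: "exp (B * real k * l) * exp (- (real k * l\<^sup>2)) / exp (- (c3 * real (kbar n) * l) * real k)
          = exp (real k * l * (c3 * real (kbar n) + B - l))"
        by (simp add: exp_add[symmetric] exp_diff[symmetric] power2_eq_square algebra_simps)
      have id: "2 / (c4 * c6) * (x / (c2 * y)) = 2 / (c2 * c4 * c6) * (x / y)" for x y
        by (simp add: mult_ac)
      show ?thesis unfolding id ex ..
    qed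
    also have "\<dots> \<le> 2 / (c2 * c4 * c6) * exp (- l\<^sup>2 / 2)"
    proof (intro mult_left_mono exp_mono)
      have "real k * l * (c3 * real (kbar n) + B - l) \<le> real k * l * (- l / 2)"
        using kb l unfolding B_def l_def[symmetric] by (intro mult_left_mono) auto
      also have "\<dots> = real k * (- l\<^sup>2 / 2)" by (simp add: power2_eq_square)
      also have "\<dots> \<le> 1 * (- l\<^sup>2 / 2)" using kb1 by (intro mult_right_mono_neg) auto
      finally show "real k * l * (c3 * real (kbar n) + B - l) \<le> - l\<^sup>2 / 2" by simp
    qed (use c in auto)
    finally show ?thesis .
  qed
  \<comment> \<open>The prior mass \<open>m\<close> cancels. Since \<open>A \<ge> B + 1\<close> and
    \<open>1 \<le> k \<le> kbar\<close>, the prior ratio beats the loss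
    \<open>exp (B * k * l)\<close> by a further factor \<open>exp (- l) = 1 / n\<close>.\<close>
  have t3: "measure (\<Pi>k n) {k<..} / \<rho> \<le> 4 * c1 / (c4 * c6) * (1 / real n)"
  proof -
    have \<rho>0: "0 \<le> 1 / \<rho>" unfolding \<rho>_eq using c m by simp
    have "measure (\<Pi>k n) {k<..} / \<rho> \<le> (2 * q * m) * (1 / \<rho>)"
      using mult_right_mono[OF tail \<rho>0] by simp
    also have "\<dots> = 4 * c1 / (c4 * c6) * exp (B * real k * l - A * real (kbar n) * l)"
    proof -
      have "exp (- A * real (kbar n) * l) * exp (B * real k * l) = exp (B * real k * l - A * real (kbar n) * l)"
        by (simp add: exp_add[symmetric])
      then show ?thesis unfolding \<rho>_eq q_def using m by simp
    qed
    also have "\<dots> \<le> 4 * c1 / (c4 * c6) * exp (- l)"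
    proof (intro mult_left_mono exp_mono)
      have "B * real k \<le> B * real (kbar n)" using B kb1 by (intro mult_left_mono) auto
      also have "\<dots> \<le> (A - 1) * real (kbar n)" using A by (intro mult_right_mono) (auto simp: B_def)
      finally have "B * real k - A * real (kbar n) \<le> - 1" using kb1 by (simp add: algebra_simps)
      then have "(B * real k - A * real (kbar n)) * l \<le> - 1 * l" using l by (intro mult_right_mono) auto
      then show "B * real k * l - A * real (kbar n) * l \<le> - l" by (simp add: algebra_simps)
    qed (use c in auto)
    finally show ?thesis unfolding expl .
  qed
  have "2 / real n + 4 * real k * e + (e + measure (\<Pi>k n) {k<..}) / \<rho>
      \<le> 2 / real n + 4 * exp (- l\<^sup>2) + 2 / (c2 * c4 * c6) * exp (- l\<^sup>2 / 2) + 4 * c1 / (c4 * c6) * (1 / real n)"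
    unfolding add_divide_distrib using t1 t2 t3 by linarith
  with main show ?thesis unfolding l_def by (meson ennreal_leI order_trans)
qed

theorem theorem2p2:
  fixes L :: real
  assumes "L > 0"
  shows "\<exists>M>0. \<forall>c4>0. \<forall>c5>0. \<forall>c6>0. \<forall>c7>0. \<exists>A\<^sub>0>0. \<forall>A\<ge>A\<^sub>0. \<forall>c1>0. \<forall>c2>0. \<forall>c3>0.
    \<forall>(kstar :: nat \<Rightarrow> nat) (kbar :: nat \<Rightarrow> nat) \<Pi>k \<Pi>\<theta> \<Pi>w.
      (\<forall>n\<ge>1. 1 \<le> kstar n \<and> kstar n \<le> kbar n) \<longrightarrow>
      (\<exists>C>0. \<forall>n\<ge>3. real (kbar n) \<le> C * (ln (real n) / ln (ln (real n)))) \<longrightarrow>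
      prior_components L \<Pi>k \<Pi>\<theta> \<Pi>w \<longrightarrow>
      prior_P1 A c1 c2 c3 kbar \<Pi>k \<longrightarrow> prior_P2 c4 c5 \<Pi>w \<longrightarrow> prior_P3 L c6 c7 \<Pi>\<theta> \<longrightarrow>
      (\<lambda>n. \<Squnion>\<nu>\<^sub>0\<in>mixing_dists_k L (kstar n).
        \<integral>\<^sup>+ x. emeasure (posterior n (mixing_prior L (\<Pi>k n) \<Pi>\<theta> \<Pi>w) x)
               {\<nu> \<in> mixing_dists L. wasserstein1 \<nu> \<nu>\<^sub>0 \<ge> M * contraction_rate n (kstar n)}
          \<partial>sample_dist n (gauss_mix \<nu>\<^sub>0))
      \<longlonglongrightarrow> (0 :: ennreal)"

proof (rule exI[of _ "64 * (1 + L) * exp (L + 1)"], intro conjI allI impI)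
  show "0 < 64 * (1 + L) * exp (L + 1)" using assms by simp
next
  fix c4 c5 c6 c7 :: real
  assume c: "0 < c4" "0 < c5" "0 < c6" "0 < c7"
  show "\<exists>A\<^sub>0>0. \<forall>A\<ge>A\<^sub>0. \<forall>c1>0. \<forall>c2>0. \<forall>c3>0.
    \<forall>(kstar :: nat \<Rightarrow> nat) (kbar :: nat \<Rightarrow> nat) \<Pi>k \<Pi>\<theta> \<Pi>w.
      (\<forall>n\<ge>1. 1 \<le> kstar n \<and> kstar n \<le> kbar n) \<longrightarrow>
      (\<exists>C>0. \<forall>n\<ge>3. real (kbar n) \<le> C * (ln (real n) / ln (ln (real n)))) \<longrightarrow>
      prior_components L \<Pi>k \<Pi>\<theta> \<Pi>w \<longrightarrow>
      prior_P1 A c1 c2 c3 kbar \<Pi>k \<longrightarrow> prior_P2 c4 c5 \<Pi>w \<longrightarrow> prior_P3 L c6 c7 \<Pi>\<theta> \<longrightarrow>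
      (\<lambda>n. \<Squnion>\<nu>\<^sub>0\<in>mixing_dists_k L (kstar n).
        \<integral>\<^sup>+ x. emeasure (posterior n (mixing_prior L (\<Pi>k n) \<Pi>\<theta> \<Pi>w) x)
               {\<nu> \<in> mixing_dists L. wasserstein1 \<nu> \<nu>\<^sub>0 \<ge> 64 * (1 + L) * exp (L + 1) * contraction_rate n (kstar n)}
          \<partial>sample_dist n (gauss_mix \<nu>\<^sub>0))
      \<longlonglongrightarrow> (0 :: ennreal)"
  \<comment> \<open>The first summand outweighs the evidence loss in the larger models; the extra 1
    leaves a factor \<open>1 / n\<close>. The threshold thus depends on \<open>c5\<close> and
    \<open>c7\<close> alone.\<close>
  proof (intro exI[of _ "6 * (c5 + c7) + 1"] conjI allI impI)
    show "0 < 6 * (c5 + c7) + 1" using c by simp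
  next
    fix A c1 c2 c3 :: real and kstar kbar :: "nat \<Rightarrow> nat" and \<Pi>k \<Pi>\<theta> \<Pi>w
    assume A: "6 * (c5 + c7) + 1 \<le> A" and c': "0 < c1" "0 < c2" "0 < c3"
      and ks: "\<forall>n\<ge>1. 1 \<le> kstar n \<and> kstar n \<le> kbar n"
      and "\<exists>C>0. \<forall>n\<ge>3. real (kbar n) \<le> C * (ln (real n) / ln (ln (real n)))"
      and pr: "prior_components L \<Pi>k \<Pi>\<theta> \<Pi>w" "prior_P1 A c1 c2 c3 kbar \<Pi>k" "prior_P2 c4 c5 \<Pi>w" "prior_P3 L c6 c7 \<Pi>\<theta>"
    then obtain C where C: "0 < C" "\<forall>n\<ge>3. real (kbar n) \<le> C * (ln (real n) / ln (ln (real n)))" by blast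
    let ?b = "\<lambda>n. 2 / real n + 4 * exp (- (ln (real n))\<^sup>2) + 2 / (c2 * c4 * c6) * exp (- (ln (real n))\<^sup>2 / 2)
        + 4 * c1 / (c4 * c6) * (1 / real n)"
    let ?p = "\<lambda>n. \<Squnion>\<nu>\<^sub>0\<in>mixing_dists_k L (kstar n).
        \<integral>\<^sup>+ x. emeasure (posterior n (mixing_prior L (\<Pi>k n) \<Pi>\<theta> \<Pi>w) x)
               {\<nu> \<in> mixing_dists L. wasserstein1 \<nu> \<nu>\<^sub>0 \<ge> 64 * (1 + L) * exp (L + 1) * contraction_rate n (kstar n)}
          \<partial>sample_dist n (gauss_mix \<nu>\<^sub>0)"
    have n_top: "filterlim (\<lambda>n::nat. real n) at_top sequentially" by (rule filterlim_real_sequentially)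
    have l_top: "filterlim (\<lambda>n::nat. ln (real n)) at_top sequentially"
      by (rule filterlim_compose[OF ln_at_top n_top])
    have ll_top: "filterlim (\<lambda>n::nat. ln (ln (real n))) at_top sequentially"
      by (rule filterlim_compose[OF ln_at_top l_top])
    \<comment> \<open>The threshold on \<open>ln (ln n)\<close> brings \<open>c3 * kbar\<close>
      below \<open>ln n / 4\<close>, the one on \<open>ln n\<close> does the same for
      \<open>6 * (c5 + c7)\<close>; together they give half of \<open>ln n\<close>. The threshold
      \<open>C + 1\<close> serves \<open>kstar < n^6\<close>.\<close>
    have ev: "\<forall>\<^sub>F n in sequentially. ?p n \<le> ennreal (?b n)"
      using filterlim_at_top[THEN iffD1, OF n_top, rule_format, of "12 * exp (4 * L\<^sup>2)"]
        filterlim_at_top[THEN iffD1, OF n_top, rule_format, of "2 * c1"]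
        filterlim_at_top[THEN iffD1, OF n_top, rule_format, of "C + 1"]
        filterlim_at_top[THEN iffD1, OF l_top, rule_format, of "24 * (c5 + c7) + 1"]
        filterlim_at_top[THEN iffD1, OF ll_top, rule_format, of "4 * c3 * C + 1"]
        eventually_ge_at_top[of 3]
    proof eventually_elim
      case (elim n)
      define l where "l = ln (real n)"
      have l: "24 * (c5 + c7) + 1 \<le> l" "1 < l" and ll: "4 * c3 * C + 1 \<le> ln l" "1 \<le> ln l"
        using elim(4,5) c c' C by (auto simp: l_def intro: order_trans[rotated])
      have kb: "real (kbar n) \<le> C * (l / ln l)" using C(2) elim(6) by (simp add: l_def)
      have ks': "1 \<le> kstar n" "kstar n \<le> kbar n" using ks elim(6) by auto
      have "c3 * real (kbar n) \<le> c3 * (C * (l / ln l))" using kb c' by (intro mult_left_mono) auto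
      also have "\<dots> = (4 * c3 * C) * l / (4 * ln l)" by simp
      also have "\<dots> \<le> ln l * l / (4 * ln l)" using ll l by (intro divide_right_mono mult_right_mono) auto
      also have "\<dots> = l / 4" using ll by simp
      finally have kb1: "c3 * real (kbar n) + 6 * (c5 + c7) \<le> ln (real n) / 2"
        using l unfolding l_def[symmetric] by argo
      have "real (kstar n) \<le> C * (l / ln l)" using kb ks' by simp
      also have "\<dots> \<le> C * (l / 1)" using ll l C by (intro mult_left_mono divide_left_mono) auto
      also have "\<dots> \<le> C * real n"
        using C ln_le_minus_one[of "real n"] elim(6) by (intro mult_left_mono) (auto simp: l_def)
      also have "\<dots> < real n * real n" using elim(3,6) by (intro mult_strict_right_mono) auto
      also have "\<dots> \<le> real n ^ 6"
        using power_increasing[of 2 6 "real n"] elim(6) by (simp add: power2_eq_square)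
      finally have k6: "real (kstar n) < real n ^ 6" .
      \<comment> \<open>The bound is the same for every true mixing distribution, so it passes to
        the supremum.\<close>
      show "?p n \<le> ennreal (?b n)"
      proof (rule SUP_least)
        fix \<nu>\<^sub>0 assume \<nu>0: "\<nu>\<^sub>0 \<in> mixing_dists_k L (kstar n)"
        show "(\<integral>\<^sup>+ x. emeasure (posterior n (mixing_prior L (\<Pi>k n) \<Pi>\<theta> \<Pi>w) x)
               {\<nu> \<in> mixing_dists L. wasserstein1 \<nu> \<nu>\<^sub>0 \<ge> 64 * (1 + L) * exp (L + 1) * contraction_rate n (kstar n)}
          \<partial>sample_dist n (gauss_mix \<nu>\<^sub>0)) \<le> ennreal (?b n)"
          using elim l l_def
          by (intro posterior_bound_explicit[OF pr c'(1,2) c A assms ks' \<nu>0 _ elim(1) k6 elim(2) _ kb1]) auto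
      qed
    qed
    have sq_top: "filterlim (\<lambda>n::nat. (ln (real n))\<^sup>2) at_top sequentially"
      by (rule filterlim_pow_at_top[OF _ l_top]) simp
    have sq2_top: "filterlim (\<lambda>n::nat. (ln (real n))\<^sup>2 / 2) at_top sequentially"
      using filterlim_tendsto_pos_mult_at_top[OF tendsto_const _ sq_top, of "1 / 2"] by simp
    have e1: "(\<lambda>n::nat. exp (- (ln (real n))\<^sup>2)) \<longlonglongrightarrow> 0"
      by (rule filterlim_compose[OF exp_at_bot])
         (use filterlim_compose[OF filterlim_uminus_at_bot_at_top sq_top] in simp)
    have e2: "(\<lambda>n::nat. exp (- (ln (real n))\<^sup>2 / 2)) \<longlonglongrightarrow> 0"
      by (rule filterlim_compose[OF exp_at_bot])
         (use filterlim_compose[OF filterlim_uminus_at_bot_at_top sq2_top] in simp)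
    have e3: "(\<lambda>n::nat. 1 / real n) \<longlonglongrightarrow> 0" by (rule lim_1_over_n)
    have "(\<lambda>n. 2 * (1 / real n) + 4 * exp (- (ln (real n))\<^sup>2) + 2 / (c2 * c4 * c6) * exp (- (ln (real n))\<^sup>2 / 2)
        + 4 * c1 / (c4 * c6) * (1 / real n)) \<longlonglongrightarrow> 2 * 0 + 4 * 0 + 2 / (c2 * c4 * c6) * 0 + 4 * c1 / (c4 * c6) * 0"
      by (intro tendsto_add tendsto_mult tendsto_const e1 e2 e3)
    then have "?b \<longlonglongrightarrow> 0" by simp
    then have lim: "(\<lambda>n. ennreal (?b n)) \<longlonglongrightarrow> 0"
      using tendsto_ennrealI by fastforce
    show "?p \<longlonglongrightarrow> 0"
      by (rule tendsto_sandwich[OF _ ev tendsto_const lim]) simp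
  qed
qed

end
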